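(* Fix an integer $d\geq 2$, and natural numbers $N_1,\dots,N_s$ with $N_1+N_2+\cdots+N_s\leq d+1$. Then the fibre product $\mathcal{P}_d(N_1)\times_{\mathcal{P}_d}\mathcal{P}_d(N_2)\times_{\mathcal{P}_d}\cdots\times_{\mathcal{P}_d}\mathcal{P}_d(N_s)$ of the spaces $\mathcal{P}_d(N_1),\dots,\mathcal{P}_d(N_s)$ over the moduli space $\mathcal{P}_d$ of polynomials of degree $d$, that is, the moduli space parametrizing polynomials of degree $d$ with marked points of period $N_1,\dots,N_s$, is rational.
   Context: Work over $\mathbb{C}$. To $\overline{a}=(a_d,\dots,a_0)\in\mathbb{A}^{d+1}$ with $a_d\neq 0$ associate the polynomial $f_{\overline{a}}(z)=\sum_{i=0}^d a_iz^i$. The group of affine transformations $\phi(z)=\alpha z+\beta$, $\alpha\neq 0$, acts on these polynomials by conjugation, $f^\phi=\phi\circ f\circ\phi^{-1}$, and $\mathcal{P}_d$, the moduli space of polynomials of degree $d$, denotes the quotient variety. Define polynomials $\Phi_k(a_d,\dots,a_0,z)$ by $f_{\overline{a}}^N(z)-z=\prod_{k\mid N}\Phi_k(a_d,\dots,a_0,z)$ for all $N\geq 1$, where $f^N$ is the $N$-th iterate; solutions of $\Phi_N=0$ correspond to polynomials with a marked point of formal period $N$. The moduli space $\mathcal{P}_d(N)$ of polynomials of degree $d$ with a marked point of period $N$ is the quotient of the variety $\{\Phi_N=0\}$ by the action $(\overline{a},z)\mapsto(\overline{a}^\phi,\phi(z))$ of the affine transformations, where $f_{\overline{a}^\phi}=\phi\circ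 f_{\overline{a}}\circ\phi^{-1}$. It maps to $\mathcal{P}_d$ by forgetting the marked point, and the fibre product is taken with respect to these maps. A variety is rational if it is birational to a projective space; here the projective space is $\mathbb{P}^{d-1}$.
   Formalization: If some N_i coincide, the fibre product is reducible (e.g. d=2, periods 1,1: two lines), so it is not rational as stated; rationality of the fibre product is proved for pairwise distinct N_i, and for arbitrary N_i rationality of every irreducible component. *)

theory Defs
  imports
    "HOL-Analysis.Analysis"
    "HOL-Computational_Algebra.Computational_Algebra"
begin

section \<open>Spaces with functions\<close>

text \<open>
  Varieties over the complex numbers are treated as point sets with a Zariski topology and a sheaf
  of complex-valued regular functions (Serre, Springer). A function is total in HOL; membership in
  \<open>regular X W\<close> depends only on its values on \<open>W\<close>, and only open \<open>W\<close> are relevant.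
\<close>

record 'a fun_space =
  zariski :: "'a topology"
  regular :: "'a set \<Rightarrow> ('a \<Rightarrow> complex) set"

abbreviation points :: "'a fun_space \<Rightarrow> 'a set"
  where "points X \<equiv> topspace (zariski X)"

definition morphism :: "'a fun_space \<Rightarrow> 'b fun_space \<Rightarrow> ('a \<Rightarrow> 'b) \<Rightarrow> bool" where
  "morphism X Y f \<longleftrightarrow>
     continuous_map (zariski X) (zariski Y) f \<and>
     (\<forall>V. openin (zariski Y) V \<longrightarrow>
        (\<forall>g \<in> regular Y V. g \<circ> f \<in> regular X {x \<in> points X. f x \<in> V}))"

definition isomorphic :: "'a fun_space \<Rightarrow> 'b fun_space \<Rightarrow> bool" where
  "isomorphic X Y \<longleftrightarrow>
     (\<exists>f g. morphism X Y f \<and> morphism Y X g \<and>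
        (\<forall>x \<in> points X. g (f x) = x) \<and> (\<forall>y \<in> points Y. f (g y) = y))"


subsection \<open>The structure generated by local functions\<close>

text \<open>
  A local function on \<open>A\<close> is a pair of a domain \<open>U \<subseteq> A\<close> and a function on it. From a set \<open>L\<close> of
  local functions we form the algebra \<open>local_algebra A L\<close> of polynomial expressions in them; the
  sets where a member does not vanish are a basis of the topology, and the regular functions are
  those that are locally quotients of two members. This is the coarsest such structure on \<open>A\<close> for
  which the members of \<open>L\<close> are regular on open domains. It specialises to the usual structure on
  a (locally closed) subset of affine space, on a subvariety, and on a product of varieties.
\<close>

inductive_set local_algebra ::
  "'a set \<Rightarrow> ('a set \<times> ('a \<Rightarrow> complex)) set \<Rightarrow> ('a set \<times> ('a \<Rightarrow> complex)) set"
  for A L where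
  const: "(A, \<lambda>_. c) \<in> local_algebra A L"
| gen: "(U, g) \<in> L \<Longrightarrow> (U, g) \<in> local_algebra A L"
| add: "(U, g) \<in> local_algebra A L \<Longrightarrow> (V, h) \<in> local_algebra A L \<Longrightarrow>
    (U \<inter> V, \<lambda>x. g x + h x) \<in> local_algebra A L"
| mult: "(U, g) \<in> local_algebra A L \<Longrightarrow> (V, h) \<in> local_algebra A L \<Longrightarrow>
    (U \<inter> V, \<lambda>x. g x * h x) \<in> local_algebra A L"

definition generated_space ::
  "'a set \<Rightarrow> ('a set \<times> ('a \<Rightarrow> complex)) set \<Rightarrow> 'a fun_space" where
  "generated_space A L =
     \<lparr> zariski = topology_generated_by {{x \<in> U. g x \<noteq> 0} | U g. (U, g) \<in> local_algebra A L},
       regular = (\<lambda>W. {h. \<forall>x \<in> W. \<exists>U g V k.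
          (U, g) \<in> local_algebra A L \<and> (V, k) \<in> local_algebra A L \<and>
          x \<in> U \<inter> V \<and> k x \<noteq> 0 \<and>
          (\<forall>y \<in> W \<inter> U \<inter> V. k y \<noteq> 0 \<longrightarrow> h y = g y / k y)}) \<rparr>"

text \<open>Subsets \<open>A\<close> of an affine space, given by a set \<open>C\<close> of coordinate functions.\<close>

definition affine_space_on :: "'a set \<Rightarrow> ('a \<Rightarrow> complex) set \<Rightarrow> 'a fun_space" where
  "affine_space_on A C = generated_space A {(A, c) | c. c \<in> C}"

definition pullback_functions ::
  "'a set \<Rightarrow> ('a \<Rightarrow> 'b) \<Rightarrow> 'b fun_space \<Rightarrow> ('a set \<times> ('a \<Rightarrow> complex)) set" where
  "pullback_functions A f X =
     {({x \<in> A. f x \<in> U}, g \<circ> f) | U g. openin (zariski X) U \<and> g \<in> regular X U}"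

definition subspace_of :: "'a fun_space \<Rightarrow> 'a set \<Rightarrow> 'a fun_space" where
  "subspace_of X A = generated_space A (pullback_functions A (\<lambda>x. x) X)"

text \<open>
  The fibre product over \<open>S\<close> of a family \<open>X i\<close>, \<open>i \<in> I\<close>, with structure maps \<open>\<rho> i\<close>. The point of
  the base is recorded too, so that the fibre product of the empty family is \<open>S\<close>.
\<close>

definition fibre_product ::
  "'b fun_space \<Rightarrow> 'i set \<Rightarrow> ('i \<Rightarrow> 'a fun_space) \<Rightarrow> ('i \<Rightarrow> 'a \<Rightarrow> 'b) \<Rightarrow>
    ('b \<times> ('i \<Rightarrow> 'a)) fun_space" where
  "fibre_product S I X \<rho> =
     (let A = {(p, q). p \<in> points S \<and> q \<in> (\<Pi>\<^sub>E i\<in>I. points (X i)) \<and> (\<forall>i\<in>I. \<rho> i (q i) = p)}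
      in generated_space A
           (pullback_functions A fst S \<union> (\<Union>i\<in>I. pullback_functions A (\<lambda>x. snd x i) (X i))))"


subsection \<open>Quotients\<close>

text \<open>
  The quotient by an equivalence relation (the orbit relation of a group action): points are the
  classes, a set of classes is open iff its union is, and regular functions are the invariant
  regular functions.
\<close>

definition quotient_space :: "'a fun_space \<Rightarrow> ('a \<times> 'a) set \<Rightarrow> 'a set fun_space" where
  "quotient_space X r =
     \<lparr> zariski = topology (\<lambda>V. V \<subseteq> points X // r \<and> openin (zariski X) (\<Union>V \<inter> points X)),
       regular = (\<lambda>V. {h. (\<lambda>x. h (r `` {x})) \<in> regular X (\<Union>V \<inter> points X)}) \<rparr>"

lemma openin_quotient_space:
  assumes "equiv UNIV r"
  shows "openin (zariski (quotient_space X r)) V \<longleftrightarrow>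
           V \<subseteq> points X // r \<and> openin (zariski X) (\<Union>V \<inter> points X)"
proof -
  have "istopology (\<lambda>V. V \<subseteq> points X // r \<and> openin (zariski X) (\<Union>V \<inter> points X))"
    unfolding istopology_def
  proof (intro conjI allI impI)
    fix S T
    assume S: "S \<subseteq> points X // r \<and> openin (zariski X) (\<Union>S \<inter> points X)"
      and T: "T \<subseteq> points X // r \<and> openin (zariski X) (\<Union>T \<inter> points X)"
    show "S \<inter> T \<subseteq> points X // r" using S by blast
    have "s = t" if "s \<in> S" "t \<in> T" "x \<in> s" "x \<in> t" for s t x
    proof -
      have "s \<in> UNIV // r" "t \<in> UNIV // r"
        using that S T by (auto simp: quotient_def)
      then show ?thesis using quotient_disj[OF assms] that by blast
    qed
    then have "\<Union>(S \<inter> T) \<inter> points X = (\<Union>S \<inter> points X) \<inter> (\<Union>T \<inter> points X)"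
      by blast
    then show "openin (zariski X) (\<Union>(S \<inter> T) \<inter> points X)"
      using S T by auto
  next
    fix K
    assume K: "\<forall>V\<in>K. V \<subseteq> points X // r \<and> openin (zariski X) (\<Union>V \<inter> points X)"
    show "\<Union>K \<subseteq> points X // r" using K by blast
    have "\<Union>(\<Union>K) \<inter> points X = \<Union>((\<lambda>V. \<Union>V \<inter> points X) ` K)" by blast
    moreover have "openin (zariski X) (\<Union>((\<lambda>V. \<Union>V \<inter> points X) ` K))"
      using K by (intro openin_Union) blast
    ultimately show "openin (zariski X) (\<Union>(\<Union>K) \<inter> points X)" by simp
  qed
  then show ?thesis by (simp add: quotient_space_def)
qed


subsection \<open>Projective space, irreducible components, birational equivalence\<close>

definition scaling_rel :: "((nat \<Rightarrow> complex) \<times> (nat \<Rightarrow> complex)) set" where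
  "scaling_rel = {(x, y). \<exists>c. c \<noteq> 0 \<and> y = (\<lambda>i. c * x i)}"

definition projective_space :: "nat \<Rightarrow> (nat \<Rightarrow> complex) set fun_space" where
  "projective_space n =
     quotient_space
       (affine_space_on {x. (\<forall>i>n. x i = 0) \<and> (\<exists>i\<le>n. x i \<noteq> 0)} {\<lambda>x. x i | i. i \<le> n})
       scaling_rel"

definition irreducible_in :: "'a topology \<Rightarrow> 'a set \<Rightarrow> bool" where
  "irreducible_in T C \<longleftrightarrow> C \<subseteq> topspace T \<and> C \<noteq> {} \<and>
     (\<forall>U V. openin T U \<longrightarrow> openin T V \<longrightarrow> U \<inter> C \<noteq> {} \<longrightarrow> V \<inter> C \<noteq> {} \<longrightarrow> U \<inter> V \<inter> C \<noteq> {})"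

definition irreducible_component :: "'a fun_space \<Rightarrow> 'a set \<Rightarrow> bool" where
  "irreducible_component X C \<longleftrightarrow> irreducible_in (zariski X) C \<and>
     (\<forall>D. irreducible_in (zariski X) D \<longrightarrow> C \<subseteq> D \<longrightarrow> D = C)"

definition birational :: "'a fun_space \<Rightarrow> 'b fun_space \<Rightarrow> bool" where
  "birational X Y \<longleftrightarrow>
     (\<exists>U V. openin (zariski X) U \<and> zariski X closure_of U = points X \<and>
            openin (zariski Y) V \<and> zariski Y closure_of V = points Y \<and>
            isomorphic (subspace_of X U) (subspace_of Y V))"


section \<open>Moduli of polynomials with marked points\<close>

definition poly_iterate :: "complex poly \<Rightarrow> nat \<Rightarrow> complex poly" where
  "poly_iterate f N = ((\<lambda>p. f \<circ>\<^sub>p p) ^^ N) [:0, 1:]"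

text \<open>
  For \<open>degree f \<ge> 2\<close> the polynomials \<open>f\<^sup>N(z) - z\<close> are nonzero, so the identities below
  determine \<open>dynatomic f k\<close> for all \<open>k \<ge> 1\<close>; it is then the specialisation at the coefficients
  of \<open>f\<close> of the universal polynomial \<open>\<Phi>\<^sub>k(a\<^sub>d, \<dots>, a\<^sub>0, z)\<close>. The value at \<open>k = 0\<close> is irrelevant.
\<close>

definition dynatomic :: "complex poly \<Rightarrow> nat \<Rightarrow> complex poly" where
  "dynatomic f =
     (SOME \<Phi>. \<forall>N\<ge>1. poly_iterate f N - [:0, 1:] = (\<Prod>k | k dvd N. \<Phi> k))"

definition affine_conj :: "complex \<Rightarrow> complex \<Rightarrow> complex poly \<Rightarrow> complex poly" where
  "affine_conj \<alpha> \<beta> f = [:\<beta>, \<alpha>:] \<circ>\<^sub>p f \<circ>\<^sub>p [:- \<beta> / \<alpha>, 1 / \<alpha>:]"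

definition conj_rel :: "(complex poly \<times> complex poly) set" where
  "conj_rel = {(f, g). \<exists>\<alpha> \<beta>. \<alpha> \<noteq> 0 \<and> g = affine_conj \<alpha> \<beta> f}"

definition marked_conj_rel :: "((complex poly \<times> complex) \<times> (complex poly \<times> complex)) set" where
  "marked_conj_rel =
     {((f, z), (g, w)). \<exists>\<alpha> \<beta>. \<alpha> \<noteq> 0 \<and> g = affine_conj \<alpha> \<beta> f \<and> w = \<alpha> * z + \<beta>}"

definition poly_moduli :: "nat \<Rightarrow> complex poly set fun_space" where
  "poly_moduli d =
     quotient_space (affine_space_on {f. degree f = d} {\<lambda>f. coeff f i | i. i \<le> d}) conj_rel"

definition marked_poly_moduli :: "nat \<Rightarrow> nat \<Rightarrow> (complex poly \<times> complex) set fun_space" where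
  "marked_poly_moduli d N =
     quotient_space
       (affine_space_on {(f, z). degree f = d \<and> poly (dynatomic f N) z = 0}
          ({\<lambda>(f, z). coeff f i | i. i \<le> d} \<union> {snd}))
       marked_conj_rel"

text \<open>The image under \<open>fst\<close> of the orbit of \<open>(f, z)\<close> is the orbit of \<open>f\<close>.\<close>

definition forget_marking :: "(complex poly \<times> complex) set \<Rightarrow> complex poly set" where
  "forget_marking Q = fst ` Q"

definition marked_fibre_product ::
  "nat \<Rightarrow> nat \<Rightarrow> (nat \<Rightarrow> nat) \<Rightarrow>
    (complex poly set \<times> (nat \<Rightarrow> (complex poly \<times> complex) set)) fun_space" where
  "marked_fibre_product d s N =
     fibre_product (poly_moduli d) {1..s} (\<lambda>i. marked_poly_moduli d (N i)) (\<lambda>i. forget_marking)"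

text \<open>
  If \<open>N i = N j\<close> for some \<open>i \<noteq> j\<close>, the fibre product is reducible: it contains components on which
  the \<open>j\<close>-th marked point is an iterate of the \<open>i\<close>-th. For instance, for \<open>d = 2\<close> and periods
  \<open>1, 1\<close>, in the normal form \<open>z\<^sup>2 + c\<close>, it is \<open>{(z, w). z - z\<^sup>2 = w - w\<^sup>2}\<close>, two lines. Rationality of the fibre product then
  means rationality of each component.
\<close>

end

theory Submission
  imports Defs "HOL-Computational_Algebra.Field_as_Ring"
begin

text \<open>
  The idea of the proof is interpolation. A polynomial \<open>f\<close> of degree \<open>d\<close> with marked points of exact
  periods \<open>N\<^sub>1, \<dots>, N\<^sub>s\<close> carries the finite set \<open>W\<close> of all points on the marked cycles, on which it acts
  as a permutation, and \<open>W\<close> has at most \<open>N\<^sub>1 + \<dots> + N\<^sub>s \<le> d + 1\<close> elements. Conversely, if distinct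
  points \<open>w\<^sub>k\<close> and a self-map \<open>\<sigma>\<close> of the indices are given, then the polynomials of degree at most \<open>d\<close>
  with \<open>f(w\<^sub>k) = w\<^bsub>\<sigma>(k)\<^esub>\<close> are parametrised by their coefficients of degree at least \<open>card W\<close>, since the
  lower ones are found by Lagrange interpolation. The affine group is used up by moving two points
  that are attached to \<open>f\<close> equivariantly to 0 and 1: two of the points \<open>w\<^sub>k\<close> if there are two; in the
  other cases the center of \<open>f\<close> (the mean of the roots) together with the only \<open>w\<^sub>k\<close>, or with the
  image of the center. What remains are \<open>d - 1\<close> free coordinates.

  In general the cycles of different marked points can coincide. The locus of exact periods is
  therefore cut into finitely many strata, according to which iterates of the marked points are
  equal (\<open>stratum\<close>). Each stratum is locally closed, and the construction above identifies it with
  a nonempty open subset of affine space (\<open>slice_coords_morphism\<close>, \<open>param_marked_morphism\<close>); in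
  particular it is irreducible. If the periods are pairwise distinct there is just one stratum.

  Two points need more work. First, the regular functions on the fibre product are those coming from
  the factors, so that the normalised coordinates have to be written in terms of functions on each
  factor. Where the center \<open>c\<close> of \<open>f\<close> is not fixed by \<open>f\<close>, conjugating with the affine map that sends
  \<open>c\<close> and \<open>f(c)\<close> to 0 and 1 gives functions on each factor which together separate the points of the
  fibre product (\<open>regular_point_poly\<close>, \<open>regular_point_mark\<close>). Secondly, the locus of exact periods
  is dense (\<open>exact_locus_dense\<close>): the roots of the dynatomic polynomials move continuously with \<open>f\<close>,
  and arbitrarily close to every \<open>f\<close> there are polynomials all of whose points of period \<open>N\<^sub>i\<close> are
  simple periodic points (\<open>generic_approximation\<close>), hence of exact period \<open>N\<^sub>i\<close> when they are roots of
  the dynatomic polynomial. So every irreducible component is the closure of a stratum, and contains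
  this stratum as an open dense subset. The same approximation also shows that the
  divisions which define the dynatomic polynomials are exact (\<open>dynatomic_rec_properties\<close>).
\<close>

section \<open>Regular functions and morphisms\<close>

text \<open>
  A sheaf of algebras of functions in which a function is invertible where it does not vanish.
  The last axiom combines restriction, gluing, and independence of the values outside the set.
  Besides the varieties that occur here, also the space of convergent sequences below is of this
  kind, so that morphisms and limits obey the same criterion.
\<close>

locale ringed_space =
  fixes X :: "'a fun_space"
  assumes regular_const: "openin (zariski X) W \<Longrightarrow> (\<lambda>_. c) \<in> regular X W"
    and regular_add: "openin (zariski X) W \<Longrightarrow> g \<in> regular X W \<Longrightarrow> h \<in> regular X W \<Longrightarrow>
          (\<lambda>x. g x + h x) \<in> regular X W"
    and regular_mult: "openin (zariski X) W \<Longrightarrow> g \<in> regular X W \<Longrightarrow> h \<in> regular X W \<Longrightarrow>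
          (\<lambda>x. g x * h x) \<in> regular X W"
    and openin_nonzero: "openin (zariski X) W \<Longrightarrow> g \<in> regular X W \<Longrightarrow>
          openin (zariski X) {x \<in> W. g x \<noteq> 0}"
    and regular_inverse_nonzero: "openin (zariski X) W \<Longrightarrow> g \<in> regular X W \<Longrightarrow>
          (\<lambda>x. inverse (g x)) \<in> regular X {x \<in> W. g x \<noteq> 0}"
    and regular_local: "openin (zariski X) W \<Longrightarrow>
          (\<And>x. x \<in> W \<Longrightarrow> \<exists>W' h. openin (zariski X) W' \<and> x \<in> W' \<and> h \<in> regular X W' \<and>
             (\<forall>y \<in> W \<inter> W'. g y = h y)) \<Longrightarrow> g \<in> regular X W"
begin

lemma regular_restrict:
  assumes "openin (zariski X) W" "g \<in> regular X W" "openin (zariski X) W'" "W' \<subseteq> W"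
  shows "g \<in> regular X W'"
  by (rule regular_local) (use assms in blast)+

lemma regular_cong:
  assumes "openin (zariski X) W" "g \<in> regular X W" "\<And>x. x \<in> W \<Longrightarrow> h x = g x"
  shows "h \<in> regular X W"
  by (rule regular_local) (use assms in blast)+

lemma regular_uminus:
  assumes "openin (zariski X) W" "g \<in> regular X W"
  shows "(\<lambda>x. - g x) \<in> regular X W"
  using regular_mult[OF assms(1) regular_const[OF assms(1), of "-1"] assms(2)] by simp

lemma regular_diff:
  assumes "openin (zariski X) W" "g \<in> regular X W" "h \<in> regular X W"
  shows "(\<lambda>x. g x - h x) \<in> regular X W"
  using regular_add[OF assms(1,2) regular_uminus[OF assms(1,3)]] by simp

lemma regular_inverse:
  assumes "openin (zariski X) W" "g \<in> regular X W" "\<And>x. x \<in> W \<Longrightarrow> g x \<noteq> 0"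
  shows "(\<lambda>x. inverse (g x)) \<in> regular X W"
proof -
  have "{x \<in> W. g x \<noteq> 0} = W" using assms(3) by blast
  then show ?thesis using regular_inverse_nonzero[OF assms(1,2)] by simp
qed

lemma regular_divide:
  assumes "openin (zariski X) W" "g \<in> regular X W" "h \<in> regular X W" "\<And>x. x \<in> W \<Longrightarrow> h x \<noteq> 0"
  shows "(\<lambda>x. g x / h x) \<in> regular X W"
  using regular_mult[OF assms(1,2) regular_inverse[OF assms(1,3,4)]] by (simp add: divide_inverse)

lemma regular_power:
  assumes "openin (zariski X) W" "g \<in> regular X W"
  shows "(\<lambda>x. g x ^ n) \<in> regular X W"
  by (induction n) (use assms in \<open>auto intro: regular_const regular_mult\<close>)

lemma regular_sum:
  assumes "openin (zariski X) W" "\<And>i. i \<in> I \<Longrightarrow> g i \<in> regular X W"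
  shows "(\<lambda>x. \<Sum>i\<in>I. g i x) \<in> regular X W"
  using assms(2)
  by (induction I rule: infinite_finite_induct)
     (use assms(1) in \<open>auto intro!: regular_const regular_add\<close>)

end

subsection \<open>Generated structures\<close>

context
  fixes A :: "'a set" and L :: "('a set \<times> ('a \<Rightarrow> complex)) set"
  assumes L: "fst ` L \<subseteq> Pow A"
begin

lemma local_algebra_subset: "(U, g) \<in> local_algebra A L \<Longrightarrow> U \<subseteq> A"
  by (induction rule: local_algebra.induct) (use L in \<open>force+\<close>)

lemma local_algebra_restrict:
  assumes "(U, g) \<in> local_algebra A L" "(V, h) \<in> local_algebra A L"
  shows "(U \<inter> V, g) \<in> local_algebra A L"
proof -
  have "(U \<inter> (V \<inter> A), \<lambda>x. g x + h x * 0) \<in> local_algebra A L"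
    by (intro local_algebra.add local_algebra.mult local_algebra.const assms)
  moreover have "V \<inter> A = V" using local_algebra_subset[OF assms(2)] by blast
  ultimately show ?thesis by simp
qed

lemma openin_generated_space:
  "openin (zariski (generated_space A L)) W \<longleftrightarrow>
     (\<forall>x\<in>W. \<exists>U g. (U, g) \<in> local_algebra A L \<and> x \<in> U \<and> g x \<noteq> 0 \<and> {y \<in> U. g y \<noteq> 0} \<subseteq> W)"
    (is "_ \<longleftrightarrow> ?P W")
proof -
  let ?B = "{{x \<in> U. g x \<noteq> 0} | U g. (U, g) \<in> local_algebra A L}"
  have basis: "openin (topology_generated_by ?B) W \<Longrightarrow> ?P W"
  proof -
    assume "openin (topology_generated_by ?B) W"
    then have "generate_topology_on ?B W" by (simp add: openin_topology_generated_by_iff)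
    then show "?P W"
    proof induction
      case (Int a b)
      show ?case
      proof
        fix x assume x: "x \<in> a \<inter> b"
        obtain U g where 1: "(U, g) \<in> local_algebra A L" "x \<in> U" "g x \<noteq> 0" "{y \<in> U. g y \<noteq> 0} \<subseteq> a"
          using Int.IH(1) x by blast
        obtain V h where 2: "(V, h) \<in> local_algebra A L" "x \<in> V" "h x \<noteq> 0" "{y \<in> V. h y \<noteq> 0} \<subseteq> b"
          using Int.IH(2) x by blast
        have "{y \<in> U \<inter> V. g y * h y \<noteq> 0} \<subseteq> a \<inter> b" using 1(4) 2(4) by auto
        moreover have "(U \<inter> V, \<lambda>x. g x * h x) \<in> local_algebra A L"
          by (rule local_algebra.mult) fact+
        ultimately show "\<exists>U g. (U, g) \<in> local_algebra A L \<and> x \<in> U \<and> g x \<noteq> 0 \<and> {y \<in> U. g y \<noteq> 0} \<subseteq> a \<inter> b"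
          using 1 2 by (intro exI[of _ "U \<inter> V"] exI[of _ "\<lambda>x. g x * h x"]) auto
      qed
    next
      case (UN K)
      show ?case
      proof
        fix x assume "x \<in> \<Union>K"
        then obtain k where k: "k \<in> K" "x \<in> k" by blast
        then obtain U g where "(U, g) \<in> local_algebra A L" "x \<in> U" "g x \<noteq> 0" "{y \<in> U. g y \<noteq> 0} \<subseteq> k"
          using UN by meson
        then show "\<exists>U g. (U, g) \<in> local_algebra A L \<and> x \<in> U \<and> g x \<noteq> 0 \<and> {y \<in> U. g y \<noteq> 0} \<subseteq> \<Union>K"
          using k by blast
      qed
    qed blast+
  qed
  have "openin (topology_generated_by ?B) W" if P: "?P W"
  proof (subst openin_subopen, intro ballI)
      fix x assume "x \<in> W"
      with P obtain U g where "(U, g) \<in> local_algebra A L" "x \<in> U" "g x \<noteq> 0" "{y \<in> U. g y \<noteq> 0} \<subseteq> W"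
        by meson
      then show "\<exists>T. openin (topology_generated_by ?B) T \<and> x \<in> T \<and> T \<subseteq> W"
        by (intro exI[of _ "{y \<in> U. g y \<noteq> 0}"] conjI topology_generated_by_Basis) auto
    qed
  with basis show ?thesis unfolding generated_space_def fun_space.simps by (rule iffI)
qed

lemma openin_local_algebra_nonzero:
  "(U, g) \<in> local_algebra A L \<Longrightarrow> openin (zariski (generated_space A L)) {x \<in> U. g x \<noteq> 0}"
  unfolding openin_generated_space by blast

lemma openin_local_algebra:
  assumes "(U, g) \<in> local_algebra A L"
  shows "openin (zariski (generated_space A L)) U"
proof -
  have "(A \<inter> U, \<lambda>_. 1) \<in> local_algebra A L"
    by (rule local_algebra_restrict[OF local_algebra.const assms])
  from openin_local_algebra_nonzero[OF this] show ?thesis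
    using local_algebra_subset[OF assms] by (simp add: Int_absorb1)
qed

lemma points_generated_space: "points (generated_space A L) = A"
proof
  show "A \<subseteq> points (generated_space A L)"
    by (rule openin_subset, rule openin_local_algebra, rule local_algebra.const)
  show "points (generated_space A L) \<subseteq> A"
  proof
    fix x assume "x \<in> points (generated_space A L)"
    with openin_topspace[of "zariski (generated_space A L)"]
    obtain U g where "(U, g) \<in> local_algebra A L" "x \<in> U"
      unfolding openin_generated_space by meson
    then show "x \<in> A" using local_algebra_subset by blast
  qed
qed

lemma regular_generatedI:
  assumes "\<And>x. x \<in> W \<Longrightarrow> \<exists>U g k. (U, g) \<in> local_algebra A L \<and> (U, k) \<in> local_algebra A L \<and>
     x \<in> U \<and> k x \<noteq> 0 \<and> (\<forall>y \<in> W \<inter> U. k y \<noteq> 0 \<longrightarrow> h y = g y / k y)"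
  shows "h \<in> regular (generated_space A L) W"
proof -
  have "\<exists>U g V k. (U, g) \<in> local_algebra A L \<and> (V, k) \<in> local_algebra A L \<and>
          x \<in> U \<inter> V \<and> k x \<noteq> 0 \<and> (\<forall>y \<in> W \<inter> U \<inter> V. k y \<noteq> 0 \<longrightarrow> h y = g y / k y)" if x: "x \<in> W" for x
  proof -
    obtain U g k where "(U, g) \<in> local_algebra A L" "(U, k) \<in> local_algebra A L"
      "x \<in> U" "k x \<noteq> 0" "\<forall>y \<in> W \<inter> U. k y \<noteq> 0 \<longrightarrow> h y = g y / k y"
      using assms[OF x] by blast
    then show ?thesis
      by (intro exI[of _ U] exI[of _ g] exI[of _ k]) auto
  qed
  then show ?thesis by (simp add: generated_space_def)
qed

text \<open>
  Restricting both to the intersection of their domains, numerator and denominator of a local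
  fraction may be taken with the same domain.
\<close>

lemma regular_generatedE:
  assumes "h \<in> regular (generated_space A L) W" "x \<in> W"
  obtains U g k where "(U, g) \<in> local_algebra A L" "(U, k) \<in> local_algebra A L" "x \<in> U" "k x \<noteq> 0"
    "\<And>y. y \<in> W \<Longrightarrow> y \<in> U \<Longrightarrow> k y \<noteq> 0 \<Longrightarrow> h y = g y / k y"
proof -
  have "\<forall>x \<in> W. \<exists>U g V k. (U, g) \<in> local_algebra A L \<and> (V, k) \<in> local_algebra A L \<and>
          x \<in> U \<inter> V \<and> k x \<noteq> 0 \<and> (\<forall>y \<in> W \<inter> U \<inter> V. k y \<noteq> 0 \<longrightarrow> h y = g y / k y)"
    using assms(1) by (simp add: generated_space_def)
  from bspec[OF this assms(2)] obtain U g V k where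
    *: "(U, g) \<in> local_algebra A L" "(V, k) \<in> local_algebra A L"
       "x \<in> U \<inter> V" "k x \<noteq> 0" "\<forall>y \<in> W \<inter> U \<inter> V. k y \<noteq> 0 \<longrightarrow> h y = g y / k y"
    by (elim exE conjE)
  show thesis
  proof (rule that[of "U \<inter> V" g k])
    show "(U \<inter> V, g) \<in> local_algebra A L" by (rule local_algebra_restrict[OF *(1,2)])
    have "(V \<inter> U, k) \<in> local_algebra A L" by (rule local_algebra_restrict[OF *(2,1)])
    then show "(U \<inter> V, k) \<in> local_algebra A L" by (simp add: Int_commute)
  qed (use * in auto)
qed

lemma regular_local_algebra:
  assumes "(U, g) \<in> local_algebra A L"
  shows "g \<in> regular (generated_space A L) U"
proof (rule regular_generatedI)
  fix x assume "x \<in> U"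
  have "(A \<inter> U, \<lambda>_. 1) \<in> local_algebra A L"
    by (rule local_algebra_restrict[OF local_algebra.const assms])
  then have "(U, \<lambda>_. 1) \<in> local_algebra A L"
    using local_algebra_subset[OF assms] by (simp add: Int_absorb1)
  then show "\<exists>V h k. (V, h) \<in> local_algebra A L \<and> (V, k) \<in> local_algebra A L \<and>
     x \<in> V \<and> k x \<noteq> 0 \<and> (\<forall>y \<in> U \<inter> V. k y \<noteq> 0 \<longrightarrow> g y = h y / k y)"
    using assms \<open>x \<in> U\<close> by (intro exI[of _ U] exI[of _ g] exI[of _ "\<lambda>_. 1"]) simp
qed

text \<open>
  Local fractions are closed under the ring operations, and also under inversion where they do not
  vanish, because the local algebra contains all products of numerators and denominators.
\<close>

lemma ringed_space_generated: "ringed_space (generated_space A L)"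
proof -
  let ?X = "generated_space A L"
  note mult = local_algebra.mult[where A = A and L = L]
  note add = local_algebra.add[where A = A and L = L]
  have mult': "(U, \<lambda>x. g x * h x) \<in> local_algebra A L"
    if "(U, g) \<in> local_algebra A L" "(U, h) \<in> local_algebra A L" for U g h
    using mult[OF that] by simp
  have add': "(U, \<lambda>x. g x + h x) \<in> local_algebra A L"
    if "(U, g) \<in> local_algebra A L" "(U, h) \<in> local_algebra A L" for U g h
    using add[OF that] by simp
  have both: "\<exists>U g1 k1 h1 l1. (U, g1) \<in> local_algebra A L \<and> (U, k1) \<in> local_algebra A L \<and>
      (U, h1) \<in> local_algebra A L \<and> (U, l1) \<in> local_algebra A L \<and> x \<in> U \<and> k1 x \<noteq> 0 \<and> l1 x \<noteq> 0 \<and>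
      (\<forall>y \<in> W \<inter> U. k1 y \<noteq> 0 \<longrightarrow> l1 y \<noteq> 0 \<longrightarrow> g y = g1 y / k1 y \<and> h y = h1 y / l1 y)"
    if g: "g \<in> regular ?X W" and h: "h \<in> regular ?X W" and "x \<in> W" for W g h x
  proof -
    obtain U g1 k1 where 1: "(U, g1) \<in> local_algebra A L" "(U, k1) \<in> local_algebra A L" "x \<in> U"
        "k1 x \<noteq> 0" "\<And>y. y \<in> W \<Longrightarrow> y \<in> U \<Longrightarrow> k1 y \<noteq> 0 \<Longrightarrow> g y = g1 y / k1 y"
      using g \<open>x \<in> W\<close> by (rule regular_generatedE) blast
    obtain V h1 l1 where 2: "(V, h1) \<in> local_algebra A L" "(V, l1) \<in> local_algebra A L" "x \<in> V"
        "l1 x \<noteq> 0" "\<And>y. y \<in> W \<Longrightarrow> y \<in> V \<Longrightarrow> l1 y \<noteq> 0 \<Longrightarrow> h y = h1 y / l1 y"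
      using h \<open>x \<in> W\<close> by (rule regular_generatedE) blast
    have "(U \<inter> V, g1) \<in> local_algebra A L" "(U \<inter> V, k1) \<in> local_algebra A L"
      "(V \<inter> U, h1) \<in> local_algebra A L" "(V \<inter> U, l1) \<in> local_algebra A L"
      by (rule local_algebra_restrict; fact)+
    then show ?thesis using 1(3-5) 2(3-5)
      by (intro exI[of _ "U \<inter> V"] exI[of _ g1] exI[of _ k1] exI[of _ h1] exI[of _ l1])
         (simp add: Int_commute)
  qed
  show ?thesis
  proof
    fix W c assume W: "openin (zariski ?X) W"
    have "W \<subseteq> A" using openin_subset[OF W] points_generated_space by simp
    then show "(\<lambda>_. c) \<in> regular ?X W"
      by (intro regular_generatedI exI[of _ A] exI[of _ "\<lambda>_. c"] exI[of _ "\<lambda>_. 1"])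
         (auto intro: local_algebra.const)
  next
    fix W g h assume W: "openin (zariski ?X) W" and g: "g \<in> regular ?X W" and h: "h \<in> regular ?X W"
    show "(\<lambda>x. g x + h x) \<in> regular ?X W"
    proof (rule regular_generatedI)
      fix x assume "x \<in> W"
      from both[OF g h this] obtain U g1 k1 h1 l1 where *: "(U, g1) \<in> local_algebra A L"
         "(U, k1) \<in> local_algebra A L" "(U, h1) \<in> local_algebra A L" "(U, l1) \<in> local_algebra A L"
         "x \<in> U" "k1 x \<noteq> 0" "l1 x \<noteq> 0"
         "\<forall>y \<in> W \<inter> U. k1 y \<noteq> 0 \<longrightarrow> l1 y \<noteq> 0 \<longrightarrow> g y = g1 y / k1 y \<and> h y = h1 y / l1 y"
        by (elim exE conjE)
      show "\<exists>U g' k. (U, g') \<in> local_algebra A L \<and> (U, k) \<in> local_algebra A L \<and>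
          x \<in> U \<and> k x \<noteq> 0 \<and> (\<forall>y \<in> W \<inter> U. k y \<noteq> 0 \<longrightarrow> g y + h y = g' y / k y)"
      proof (intro exI conjI ballI impI)
        show "(U, \<lambda>x. g1 x * l1 x + h1 x * k1 x) \<in> local_algebra A L"
          "(U, \<lambda>x. k1 x * l1 x) \<in> local_algebra A L"
          by (intro add' mult' *)+
        fix y assume "y \<in> W \<inter> U" "k1 y * l1 y \<noteq> 0"
        then show "g y + h y = (g1 y * l1 y + h1 y * k1 y) / (k1 y * l1 y)"
          using *(8) by (simp add: add_frac_eq)
      qed (use * in auto)
    qed
    show "(\<lambda>x. g x * h x) \<in> regular ?X W"
    proof (rule regular_generatedI)
      fix x assume "x \<in> W"
      from both[OF g h this] obtain U g1 k1 h1 l1 where *: "(U, g1) \<in> local_algebra A L"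
         "(U, k1) \<in> local_algebra A L" "(U, h1) \<in> local_algebra A L" "(U, l1) \<in> local_algebra A L"
         "x \<in> U" "k1 x \<noteq> 0" "l1 x \<noteq> 0"
         "\<forall>y \<in> W \<inter> U. k1 y \<noteq> 0 \<longrightarrow> l1 y \<noteq> 0 \<longrightarrow> g y = g1 y / k1 y \<and> h y = h1 y / l1 y"
        by (elim exE conjE)
      show "\<exists>U g' k. (U, g') \<in> local_algebra A L \<and> (U, k) \<in> local_algebra A L \<and>
          x \<in> U \<and> k x \<noteq> 0 \<and> (\<forall>y \<in> W \<inter> U. k y \<noteq> 0 \<longrightarrow> g y * h y = g' y / k y)"
      proof (intro exI conjI ballI impI)
        show "(U, \<lambda>x. g1 x * h1 x) \<in> local_algebra A L"
          "(U, \<lambda>x. k1 x * l1 x) \<in> local_algebra A L"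
          by (intro mult' *)+
        fix y assume "y \<in> W \<inter> U" "k1 y * l1 y \<noteq> 0"
        then show "g y * h y = (g1 y * h1 y) / (k1 y * l1 y)"
          using *(8) by simp
      qed (use * in auto)
    qed
  next
    fix W g assume W: "openin (zariski ?X) W" and g: "g \<in> regular ?X W"
    show "openin (zariski ?X) {x \<in> W. g x \<noteq> 0}"
    proof (subst openin_subopen, intro ballI)
      fix x assume x: "x \<in> {x \<in> W. g x \<noteq> 0}"
      then have "x \<in> W" by simp
      with g obtain U g1 k1 where *: "(U, g1) \<in> local_algebra A L" "(U, k1) \<in> local_algebra A L" "x \<in> U"
          "k1 x \<noteq> 0" "\<And>y. y \<in> W \<Longrightarrow> y \<in> U \<Longrightarrow> k1 y \<noteq> 0 \<Longrightarrow> g y = g1 y / k1 y"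
        by (rule regular_generatedE) blast
      have "openin (zariski ?X) (W \<inter> {x \<in> U. g1 x * k1 x \<noteq> 0})"
        using W openin_local_algebra_nonzero[OF mult'[OF *(1,2)]] by (rule openin_Int)
      moreover have "x \<in> W \<inter> {x \<in> U. g1 x * k1 x \<noteq> 0}"
        "W \<inter> {x \<in> U. g1 x * k1 x \<noteq> 0} \<subseteq> {x \<in> W. g x \<noteq> 0}" using * x by auto
      ultimately show "\<exists>T. openin (zariski ?X) T \<and> x \<in> T \<and> T \<subseteq> {x \<in> W. g x \<noteq> 0}" by blast
    qed
    show "(\<lambda>x. inverse (g x)) \<in> regular ?X {x \<in> W. g x \<noteq> 0}"
    proof (rule regular_generatedI)
      fix x assume x: "x \<in> {x \<in> W. g x \<noteq> 0}"
      then have "x \<in> W" by simp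
      with g obtain U g1 k1 where *: "(U, g1) \<in> local_algebra A L" "(U, k1) \<in> local_algebra A L" "x \<in> U"
          "k1 x \<noteq> 0" "\<And>y. y \<in> W \<Longrightarrow> y \<in> U \<Longrightarrow> k1 y \<noteq> 0 \<Longrightarrow> g y = g1 y / k1 y"
        by (rule regular_generatedE) blast
      show "\<exists>U g' k. (U, g') \<in> local_algebra A L \<and> (U, k) \<in> local_algebra A L \<and>
          x \<in> U \<and> k x \<noteq> 0 \<and> (\<forall>y \<in> {x \<in> W. g x \<noteq> 0} \<inter> U. k y \<noteq> 0 \<longrightarrow> inverse (g y) = g' y / k y)"
      proof (intro exI conjI ballI impI)
        \<comment> \<open>The extra factor \<open>k1\<close> makes sure that \<open>k1\<close> does not vanish where the new denominator does not.\<close>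
        show "(U, \<lambda>x. k1 x * k1 x) \<in> local_algebra A L"
          "(U, \<lambda>x. g1 x * k1 x) \<in> local_algebra A L"
          by (intro mult' *)+
        show "g1 x * k1 x \<noteq> 0" using * x by auto
        fix y assume "y \<in> {x \<in> W. g x \<noteq> 0} \<inter> U" "g1 y * k1 y \<noteq> 0"
        then show "inverse (g y) = (k1 y * k1 y) / (g1 y * k1 y)" using *(5) by simp
      qed (use * in auto)
    qed
  next
    fix W g
    assume W: "openin (zariski ?X) W"
      and loc: "\<And>x. x \<in> W \<Longrightarrow> \<exists>W' h. openin (zariski ?X) W' \<and> x \<in> W' \<and> h \<in> regular ?X W' \<and>
             (\<forall>y \<in> W \<inter> W'. g y = h y)"
    show "g \<in> regular ?X W"
    proof (rule regular_generatedI)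
      fix x assume "x \<in> W"
      from loc[OF this] obtain W' h where W': "openin (zariski ?X) W'" "x \<in> W'" "h \<in> regular ?X W'"
        "\<forall>y \<in> W \<inter> W'. g y = h y" by (elim exE conjE)
      obtain U g1 k1 where 1: "(U, g1) \<in> local_algebra A L" "(U, k1) \<in> local_algebra A L" "x \<in> U"
          "k1 x \<noteq> 0" "\<And>y. y \<in> W' \<Longrightarrow> y \<in> U \<Longrightarrow> k1 y \<noteq> 0 \<Longrightarrow> h y = g1 y / k1 y"
        using W'(3,2) by (rule regular_generatedE) blast
      obtain D e where 2: "(D, e) \<in> local_algebra A L" "x \<in> D" "e x \<noteq> 0" "{y \<in> D. e y \<noteq> 0} \<subseteq> W'"
        using W'(1,2) unfolding openin_generated_space by meson
      show "\<exists>U g' k. (U, g') \<in> local_algebra A L \<and> (U, k) \<in> local_algebra A L \<and>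
          x \<in> U \<and> k x \<noteq> 0 \<and> (\<forall>y \<in> W \<inter> U. k y \<noteq> 0 \<longrightarrow> g y = g' y / k y)"
      proof (intro exI conjI ballI impI)
        show "(U \<inter> D, \<lambda>x. g1 x * e x) \<in> local_algebra A L" by (rule mult[OF 1(1) 2(1)])
        show "(U \<inter> D, \<lambda>x. k1 x * e x) \<in> local_algebra A L" by (rule mult[OF 1(2) 2(1)])
        fix y assume y: "y \<in> W \<inter> (U \<inter> D)" "k1 y * e y \<noteq> 0"
        then have "y \<in> W'" using 2(4) by auto
        then show "g y = (g1 y * e y) / (k1 y * e y)" using y 1(5)[of y] W'(4) by simp
      qed (use 1 2 in auto)
    qed
  qed
qed

end

subsection \<open>Morphisms\<close>

lemma morphism_compose:
  assumes f: "morphism X Y f" and g: "morphism Y Z g"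
  shows "morphism X Z (\<lambda>x. g (f x))"
  unfolding morphism_def
proof (intro conjI allI impI ballI)
  show "continuous_map (zariski X) (zariski Z) (\<lambda>x. g (f x))"
    using f g continuous_map_compose[of "zariski X" "zariski Y" f "zariski Z" g]
    by (simp add: morphism_def comp_def)
  fix V h assume V: "openin (zariski Z) V" and h: "h \<in> regular Z V"
  let ?V = "{y \<in> points Y. g y \<in> V}"
  have "openin (zariski Y) ?V" "h \<circ> g \<in> regular Y ?V"
    using g V h by (auto simp: morphism_def openin_continuous_map_preimage)
  then have "(h \<circ> g) \<circ> f \<in> regular X {x \<in> points X. f x \<in> ?V}"
    using f unfolding morphism_def by blast
  moreover have "{x \<in> points X. f x \<in> ?V} = {x \<in> points X. g (f x) \<in> V}"
    using f by (auto simp: morphism_def continuous_map_def Pi_def)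
  ultimately show "h \<circ> (\<lambda>x. g (f x)) \<in> regular X {x \<in> points X. g (f x) \<in> V}"
    by (simp add: comp_def)
qed

lemma morphism_points: "morphism X Y f \<Longrightarrow> x \<in> points X \<Longrightarrow> f x \<in> points Y"
  by (auto simp: morphism_def continuous_map_def Pi_def)

lemma morphism_openin:
  "morphism X Y f \<Longrightarrow> openin (zariski Y) V \<Longrightarrow> openin (zariski X) {x \<in> points X. f x \<in> V}"
  unfolding morphism_def by (blast intro: openin_continuous_map_preimage)

lemma morphism_regular:
  "morphism X Y f \<Longrightarrow> openin (zariski Y) V \<Longrightarrow> g \<in> regular Y V \<Longrightarrow>
    (\<lambda>x. g (f x)) \<in> regular X {x \<in> points X. f x \<in> V}"
  by (simp add: morphism_def comp_def)

text \<open>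
  The universal property by which every morphism below is constructed: pulling back is compatible
  with sums, products and fractions, so only the generating functions have to be tested.
\<close>

lemma morphism_into_generated_space:
  assumes L: "fst ` L \<subseteq> Pow A" and Z: "ringed_space Z"
    and A: "\<And>x. x \<in> points Z \<Longrightarrow> f x \<in> A"
    and gen: "\<And>U g. (U, g) \<in> L \<Longrightarrow> openin (zariski Z) {x \<in> points Z. f x \<in> U} \<and>
        (\<lambda>x. g (f x)) \<in> regular Z {x \<in> points Z. f x \<in> U}"
  shows "morphism Z (generated_space A L) f"
proof -
  interpret ringed_space Z by fact
  let ?X = "generated_space A L"
  have alg: "openin (zariski Z) {x \<in> points Z. f x \<in> U} \<and>
      (\<lambda>x. g (f x)) \<in> regular Z {x \<in> points Z. f x \<in> U}"
    if "(U, g) \<in> local_algebra A L" for U g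
    using that
  proof induction
    case (const c)
    have "{x \<in> points Z. f x \<in> A} = points Z" using A by blast
    then show ?case using regular_const[of "points Z" c] by simp
  next
    case (gen U g)
    then show ?case by (rule assms(4))
  next
    case (add U g V h)
    let ?P = "\<lambda>U. {x \<in> points Z. f x \<in> U}"
    have eq: "?P (U \<inter> V) = ?P U \<inter> ?P V" by blast
    have o: "openin (zariski Z) (?P U)" "openin (zariski Z) (?P V)"
      and gh: "(\<lambda>x. g (f x)) \<in> regular Z (?P U)" "(\<lambda>x. h (f x)) \<in> regular Z (?P V)"
      using add.IH by simp_all
    have "openin (zariski Z) (?P (U \<inter> V))" unfolding eq by (rule openin_Int[OF o])
    moreover from this have "(\<lambda>x. g (f x)) \<in> regular Z (?P (U \<inter> V))" "(\<lambda>x. h (f x)) \<in> regular Z (?P (U \<inter> V))"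
      using regular_restrict[OF o(1) gh(1)] regular_restrict[OF o(2) gh(2)] by blast+
    ultimately show ?case using regular_add by blast
  next
    case (mult U g V h)
    let ?P = "\<lambda>U. {x \<in> points Z. f x \<in> U}"
    have eq: "?P (U \<inter> V) = ?P U \<inter> ?P V" by blast
    have o: "openin (zariski Z) (?P U)" "openin (zariski Z) (?P V)"
      and gh: "(\<lambda>x. g (f x)) \<in> regular Z (?P U)" "(\<lambda>x. h (f x)) \<in> regular Z (?P V)"
      using mult.IH by simp_all
    have "openin (zariski Z) (?P (U \<inter> V))" unfolding eq by (rule openin_Int[OF o])
    moreover from this have "(\<lambda>x. g (f x)) \<in> regular Z (?P (U \<inter> V))" "(\<lambda>x. h (f x)) \<in> regular Z (?P (U \<inter> V))"
      using regular_restrict[OF o(1) gh(1)] regular_restrict[OF o(2) gh(2)] by blast+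
    ultimately show ?case using regular_mult by blast
  qed
  have preimage: "openin (zariski Z) {x \<in> points Z. f x \<in> W}" if W: "openin (zariski ?X) W" for W
  proof (subst openin_subopen, intro ballI)
    fix x assume x: "x \<in> {x \<in> points Z. f x \<in> W}"
    then have "f x \<in> W" by simp
    with W obtain U g where U: "(U, g) \<in> local_algebra A L" "f x \<in> U" "g (f x) \<noteq> 0"
        "{y \<in> U. g y \<noteq> 0} \<subseteq> W"
      unfolding openin_generated_space[OF L] by meson
    have "openin (zariski Z) {x \<in> {x \<in> points Z. f x \<in> U}. g (f x) \<noteq> 0}"
      using alg[OF U(1)] by (intro openin_nonzero) auto
    then show "\<exists>T. openin (zariski Z) T \<and> x \<in> T \<and> T \<subseteq> {x \<in> points Z. f x \<in> W}"
      using U x by (intro exI conjI) auto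
  qed
  show ?thesis
    unfolding morphism_def
  proof (intro conjI allI impI ballI)
    show "continuous_map (zariski Z) (zariski ?X) f"
      unfolding continuous_map_def
      using A preimage by (simp add: points_generated_space[OF L] Pi_def)
    fix V h assume V: "openin (zariski ?X) V" and h: "h \<in> regular ?X V"
    have "(\<lambda>x. h (f x)) \<in> regular Z {x \<in> points Z. f x \<in> V}"
    proof (rule regular_local[OF preimage[OF V]])
      fix x assume x: "x \<in> {x \<in> points Z. f x \<in> V}"
      then have "f x \<in> V" by simp
      obtain U g k where U: "(U, g) \<in> local_algebra A L" "(U, k) \<in> local_algebra A L" "f x \<in> U"
          "k (f x) \<noteq> 0" "\<And>y. y \<in> V \<Longrightarrow> y \<in> U \<Longrightarrow> k y \<noteq> 0 \<Longrightarrow> h y = g y / k y"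
        by (rule regular_generatedE[OF L h \<open>f x \<in> V\<close>]) blast+
      let ?W = "{x \<in> {x \<in> points Z. f x \<in> U}. k (f x) \<noteq> 0}"
      have W: "openin (zariski Z) ?W"
        using alg[OF U(2)] by (intro openin_nonzero) auto
      have "(\<lambda>x. g (f x) / k (f x)) \<in> regular Z ?W"
      proof (rule regular_divide[OF W])
        have "?W \<subseteq> {x \<in> points Z. f x \<in> U}" by blast
        then show "(\<lambda>x. g (f x)) \<in> regular Z ?W" "(\<lambda>x. k (f x)) \<in> regular Z ?W"
          using alg[OF U(1)] alg[OF U(2)] regular_restrict[OF _ _ W] by blast+
      qed blast
      then show "\<exists>W' ha. openin (zariski Z) W' \<and> x \<in> W' \<and> ha \<in> regular Z W' \<and>
         (\<forall>y \<in> {x \<in> points Z. f x \<in> V} \<inter> W'. h (f y) = ha y)"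
        using W U x by (intro exI[of _ ?W] exI[of _ "\<lambda>x. g (f x) / k (f x)"]) auto
    qed
    then show "h \<circ> f \<in> regular Z {x \<in> points Z. f x \<in> V}" by (simp add: comp_def)
  qed
qed

lemma pullback_functions_subset: "fst ` pullback_functions A f X \<subseteq> Pow A"
  by (auto simp: pullback_functions_def)

lemma morphism_from_generated_space:
  assumes L: "fst ` L \<subseteq> Pow A" and "pullback_functions A f Y \<subseteq> L"
    and "\<And>x. x \<in> A \<Longrightarrow> f x \<in> points Y" and Y: "ringed_space Y"
  shows "morphism (generated_space A L) Y f"
proof -
  interpret ringed_space Y by fact
  have gen: "({x \<in> A. f x \<in> V}, g \<circ> f) \<in> local_algebra A L" if "openin (zariski Y) V" "g \<in> regular Y V" for V g
    using that assms(2) by (intro local_algebra.gen) (auto simp: pullback_functions_def)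
  show ?thesis
    unfolding morphism_def continuous_map_def points_generated_space[OF L]
    using openin_local_algebra[OF L gen[OF _ regular_const]] regular_local_algebra[OF L gen] assms(3)
    by (auto simp: Pi_def)
qed

lemma isomorphic_trans:
  assumes "isomorphic X Y" "isomorphic Y Z"
  shows "isomorphic X Z"
proof -
  obtain f g where 1: "morphism X Y f" "morphism Y X g" "\<forall>x \<in> points X. g (f x) = x"
      "\<forall>y \<in> points Y. f (g y) = y"
    using assms(1) unfolding isomorphic_def by blast
  obtain h k where 2: "morphism Y Z h" "morphism Z Y k" "\<forall>x \<in> points Y. k (h x) = x"
      "\<forall>y \<in> points Z. h (k y) = y"
    using assms(2) unfolding isomorphic_def by blast
  show ?thesis
    unfolding isomorphic_def
    using morphism_compose[OF 1(1) 2(1)] morphism_compose[OF 2(2) 1(2)] 1 2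
      morphism_points[OF 1(1)] morphism_points[OF 2(2)]
    by (intro exI[of _ "\<lambda>x. h (f x)"] exI[of _ "\<lambda>x. g (k x)"]) auto
qed

subsection \<open>Subspaces\<close>

lemma points_subspace_of: "points (subspace_of X A) = A"
  unfolding subspace_of_def by (rule points_generated_space[OF pullback_functions_subset])

lemma ringed_space_subspace_of: "ringed_space (subspace_of X A)"
  unfolding subspace_of_def by (rule ringed_space_generated[OF pullback_functions_subset])

lemma morphism_inclusion:
  assumes "ringed_space X" "A \<subseteq> points X"
  shows "morphism (subspace_of X A) X (\<lambda>x. x)"
  unfolding subspace_of_def
  by (rule morphism_from_generated_space[OF pullback_functions_subset]) (use assms in auto)

lemma morphism_into_subspace_of:
  assumes "ringed_space Z" "morphism Z X f" "\<And>x. x \<in> points Z \<Longrightarrow> f x \<in> A"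
  shows "morphism Z (subspace_of X A) f"
  unfolding subspace_of_def
proof (rule morphism_into_generated_space[OF pullback_functions_subset assms(1,3)])
  fix U g assume "(U, g) \<in> pullback_functions A (\<lambda>x. x) X"
  then obtain W h where W: "U = {x \<in> A. x \<in> W}" "g = h \<circ> (\<lambda>x. x)" "openin (zariski X) W"
      "h \<in> regular X W"
    by (auto simp: pullback_functions_def)
  have "{x \<in> points Z. f x \<in> U} = {x \<in> points Z. f x \<in> W}" using W(1) assms(3) by blast
  then show "openin (zariski Z) {x \<in> points Z. f x \<in> U} \<and>
        (\<lambda>x. g (f x)) \<in> regular Z {x \<in> points Z. f x \<in> U}"
    using morphism_openin[OF assms(2) W(3)] morphism_regular[OF assms(2) W(3,4)] W(2) by simp
qed auto

text \<open>
  A subspace carries the induced topology: by induction, a member of its local algebra is the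
  restriction of a regular function on an open set of the ambient space.
\<close>

lemma openin_subspace_of:
  assumes X: "ringed_space X" and A: "A \<subseteq> points X"
  shows "openin (zariski (subspace_of X A)) V \<longleftrightarrow> (\<exists>W. openin (zariski X) W \<and> V = W \<inter> A)"
proof
  interpret ringed_space X by fact
  let ?L = "pullback_functions A (\<lambda>x. x) X"
  have alg: "\<exists>W h. openin (zariski X) W \<and> h \<in> regular X W \<and> U = W \<inter> A \<and> (\<forall>x\<in>U. g x = h x)"
    if "(U, g) \<in> local_algebra A ?L" for U g
    using that
  proof induction
    case (const c)
    then show ?case using A regular_const[of "points X" c] by (intro exI[of _ "points X"]) auto
  next
    case (gen U g)
    then obtain W h where "U = {x \<in> A. x \<in> W}" "g = h" "openin (zariski X) W" "h \<in> regular X W"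
      by (auto simp: pullback_functions_def comp_def)
    then show ?case by (intro exI[of _ W] exI[of _ h]) auto
  next
    case (add U g V h)
    then obtain W1 g1 W2 h1 where *: "openin (zariski X) W1" "g1 \<in> regular X W1" "U = W1 \<inter> A" "\<forall>x\<in>U. g x = g1 x"
       "openin (zariski X) W2" "h1 \<in> regular X W2" "V = W2 \<inter> A" "\<forall>x\<in>V. h x = h1 x" by (elim exE conjE)
    have "(\<lambda>x. g1 x + h1 x) \<in> regular X (W1 \<inter> W2)"
      using * by (intro regular_add regular_restrict[OF *(1,2)] regular_restrict[OF *(5,6)]) auto
    then show ?case using * by (intro exI[of _ "W1 \<inter> W2"] exI[of _ "\<lambda>x. g1 x + h1 x"]) auto
  next
    case (mult U g V h)
    then obtain W1 g1 W2 h1 where *: "openin (zariski X) W1" "g1 \<in> regular X W1" "U = W1 \<inter> A" "\<forall>x\<in>U. g x = g1 x"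
       "openin (zariski X) W2" "h1 \<in> regular X W2" "V = W2 \<inter> A" "\<forall>x\<in>V. h x = h1 x" by (elim exE conjE)
    have "(\<lambda>x. g1 x * h1 x) \<in> regular X (W1 \<inter> W2)"
      using * by (intro regular_mult regular_restrict[OF *(1,2)] regular_restrict[OF *(5,6)]) auto
    then show ?case using * by (intro exI[of _ "W1 \<inter> W2"] exI[of _ "\<lambda>x. g1 x * h1 x"]) auto
  qed
  assume V: "openin (zariski (subspace_of X A)) V"
  have "V \<subseteq> A" using openin_subset[OF V] by (simp add: points_subspace_of)
  let ?W = "\<Union>{W. openin (zariski X) W \<and> W \<inter> A \<subseteq> V}"
  have "V \<subseteq> ?W"
  proof
    fix x assume x: "x \<in> V"
    with V obtain U g where U: "(U, g) \<in> local_algebra A ?L" "x \<in> U" "g x \<noteq> 0" "{y \<in> U. g y \<noteq> 0} \<subseteq> V"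
      unfolding subspace_of_def openin_generated_space[OF pullback_functions_subset] by meson
    from alg[OF U(1)] obtain W h where W: "openin (zariski X) W" "h \<in> regular X W" "U = W \<inter> A" "\<forall>x\<in>U. g x = h x"
      by (elim exE conjE)
    have "openin (zariski X) {y \<in> W. h y \<noteq> 0}" by (rule openin_nonzero[OF W(1,2)])
    moreover have "{y \<in> W. h y \<noteq> 0} \<inter> A \<subseteq> V" "x \<in> {y \<in> W. h y \<noteq> 0}" using W U by auto
    ultimately show "x \<in> ?W" by blast
  qed
  then have "V = ?W \<inter> A" using \<open>V \<subseteq> A\<close> by blast
  moreover have "openin (zariski X) ?W" by (rule openin_Union) blast
  ultimately show "\<exists>W. openin (zariski X) W \<and> V = W \<inter> A" by blast
next
  assume "\<exists>W. openin (zariski X) W \<and> V = W \<inter> A"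
  then obtain W where W: "openin (zariski X) W" "V = W \<inter> A" by blast
  have "V = {x \<in> points (subspace_of X A). x \<in> W}" using W(2) by (auto simp: points_subspace_of)
  then show "openin (zariski (subspace_of X A)) V"
    using morphism_openin[OF morphism_inclusion[OF X A] W(1)] by simp
qed

lemma regular_subspace_of:
  assumes "ringed_space X" "openin (zariski X) W" "g \<in> regular X W" "A \<subseteq> W"
  shows "g \<in> regular (subspace_of X A) A"
proof -
  have "A \<subseteq> points X" using assms(4) openin_subset[OF assms(2)] by blast
  have "{x \<in> points (subspace_of X A). x \<in> W} = A" using assms(4) by (auto simp: points_subspace_of)
  then show ?thesis
    using morphism_regular[OF morphism_inclusion[OF assms(1) \<open>A \<subseteq> points X\<close>] assms(2,3)] by simp
qed

subsection \<open>Affine spaces\<close>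

lemma points_affine_space_on: "points (affine_space_on A C) = A"
  unfolding affine_space_on_def by (rule points_generated_space) auto

lemma ringed_space_affine_space_on: "ringed_space (affine_space_on A C)"
  unfolding affine_space_on_def by (rule ringed_space_generated) auto

lemma regular_coordinate: "c \<in> C \<Longrightarrow> c \<in> regular (affine_space_on A C) A"
  unfolding affine_space_on_def by (rule regular_local_algebra) (auto intro: local_algebra.gen)

lemma morphism_into_affine_space_on:
  assumes "ringed_space Z" "\<And>x. x \<in> points Z \<Longrightarrow> f x \<in> A"
    and "\<And>c. c \<in> C \<Longrightarrow> (\<lambda>x. c (f x)) \<in> regular Z (points Z)"
  shows "morphism Z (affine_space_on A C) f"
proof -
  have "{x \<in> points Z. f x \<in> A} = points Z" using assms(2) by blast
  then show ?thesis
    unfolding affine_space_on_def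
    by (intro morphism_into_generated_space) (use assms in auto)
qed

subsection \<open>Quotients\<close>

context
  fixes X :: "'a fun_space" and r :: "('a \<times> 'a) set"
  assumes X: "ringed_space X" and r: "equiv UNIV r"
begin

lemma Union_classes_eq:
  assumes "V \<subseteq> points X // r"
  shows "\<Union>V \<inter> points X = {x \<in> points X. r `` {x} \<in> V}"
proof (intro equalityI subsetI)
  fix x assume "x \<in> \<Union>V \<inter> points X"
  then obtain v where v: "v \<in> V" "x \<in> v" "x \<in> points X" by blast
  then obtain y where "v = r `` {y}" using assms by (auto simp: quotient_def)
  then have "v = r `` {x}" using v(2) equiv_class_eq[OF r, of y x] by simp
  then show "x \<in> {x \<in> points X. r `` {x} \<in> V}" using v by simp
next
  fix x assume "x \<in> {x \<in> points X. r `` {x} \<in> V}"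
  then show "x \<in> \<Union>V \<inter> points X" using equiv_class_self[OF r, of x] by auto
qed

lemma openin_quotient_iff:
  "openin (zariski (quotient_space X r)) V \<longleftrightarrow>
     V \<subseteq> points X // r \<and> openin (zariski X) {x \<in> points X. r `` {x} \<in> V}"
  unfolding openin_quotient_space[OF r] using Union_classes_eq by metis

lemma points_quotient_space: "points (quotient_space X r) = points X // r"
proof -
  have "{x \<in> points X. r `` {x} \<in> points X // r} = points X" by (auto simp: quotient_def)
  then have "openin (zariski (quotient_space X r)) (points X // r)"
    unfolding openin_quotient_iff by simp
  then show ?thesis
    using openin_quotient_iff[of "points (quotient_space X r)"] openin_subset by auto
qed

lemma regular_quotient_iff:
  assumes "V \<subseteq> points X // r"
  shows "h \<in> regular (quotient_space X r) V \<longleftrightarrow>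
    (\<lambda>x. h (r `` {x})) \<in> regular X {x \<in> points X. r `` {x} \<in> V}"
  using Union_classes_eq[OF assms] by (simp add: quotient_space_def)

lemma morphism_quotient_map: "morphism X (quotient_space X r) (\<lambda>x. r `` {x})"
  unfolding morphism_def continuous_map_def
proof (intro conjI allI impI ballI)
  show "(\<lambda>x. r `` {x}) \<in> points X \<rightarrow> points (quotient_space X r)"
    by (simp add: points_quotient_space quotientI)
  fix V assume "openin (zariski (quotient_space X r)) V"
  note V = this[unfolded openin_quotient_iff]
  show "openin (zariski X) {x \<in> points X. r `` {x} \<in> V}" by (rule V[THEN conjunct2])
  fix g assume "g \<in> regular (quotient_space X r) V"
  then show "g \<circ> (\<lambda>x. r `` {x}) \<in> regular X {x \<in> points X. r `` {x} \<in> V}"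
    unfolding comp_def regular_quotient_iff[OF V[THEN conjunct1]] .
qed

text \<open>
  Everything is inherited from the total space, as open sets and regular functions of the quotient
  are given by the saturated ones upstairs.
\<close>

lemma ringed_space_quotient: "ringed_space (quotient_space X r)"
proof -
  interpret ringed_space X by (rule X)
  let ?Q = "quotient_space X r"
  let ?P = "\<lambda>W. {x \<in> points X. r `` {x} \<in> W}"
  show ?thesis
  proof
    fix W assume W: "openin (zariski ?Q) W"
    note o_ = W[unfolded openin_quotient_iff]
    note sub = o_[THEN conjunct1] and o = o_[THEN conjunct2]
    note R = regular_quotient_iff[OF sub]
    show "(\<lambda>_. c) \<in> regular ?Q W" for c
      unfolding R by (rule regular_const[OF o])
    fix g assume "g \<in> regular ?Q W"
    note g = this[unfolded R]
    have nz: "?P {x \<in> W. g x \<noteq> 0} = {x \<in> ?P W. g (r `` {x}) \<noteq> 0}" by blast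
    show "openin (zariski ?Q) {x \<in> W. g x \<noteq> 0}"
      unfolding openin_quotient_iff nz using sub openin_nonzero[OF o g] by simp blast
    have sub': "{x \<in> W. g x \<noteq> 0} \<subseteq> points X // r" using sub by blast
    show "(\<lambda>x. inverse (g x)) \<in> regular ?Q {x \<in> W. g x \<noteq> 0}"
      unfolding regular_quotient_iff[OF sub'] nz by (rule regular_inverse_nonzero[OF o g])
    fix h assume "h \<in> regular ?Q W"
    note h = this[unfolded R]
    show "(\<lambda>x. g x + h x) \<in> regular ?Q W" unfolding R by (rule regular_add[OF o g h])
    show "(\<lambda>x. g x * h x) \<in> regular ?Q W" unfolding R by (rule regular_mult[OF o g h])
  next
    fix W g assume W: "openin (zariski ?Q) W" and loc: "\<And>x. x \<in> W \<Longrightarrow>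
      \<exists>W' h. openin (zariski ?Q) W' \<and> x \<in> W' \<and> h \<in> regular ?Q W' \<and> (\<forall>y \<in> W \<inter> W'. g y = h y)"
    note o_ = W[unfolded openin_quotient_iff]
    note sub = o_[THEN conjunct1] and o = o_[THEN conjunct2]
    show "g \<in> regular ?Q W"
      unfolding regular_quotient_iff[OF sub]
    proof (rule regular_local[OF o])
      fix x assume "x \<in> ?P W"
      then have x: "x \<in> points X" "r `` {x} \<in> W" by simp_all
      from loc[OF x(2)] obtain W' h where W': "openin (zariski ?Q) W'" "r `` {x} \<in> W'"
         "h \<in> regular ?Q W'" "\<forall>y \<in> W \<inter> W'. g y = h y" by (elim exE conjE)
      note oq_ = W'(1)[unfolded openin_quotient_iff]
    note sub' = oq_[THEN conjunct1] and o' = oq_[THEN conjunct2]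
      note h = W'(3)[unfolded regular_quotient_iff[OF sub']]
      have "x \<in> ?P W'" "\<forall>y \<in> ?P W \<inter> ?P W'. g (r `` {y}) = h (r `` {y})"
        using x(1) W'(2,4) by auto
      with o' h show "\<exists>V h. openin (zariski X) V \<and> x \<in> V \<and> h \<in> regular X V \<and>
         (\<forall>y \<in> ?P W \<inter> V. g (r `` {y}) = h y)" by blast
    qed
  qed
qed

end

subsection \<open>Analytic limits\<close>

text \<open>
  A sequence together with its limit, the point \<open>None\<close>. A morphism from this space to \<open>X\<close> is a
  sequence of points along which all regular functions converge to their value at the limit. In this
  form, convergence passes to quotients and fibre products by composing morphisms.
\<close>

definition sequence_space :: "nat option fun_space" where
  "sequence_space =
     \<lparr> zariski = topology (\<lambda>W. None \<in> W \<longrightarrow> eventually (\<lambda>n. Some n \<in> W) sequentially),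
       regular = (\<lambda>W. {h. None \<in> W \<longrightarrow> (\<lambda>n. h (Some n)) \<longlonglongrightarrow> h None}) \<rparr>"

lemma openin_sequence_space:
  "openin (zariski sequence_space) W \<longleftrightarrow> (None \<in> W \<longrightarrow> eventually (\<lambda>n. Some n \<in> W) sequentially)"
proof -
  have "istopology (\<lambda>W. None \<in> W \<longrightarrow> eventually (\<lambda>n. Some n \<in> W) sequentially)"
    unfolding istopology_def
  proof (intro conjI allI impI)
    fix K assume K: "\<forall>W\<in>K. None \<in> W \<longrightarrow> eventually (\<lambda>n. Some n \<in> W) sequentially"
      and "None \<in> \<Union>K"
    then obtain W where "W \<in> K" "eventually (\<lambda>n. Some n \<in> W) sequentially" by blast
    then show "eventually (\<lambda>n. Some n \<in> \<Union>K) sequentially"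
      using eventually_mono[of "\<lambda>n. Some n \<in> W" sequentially "\<lambda>n. Some n \<in> \<Union>K"] by blast
  qed (simp add: eventually_conj_iff)
  then show ?thesis by (simp add: sequence_space_def)
qed

lemma points_sequence_space: "points sequence_space = UNIV"
  using openin_subset[of "zariski sequence_space" UNIV] by (auto simp: openin_sequence_space)

lemma regular_sequence_space:
  "h \<in> regular sequence_space W \<longleftrightarrow> (None \<in> W \<longrightarrow> (\<lambda>n. h (Some n)) \<longlonglongrightarrow> h None)"
  by (simp add: sequence_space_def)

lemma ringed_space_sequence_space: "ringed_space sequence_space"
proof
  fix W and g :: "nat option \<Rightarrow> complex"
  assume W: "openin (zariski sequence_space) W" and g: "g \<in> regular sequence_space W"
  show "openin (zariski sequence_space) {x \<in> W. g x \<noteq> 0}"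
    unfolding openin_sequence_space
  proof
    assume "None \<in> {x \<in> W. g x \<noteq> 0}"
    then have "(\<lambda>n. g (Some n)) \<longlonglongrightarrow> g None" "g None \<noteq> 0" "eventually (\<lambda>n. Some n \<in> W) sequentially"
      using W g by (auto simp: openin_sequence_space regular_sequence_space)
    then show "eventually (\<lambda>n. Some n \<in> {x \<in> W. g x \<noteq> 0}) sequentially"
      using tendsto_imp_eventually_ne[of "\<lambda>n. g (Some n)" "g None" sequentially 0]
      by (simp add: eventually_conj_iff)
  qed
  show "(\<lambda>x. inverse (g x)) \<in> regular sequence_space {x \<in> W. g x \<noteq> 0}"
    using g by (simp add: regular_sequence_space tendsto_inverse)
next
  fix W and g :: "nat option \<Rightarrow> complex"
  assume W: "openin (zariski sequence_space) W" and loc: "\<And>x. x \<in> W \<Longrightarrow>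
     \<exists>W' h. openin (zariski sequence_space) W' \<and> x \<in> W' \<and> h \<in> regular sequence_space W' \<and>
       (\<forall>y \<in> W \<inter> W'. g y = h y)"
  show "g \<in> regular sequence_space W"
    unfolding regular_sequence_space
  proof
    assume N: "None \<in> W"
    from loc[OF this] obtain W' h where *: "openin (zariski sequence_space) W'" "None \<in> W'"
      "h \<in> regular sequence_space W'" "\<forall>y \<in> W \<inter> W'. g y = h y" by (elim exE conjE)
    have lim: "(\<lambda>n. h (Some n)) \<longlonglongrightarrow> g None" using * N by (auto simp: regular_sequence_space)
    have ev: "eventually (\<lambda>n. h (Some n) = g (Some n)) sequentially"
    proof -
      have "eventually (\<lambda>n. Some n \<in> W) sequentially" "eventually (\<lambda>n. Some n \<in> W') sequentially"
        using W * N by (auto simp: openin_sequence_space)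
      then show ?thesis by eventually_elim (use * in auto)
    qed
    show "(\<lambda>n. g (Some n)) \<longlonglongrightarrow> g None" using lim ev by (rule Lim_transform_eventually)
  qed
qed (simp_all add: regular_sequence_space tendsto_add tendsto_mult)

section \<open>Irreducibility and the standard chart of projective space\<close>

lemma irreducible_in_image:
  assumes "irreducible_in T C" "continuous_map T T' f"
  shows "irreducible_in T' (f ` C)"
  unfolding irreducible_in_def
proof (intro conjI allI impI)
  have C: "C \<subseteq> topspace T" "C \<noteq> {}" using assms(1) by (auto simp: irreducible_in_def)
  then show "f ` C \<noteq> {}" "f ` C \<subseteq> topspace T'"
    using continuous_map_image_subset_topspace[OF assms(2)] by auto
  fix U V assume U: "openin T' U" and V: "openin T' V" and ne: "U \<inter> f ` C \<noteq> {}" "V \<inter> f ` C \<noteq> {}"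
  have "openin T {x \<in> topspace T. f x \<in> U}" "openin T {x \<in> topspace T. f x \<in> V}"
    using openin_continuous_map_preimage[OF assms(2)] U V by auto
  moreover have "{x \<in> topspace T. f x \<in> U} \<inter> C \<noteq> {}" "{x \<in> topspace T. f x \<in> V} \<inter> C \<noteq> {}"
    using ne C by auto
  ultimately have "{x \<in> topspace T. f x \<in> U} \<inter> {x \<in> topspace T. f x \<in> V} \<inter> C \<noteq> {}"
    using assms(1) unfolding irreducible_in_def by blast
  then show "U \<inter> V \<inter> f ` C \<noteq> {}" by blast
qed

lemma irreducible_in_open_subset:
  assumes "irreducible_in T C" "openin T U" "U \<inter> C \<noteq> {}"
  shows "irreducible_in T (U \<inter> C)"
  unfolding irreducible_in_def
proof (intro conjI allI impI)
  show "U \<inter> C \<subseteq> topspace T" using assms(1) by (auto simp: irreducible_in_def)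
  fix V W assume *: "openin T V" "openin T W" "V \<inter> (U \<inter> C) \<noteq> {}" "W \<inter> (U \<inter> C) \<noteq> {}"
  then have "openin T (V \<inter> U)" "openin T (W \<inter> U)" "(V \<inter> U) \<inter> C \<noteq> {}" "(W \<inter> U) \<inter> C \<noteq> {}"
    using assms(2) by auto
  then have "(V \<inter> U) \<inter> (W \<inter> U) \<inter> C \<noteq> {}"
    using assms(1) unfolding irreducible_in_def by blast
  then show "V \<inter> W \<inter> (U \<inter> C) \<noteq> {}" by blast
qed (rule assms(3))

lemma irreducible_imp_open_dense:
  assumes "irreducible_in T (topspace T)" "openin T U" "U \<noteq> {}"
  shows "T closure_of U = topspace T"
  unfolding dense_intersects_open
proof (intro allI impI)
  fix V assume "openin T V \<and> V \<noteq> {}"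
  then have "openin T V" "V \<inter> topspace T \<noteq> {}" "U \<inter> topspace T \<noteq> {}"
    using openin_subset[of T] assms by fastforce+
  then show "U \<inter> V \<noteq> {}" using assms(1,2) unfolding irreducible_in_def by blast
qed

text \<open>
  The local algebra of a line consists of polynomials in one variable.
\<close>

lemma finite_complement_open_line:
  assumes W: "openin (zariski (affine_space_on A {\<lambda>t. t})) W" and "W \<noteq> {}"
  shows "finite (A - W)"
proof -
  let ?L = "{(A, c) | c. c \<in> {\<lambda>t::complex. t}}"
  have L: "fst ` ?L \<subseteq> Pow A" by auto
  have alg: "U = A \<and> (\<exists>p. \<forall>t. g t = poly p t)" if "(U, g) \<in> local_algebra A ?L" for U g
    using that
  proof induction
    case (const c)
    show ?case by (intro conjI refl exI[of _ "[:c:]"]) simp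
  next
    case (gen U g)
    then show ?case by (intro conjI exI[of _ "[:0, 1:]"]) auto
  next
    case (add U g V h)
    then obtain p q where "\<forall>t. g t = poly p t" "\<forall>t. h t = poly q t" by blast
    then show ?case using add by (intro conjI exI[of _ "p + q"]) auto
  next
    case (mult U g V h)
    then obtain p q where "\<forall>t. g t = poly p t" "\<forall>t. h t = poly q t" by blast
    then show ?case using mult by (intro conjI exI[of _ "p * q"]) auto
  qed
  from \<open>W \<noteq> {}\<close> obtain t where "t \<in> W" by blast
  with W obtain U g where U: "(U, g) \<in> local_algebra A ?L" "t \<in> U" "g t \<noteq> 0" "{y \<in> U. g y \<noteq> 0} \<subseteq> W"
    unfolding affine_space_on_def openin_generated_space[OF L] by meson
  from alg[OF U(1)] obtain p where p: "U = A" "\<And>t. g t = poly p t" by blast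
  then have "p \<noteq> 0" using U(3) by auto
  moreover have "A - W \<subseteq> {t. poly p t = 0}" using U(4) p by auto
  ultimately show ?thesis using poly_roots_finite finite_subset by blast
qed

text \<open>
  Two nonempty open sets are joined by a line, and both contain all but finitely many of its points.
  The line may leave \<open>A\<close> at finitely many points, which covers a vector space without the origin.
\<close>

lemma irreducible_in_affine_space:
  fixes A :: "(nat \<Rightarrow> complex) set"
  assumes "A \<noteq> {}"
    and line: "\<And>x y. x \<in> A \<Longrightarrow> y \<in> A \<Longrightarrow> finite {t. (\<lambda>i. (1 - t) * x i + t * y i) \<notin> A}"
  shows "irreducible_in (zariski (affine_space_on A {\<lambda>x. x i | i. P i})) A"
  unfolding irreducible_in_def
proof (intro conjI allI impI)
  let ?X = "affine_space_on A {\<lambda>x. x i | i. P i}"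
  show "A \<subseteq> points ?X" by (simp add: points_affine_space_on)
  fix U V assume U: "openin (zariski ?X) U" and V: "openin (zariski ?X) V"
    and ne: "U \<inter> A \<noteq> {}" "V \<inter> A \<noteq> {}"
  then obtain x y where x: "x \<in> U" "x \<in> A" and y: "y \<in> V" "y \<in> A" by blast
  define l where "l = (\<lambda>t i. (1 - t) * x i + t * y i)"
  let ?T = "affine_space_on {t. l t \<in> A} {\<lambda>t. t}"
  interpret T: ringed_space ?T by (rule ringed_space_affine_space_on)
  have l: "morphism ?T ?X l"
  proof (rule morphism_into_affine_space_on[OF ringed_space_affine_space_on])
    fix c :: "(nat \<Rightarrow> complex) \<Rightarrow> complex" assume "c \<in> {\<lambda>x. x i | i. P i}"
    then obtain i where c: "c = (\<lambda>x. x i)" by blast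
    have o: "openin (zariski ?T) (points ?T)" by simp
    have "(\<lambda>t. t) \<in> regular ?T (points ?T)"
      using regular_coordinate[of "\<lambda>t. t" "{\<lambda>t. t}" "{t. l t \<in> A}"] by (simp add: points_affine_space_on)
    then have "(\<lambda>t. (1 - t) * x i + t * y i) \<in> regular ?T (points ?T)"
      by (intro T.regular_add[OF o] T.regular_mult[OF o] T.regular_diff[OF o] T.regular_const[OF o])
    then show "(\<lambda>t. c (l t)) \<in> regular ?T (points ?T)" by (simp add: c l_def)
  qed (simp add: points_affine_space_on)
  have l01: "l 0 = x" "l 1 = y" by (simp_all add: l_def)
  have fin: "finite {t. l t \<notin> U}" if o: "openin (zariski ?X) U" and "\<exists>t. l t \<in> U" for U
  proof -
    have "U \<subseteq> A" using openin_subset[OF o] by (simp add: points_affine_space_on)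
    then have "{t \<in> points ?T. l t \<in> U} \<noteq> {}" using that(2) by (auto simp: points_affine_space_on)
    from finite_complement_open_line[OF morphism_openin[OF l o] this]
    have "finite ({t. l t \<in> A} - {t \<in> points ?T. l t \<in> U})" .
    moreover have "finite {t. l t \<notin> A}" using line[OF x(2) y(2)] by (simp add: l_def)
    ultimately have "finite (({t. l t \<in> A} - {t \<in> points ?T. l t \<in> U}) \<union> {t. l t \<notin> A})" by blast
    then show ?thesis by (rule finite_subset[rotated]) (auto simp: points_affine_space_on)
  qed
  have "finite ({t. l t \<notin> U} \<union> {t. l t \<notin> V})" using fin[OF U] fin[OF V] x y l01 by blast
  then obtain t where "t \<notin> {t. l t \<notin> U} \<union> {t. l t \<notin> V}"
    using ex_new_if_finite[OF infinite_UNIV_char_0] by blast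
  then have t: "l t \<in> U" "l t \<in> V" by auto
  moreover have "U \<subseteq> A" using openin_subset[OF U] by (simp add: points_affine_space_on)
  ultimately show "U \<inter> V \<inter> A \<noteq> {}" by blast
qed (rule assms(1))

lemma equiv_scaling_rel: "equiv UNIV scaling_rel"
proof (rule equivI)
  show "refl scaling_rel" by (auto simp: refl_on_def scaling_rel_def intro: exI[of _ 1])
  show "sym scaling_rel"
  proof (rule symI)
    fix x y assume "(x, y) \<in> scaling_rel"
    then obtain c where "c \<noteq> 0" "y = (\<lambda>i. c * x i)" by (auto simp: scaling_rel_def)
    then show "(y, x) \<in> scaling_rel" by (auto simp: scaling_rel_def intro!: exI[of _ "inverse c"])
  qed
  show "trans scaling_rel"
  proof (rule transI)
    fix x y z assume "(x, y) \<in> scaling_rel" "(y, z) \<in> scaling_rel"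
    then obtain c e where "c \<noteq> 0" "e \<noteq> 0" "y = (\<lambda>i. c * x i)" "z = (\<lambda>i. e * y i)"
      by (auto simp: scaling_rel_def)
    then show "(x, z) \<in> scaling_rel" by (auto simp: scaling_rel_def intro!: exI[of _ "e * c"])
  qed
qed auto

text \<open>
  Affine space with coordinates \<open>1, \<dots>, n\<close>; the index 0 is left for the homogeneous coordinate that
  is set to 1 in the chart of projective space.
\<close>

definition coordinate_space :: "nat \<Rightarrow> (nat \<Rightarrow> complex) fun_space" where
  "coordinate_space n = affine_space_on {u. \<forall>k. k \<notin> {1..n} \<longrightarrow> u k = 0} {\<lambda>u. u k | k. k \<in> {1..n}}"

lemma points_coordinate_space: "points (coordinate_space n) = {u. \<forall>k. k \<notin> {1..n} \<longrightarrow> u k = 0}"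
  by (simp add: coordinate_space_def points_affine_space_on)

lemma ringed_space_coordinate_space: "ringed_space (coordinate_space n)"
  by (simp add: coordinate_space_def ringed_space_affine_space_on)

lemma irreducible_coordinate_space:
  "irreducible_in (zariski (coordinate_space n)) (points (coordinate_space n))"
  unfolding points_coordinate_space unfolding coordinate_space_def
  by (rule irreducible_in_affine_space) (auto intro: exI[of _ "\<lambda>_. 0"])

lemma regular_coordinate_space:
  "(\<lambda>u. u k) \<in> regular (coordinate_space n) (points (coordinate_space n))"
proof (cases "k \<in> {1..n}")
  case True
  then show ?thesis unfolding points_coordinate_space unfolding coordinate_space_def
    by (intro regular_coordinate) blast
next
  case False
  interpret ringed_space "coordinate_space n" by (rule ringed_space_coordinate_space)
  have "(\<lambda>_. 0) \<in> regular (coordinate_space n) (points (coordinate_space n))"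
    by (rule regular_const) simp
  then show ?thesis
    by (rule regular_cong[OF openin_topspace]) (use False in \<open>simp add: points_coordinate_space\<close>)
qed

lemma ringed_space_projective_space: "ringed_space (projective_space n)"
  unfolding projective_space_def
  by (intro ringed_space_quotient ringed_space_affine_space_on equiv_scaling_rel)

text \<open>
  The chart is \<open>u \<mapsto> [1 : u]\<close>. Its inverse is regular since the ratios \<open>x\<^sub>k / x\<^sub>0\<close> are regular and
  invariant on the part of the cone where \<open>x\<^sub>0 \<noteq> 0\<close>. Open sets are dense as projective space is
  irreducible, being the image of the cone.
\<close>

lemma chart_projective_space:
  assumes \<Omega>: "openin (zariski (coordinate_space n)) \<Omega>" and "\<Omega> \<noteq> {}"
  obtains V where "openin (zariski (projective_space n)) V"
    "zariski (projective_space n) closure_of V = points (projective_space n)"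
    "isomorphic (subspace_of (coordinate_space n) \<Omega>) (subspace_of (projective_space n) V)"
proof -
  define K :: "(nat \<Rightarrow> complex) set" where "K = {x. (\<forall>i>n. x i = 0) \<and> (\<exists>i\<le>n. x i \<noteq> 0)}"
  define cone where "cone = affine_space_on K {\<lambda>x. x i | i. i \<le> n}"
  let ?S = "coordinate_space n" and ?P = "projective_space n"
  have P: "?P = quotient_space cone scaling_rel"
    by (simp add: projective_space_def cone_def K_def)
  have ringed_cone: "ringed_space cone" by (simp add: cone_def ringed_space_affine_space_on)
  have points_cone: "points cone = K" by (simp add: cone_def points_affine_space_on)
  interpret cone: ringed_space cone by (rule ringed_cone)
  interpret P: ringed_space ?P by (rule ringed_space_projective_space)
  interpret S: ringed_space ?S by (rule ringed_space_coordinate_space)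
  note quotient_facts = ringed_cone equiv_scaling_rel
  have points_P: "points ?P = K // scaling_rel"
    unfolding P by (simp add: points_quotient_space[OF quotient_facts] points_cone)
  have coord: "(\<lambda>x. x k) \<in> regular cone K" if "k \<le> n" for k
    unfolding cone_def by (rule regular_coordinate) (use that in blast)
  have openK: "openin (zariski cone) K" using openin_topspace[of "zariski cone"] by (simp add: points_cone)

  have irreducible_P: "irreducible_in (zariski ?P) (points ?P)"
  proof -
    have "irreducible_in (zariski cone) K"
      unfolding cone_def
    proof (rule irreducible_in_affine_space)
      have "(\<lambda>i. if i = 0 then 1 else 0) \<in> K" by (auto simp: K_def)
      then show "K \<noteq> {}" by blast
      fix x y assume x: "x \<in> K" and y: "y \<in> K"
      then obtain i where i: "i \<le> n" "x i \<noteq> 0" by (auto simp: K_def)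
      \<comment> \<open>The \<open>i\<close>-th coordinate along the line.\<close>
      let ?p = "[:x i, y i - x i:]"
      have "{t. (\<lambda>i. (1 - t) * x i + t * y i) \<notin> K} \<subseteq> {t. poly ?p t = 0}"
      proof
        fix t assume "t \<in> {t. (\<lambda>i. (1 - t) * x i + t * y i) \<notin> K}"
        then have "(1 - t) * x i + t * y i = 0" using x y i(1) by (auto simp: K_def)
        then show "t \<in> {t. poly ?p t = 0}" by (simp add: algebra_simps)
      qed
      moreover have "finite {t. poly ?p t = 0}" using i by (intro poly_roots_finite) auto
      ultimately show "finite {t. (\<lambda>i. (1 - t) * x i + t * y i) \<notin> K}" by (rule finite_subset)
    qed
    moreover have "continuous_map (zariski cone) (zariski ?P) (\<lambda>x. scaling_rel `` {x})"
      using morphism_quotient_map[OF quotient_facts] unfolding P by (simp add: morphism_def)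
    ultimately have "irreducible_in (zariski ?P) ((\<lambda>x. scaling_rel `` {x}) ` K)"
      by (rule irreducible_in_image)
    moreover have "(\<lambda>x. scaling_rel `` {x}) ` K = points ?P"
      unfolding points_P by (auto simp: quotient_def)
    ultimately show ?thesis by simp
  qed

  define u where "u = (\<lambda>Q. let x = (SOME x. x \<in> Q) in (\<lambda>k. if k \<in> {1..n} then x k / x 0 else (0::complex)))"
  have u: "u (scaling_rel `` {x}) = (\<lambda>k. if k \<in> {1..n} then x k / x 0 else 0)" for x
  proof -
    have "(SOME y. y \<in> scaling_rel `` {x}) \<in> scaling_rel `` {x}"
      by (rule someI[of _ x]) (rule equiv_class_self[OF equiv_scaling_rel], simp)
    then obtain c where "c \<noteq> 0" "(SOME y. y \<in> scaling_rel `` {x}) = (\<lambda>i. c * x i)"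
      by (auto simp: scaling_rel_def)
    then show ?thesis by (simp add: u_def Let_def fun_eq_iff)
  qed
  define D where "D = (\<lambda>x. scaling_rel `` {x}) ` {x \<in> K. x 0 \<noteq> 0}"
  have D_iff: "scaling_rel `` {x} \<in> D \<longleftrightarrow> x 0 \<noteq> 0" if "x \<in> K" for x
  proof
    assume "scaling_rel `` {x} \<in> D"
    then obtain y where y: "y 0 \<noteq> 0" "scaling_rel `` {x} = scaling_rel `` {y}" by (auto simp: D_def)
    then have "(x, y) \<in> scaling_rel" using eq_equiv_class_iff[OF equiv_scaling_rel] by blast
    then show "x 0 \<noteq> 0" using y(1) by (auto simp: scaling_rel_def)
  qed (use that in \<open>auto simp: D_def\<close>)
  have D_sub: "D \<subseteq> points cone // scaling_rel" by (auto simp: D_def quotient_def points_cone)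
  have pre_D: "{x \<in> points cone. scaling_rel `` {x} \<in> D} = {x \<in> K. x 0 \<noteq> 0}"
    using D_iff by (auto simp: points_cone)
  have open0: "openin (zariski cone) {x \<in> K. x 0 \<noteq> 0}"
    by (rule cone.openin_nonzero[OF openK coord]) simp
  have open_D: "openin (zariski ?P) D"
    unfolding P openin_quotient_iff[OF quotient_facts] pre_D using D_sub open0 by blast
  have regular_u: "(\<lambda>Q. u Q k) \<in> regular ?P D" if "k \<in> {1..n}" for k
  proof -
    have "(\<lambda>x. x k / x 0) \<in> regular cone {x \<in> K. x 0 \<noteq> 0}"
      using that by (intro cone.regular_divide[OF open0] cone.regular_restrict[OF openK coord open0]) auto
    then show ?thesis
      unfolding P regular_quotient_iff[OF quotient_facts D_sub] pre_D using that by (simp add: u)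
  qed
  have u_morphism: "morphism (subspace_of ?P V) ?S u" if "V \<subseteq> D" for V
    unfolding coordinate_space_def
  proof (rule morphism_into_affine_space_on[OF ringed_space_subspace_of])
    fix Q assume "Q \<in> points (subspace_of ?P V)"
    then have "Q \<in> D" using that by (auto simp: points_subspace_of)
    then show "u Q \<in> {u. \<forall>k. k \<notin> {1..n} \<longrightarrow> u k = 0}" by (auto simp: D_def u)
  next
    fix c :: "(nat \<Rightarrow> complex) \<Rightarrow> complex" assume "c \<in> {\<lambda>u. u k | k. k \<in> {1..n}}"
    then show "(\<lambda>x. c (u x)) \<in> regular (subspace_of ?P V) (points (subspace_of ?P V))"
      using regular_subspace_of[OF P.ringed_space_axioms open_D regular_u that]
      by (auto simp: points_subspace_of)
  qed
  define V where "V = {Q \<in> D. u Q \<in> \<Omega>}"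
  have "V \<subseteq> D" by (auto simp: V_def)
  have D_P: "D \<subseteq> points ?P" using openin_subset[OF open_D] .
  have open_V: "openin (zariski ?P) V"
  proof -
    have "openin (zariski (subspace_of ?P D)) V"
      using morphism_openin[OF u_morphism[OF subset_refl] \<Omega>] by (simp add: V_def points_subspace_of)
    then obtain W where "openin (zariski ?P) W" "V = W \<inter> D"
      unfolding openin_subspace_of[OF P.ringed_space_axioms D_P] by blast
    then show ?thesis using open_D by blast
  qed
  have \<Omega>_S: "\<Omega> \<subseteq> points ?S" using openin_subset[OF \<Omega>] .
  define j where "j = (\<lambda>u :: nat \<Rightarrow> complex. (\<lambda>k. if k = 0 then 1 else u k))"
  have j: "morphism ?S cone j"
    unfolding cone_def
  proof (rule morphism_into_affine_space_on[OF S.ringed_space_axioms])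
    fix v assume "v \<in> points ?S"
    then show "j v \<in> K" by (auto simp: K_def j_def points_coordinate_space)
  next
    fix c :: "(nat \<Rightarrow> complex) \<Rightarrow> complex" assume "c \<in> {\<lambda>x. x i | i. i \<le> n}"
    then obtain i where "c = (\<lambda>x. x i)" by blast
    then show "(\<lambda>x. c (j x)) \<in> regular ?S (points ?S)"
      using regular_coordinate_space[of i n] S.regular_const[of "points ?S" 1]
      by (cases "i = 0") (simp_all add: j_def)
  qed
  have u_j: "u (scaling_rel `` {j v}) = v" if "v \<in> points ?S" for v
    using that unfolding u by (auto simp: j_def points_coordinate_space)
  have j_K: "j v \<in> K" if "v \<in> points ?S" for v
    using morphism_points[OF j that] by (simp add: points_cone)
  have j_V: "scaling_rel `` {j v} \<in> V" if "v \<in> \<Omega>" for v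
    using that \<Omega>_S u_j[of v] D_iff[OF j_K, of v] by (auto simp: V_def j_def)
  have j_u: "scaling_rel `` {j (u Q)} = Q" if "Q \<in> V" for Q
  proof -
    obtain x where x: "x \<in> K" "x 0 \<noteq> 0" "Q = scaling_rel `` {x}"
      using \<open>Q \<in> V\<close> by (auto simp: V_def D_def)
    have "j (u Q) = (\<lambda>k. (1 / x 0) * x k)"
      using x by (auto simp: fun_eq_iff j_def u K_def not_le)
    then have "(x, j (u Q)) \<in> scaling_rel" using x(2)
      unfolding scaling_rel_def by (auto intro!: exI[of _ "1 / x 0"])
    then show ?thesis using equiv_class_eq[OF equiv_scaling_rel] x(3) by metis
  qed
  have iso: "isomorphic (subspace_of ?S \<Omega>) (subspace_of ?P V)"
    unfolding isomorphic_def
  proof (intro exI conjI ballI)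
    have "morphism ?S ?P (\<lambda>v. scaling_rel `` {j v})"
      unfolding P by (rule morphism_compose[OF j morphism_quotient_map[OF quotient_facts]])
    then have "morphism (subspace_of ?S \<Omega>) ?P (\<lambda>v. scaling_rel `` {j v})"
      using morphism_compose[OF morphism_inclusion[OF S.ringed_space_axioms \<Omega>_S]] by blast
    then show "morphism (subspace_of ?S \<Omega>) (subspace_of ?P V) (\<lambda>v. scaling_rel `` {j v})"
      by (rule morphism_into_subspace_of[OF ringed_space_subspace_of]) (simp add: points_subspace_of j_V)
    show "morphism (subspace_of ?P V) (subspace_of ?S \<Omega>) u"
      by (rule morphism_into_subspace_of[OF ringed_space_subspace_of u_morphism[OF \<open>V \<subseteq> D\<close>]])
         (simp add: points_subspace_of V_def)
  qed (use u_j j_u \<Omega>_S in \<open>auto simp: points_subspace_of\<close>)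
  have "V \<noteq> {}" using \<open>\<Omega> \<noteq> {}\<close> j_V by blast
  show thesis
    by (rule that[OF open_V irreducible_imp_open_dense[OF irreducible_P open_V \<open>V \<noteq> {}\<close>] iso])
qed

section \<open>Roots of convergent polynomials\<close>

text \<open>
  Every linear factor satisfies \<open>\<bar>w - r\<bar> \<le> \<bar>w - z\<bar> + \<bar>z - r\<bar> \<le> 2 \<bar>z - r\<bar>\<close>.
\<close>

lemma norm_poly_le_of_roots_far:
  fixes p :: "complex poly"
  assumes "degree p \<le> D" and "\<And>r. poly p r = 0 \<Longrightarrow> e \<le> dist r z" and "dist w z \<le> e" and "e > 0"
  shows "norm (poly p w) \<le> 2 ^ D * norm (poly p z)"
  using assms(1,2)
proof (induction D arbitrary: p)
  case 0
  then obtain c where "p = [:c:]" by (meson degree_eq_zeroE le_zero_eq)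
  then show ?case by simp
next
  case (Suc D)
  show ?case
  proof (cases "degree p = 0")
    case True
    then obtain c where "p = [:c:]" by (meson degree_eq_zeroE)
    moreover have "norm c * 1 \<le> norm c * (2 * 2 ^ D)"
    proof (rule mult_left_mono)
      have "(1::real) \<le> 2 ^ Suc D" by (rule one_le_power) simp
      then show "(1::real) \<le> 2 * 2 ^ D" by simp
    qed simp
    ultimately show ?thesis by (simp add: mult.commute)
  next
    case False
    then obtain r where r: "poly p r = 0"
      using fundamental_theorem_of_algebra[of p] by (auto simp: constant_degree)
    then obtain q where q: "p = [:-r, 1:] * q" by (auto simp: poly_eq_0_iff_dvd dvd_def)
    have "q \<noteq> 0" using False q by auto
    then have "degree p = Suc (degree q)" unfolding q by (subst degree_mult_eq) auto
    then have IH: "norm (poly q w) \<le> 2 ^ D * norm (poly q z)"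
      using Suc.prems by (intro Suc.IH) (auto simp: q)
    have "norm (w - r) \<le> norm (w - z) + norm (z - r)" using norm_triangle_ineq[of "w - z" "z - r"] by simp
    also have "\<dots> \<le> 2 * norm (z - r)"
      using Suc.prems(2)[OF r] assms(3) by (simp add: dist_norm norm_minus_commute)
    finally have "norm (w - r) * norm (poly q w) \<le> (2 * norm (z - r)) * (2 ^ D * norm (poly q z))"
      using IH by (intro mult_mono) auto
    moreover have "poly p w = (w - r) * poly q w" "poly p z = (z - r) * poly q z"
      unfolding q by (simp_all add: algebra_simps)
    ultimately show ?thesis by (simp add: norm_mult mult_ac)
  qed
qed

text \<open>
  If a disc about \<open>z\<close> contained no root of \<open>P n\<close> for infinitely many \<open>n\<close>, then the preceding estimate
  would bound the values of \<open>P n\<close> in the disc by a multiple of \<open>P n z\<close>, which tends to 0, whereas \<open>Q\<close>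
  does not vanish identically on the disc.
\<close>

lemma roots_converge:
  fixes P :: "nat \<Rightarrow> complex poly"
  assumes lim: "\<And>w. (\<lambda>n. poly (P n) w) \<longlonglongrightarrow> poly Q w" and deg: "\<And>n. degree (P n) \<le> D"
    and "Q \<noteq> 0" "poly Q z = 0"
  obtains \<zeta> where "\<zeta> \<longlonglongrightarrow> z" "eventually (\<lambda>n. poly (P n) (\<zeta> n) = 0) sequentially"
proof -
  have near: "eventually (\<lambda>n. \<exists>r. poly (P n) r = 0 \<and> dist r z < e) sequentially" if "e > 0" for e
  proof -
    have "infinite (ball z e)" using \<open>e > 0\<close> uncountable_ball countable_finite by blast
    then have "\<not> ball z e \<subseteq> {w. poly Q w = 0}" using poly_roots_finite[OF \<open>Q \<noteq> 0\<close>] finite_subset by blast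
    then obtain w where w: "dist w z < e" "poly Q w \<noteq> 0"
      by (metis (mono_tags, lifting) dist_commute mem_Collect_eq mem_ball subsetI)
    have "(\<lambda>n. 2 ^ D * norm (poly (P n) z) - norm (poly (P n) w)) \<longlonglongrightarrow> 2 ^ D * norm (poly Q z) - norm (poly Q w)"
      by (intro tendsto_intros lim)
    then have "eventually (\<lambda>n. 2 ^ D * norm (poly (P n) z) - norm (poly (P n) w) < 0) sequentially"
      using w(2) assms(4) by (intro order_tendstoD(2)) auto
    then show ?thesis
    proof eventually_elim
      case (elim n)
      show ?case
      proof (rule ccontr)
        assume "\<nexists>r. poly (P n) r = 0 \<and> dist r z < e"
        then have "norm (poly (P n) w) \<le> 2 ^ D * norm (poly (P n) z)"
          using w(1) \<open>e > 0\<close> by (intro norm_poly_le_of_roots_far[OF deg, of n e]) (auto simp: not_less)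
        then show False using elim by simp
      qed
    qed
  qed
  have closest: "\<exists>\<zeta>. (\<exists>r. poly (P n) r = 0) \<longrightarrow> poly (P n) \<zeta> = 0 \<and> (\<forall>r. poly (P n) r = 0 \<longrightarrow> dist z \<zeta> \<le> dist z r)" for n
  proof (cases "\<exists>r. poly (P n) r = 0")
    case True
    have "closed {r. poly (P n) r = 0}" by (intro closed_Collect_eq continuous_intros)
    then obtain \<zeta> where "\<zeta> \<in> {r. poly (P n) r = 0}" "\<And>y. y \<in> {r. poly (P n) r = 0} \<Longrightarrow> dist z \<zeta> \<le> dist z y"
      using distance_attains_inf[of "{r. poly (P n) r = 0}" z] True by blast
    then show ?thesis by blast
  qed blast
  then obtain \<zeta> where \<zeta>: "\<And>n. (\<exists>r. poly (P n) r = 0) \<Longrightarrow> poly (P n) (\<zeta> n) = 0"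
      "\<And>n r. poly (P n) r = 0 \<Longrightarrow> dist z (\<zeta> n) \<le> dist z r" by metis
  show thesis
  proof (rule that[of \<zeta>])
    show "\<zeta> \<longlonglongrightarrow> z"
    proof (rule tendstoI)
      fix e :: real assume "e > 0"
      from near[OF this] show "eventually (\<lambda>n. dist (\<zeta> n) z < e) sequentially"
      proof eventually_elim
        case (elim n)
        then show ?case using \<zeta>(2) by (metis dist_commute order_le_less_trans)
      qed
    qed
    show "eventually (\<lambda>n. poly (P n) (\<zeta> n) = 0) sequentially"
      using near[OF zero_less_one] by eventually_elim (use \<zeta>(1) in auto)
  qed
qed

definition lagrange_basis :: "'i set \<Rightarrow> ('i \<Rightarrow> complex) \<Rightarrow> 'i \<Rightarrow> complex poly" where
  "lagrange_basis I w k = (\<Prod>l\<in>I - {k}. smult (1 / (w k - w l)) [:- w l, 1:])"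

lemma degree_lagrange_basis:
  assumes "finite I" "k \<in> I"
  shows "degree (lagrange_basis I w k) < card I"
proof -
  have "degree (lagrange_basis I w k) \<le> (\<Sum>l\<in>I - {k}. degree (smult (1 / (w k - w l)) [:- w l, 1:]))"
    unfolding lagrange_basis_def using degree_prod_sum_le[of "I - {k}" "\<lambda>l. smult (1 / (w k - w l)) [:- w l, 1:]"] assms
    by (simp only: comp_def finite_Diff)
  also have "\<dots> \<le> (\<Sum>l\<in>I - {k}. 1)" by (intro sum_mono) (simp add: degree_smult_eq)
  also have "\<dots> < card I" using assms card_gt_0_iff[of I] by auto
  finally show ?thesis .
qed

lemma poly_lagrange_basis:
  assumes "finite I" "inj_on w I" "k \<in> I" "j \<in> I"
  shows "poly (lagrange_basis I w k) (w j) = (if j = k then 1 else 0)"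
proof (cases "j = k")
  case True
  have "w k - w l \<noteq> 0" if "l \<in> I - {k}" for l
    using that assms by (auto dest: inj_onD)
  then show ?thesis
    unfolding lagrange_basis_def poly_prod using True
    by (intro trans[OF prod.neutral]) (auto simp: diff_divide_distrib[symmetric])
next
  case False
  then show ?thesis
    unfolding lagrange_basis_def poly_prod using assms by auto
qed

lemma lagrange_interpolation:
  assumes "finite I" "inj_on w I"
  shows "degree (\<Sum>k\<in>I. smult (v k) (lagrange_basis I w k)) \<le> card I - 1"
    and "j \<in> I \<Longrightarrow> poly (\<Sum>k\<in>I. smult (v k) (lagrange_basis I w k)) (w j) = v j"
proof -
  have "degree (lagrange_basis I w k) \<le> card I - 1" if "k \<in> I" for k
    using degree_lagrange_basis[OF assms(1) that, of w] by simp
  then show "degree (\<Sum>k\<in>I. smult (v k) (lagrange_basis I w k)) \<le> card I - 1"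
    by (intro degree_sum_le) (use assms(1) in \<open>auto intro: order.trans[OF degree_smult_le]\<close>)
  show "poly (\<Sum>k\<in>I. smult (v k) (lagrange_basis I w k)) (w j) = v j" if "j \<in> I"
  proof -
    have "poly (\<Sum>k\<in>I. smult (v k) (lagrange_basis I w k)) (w j) = (\<Sum>k\<in>I. if k = j then v k else 0)"
      unfolding poly_sum by (intro sum.cong) (use assms that poly_lagrange_basis[OF assms] in auto)
    then show ?thesis using assms(1) that by simp
  qed
qed

lemma poly_eqI_card:
  fixes p q :: "complex poly"
  assumes "finite I" "inj_on w I" "\<And>k. k \<in> I \<Longrightarrow> poly p (w k) = poly q (w k)"
    and "degree p < card I" "degree q < card I"
  shows "p = q"
  by (rule poly_eqI_degree[of "w ` I"]) (use assms in \<open>auto simp: card_image\<close>)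

text \<open>
  Interpolation at finitely many points of \<open>S\<close> expresses \<open>R n\<close> through its values there, which
  converge.
\<close>

lemma polynomial_limit:
  fixes R :: "nat \<Rightarrow> complex poly"
  assumes deg: "\<And>n. degree (R n) \<le> D" and "infinite S" and lim: "\<And>w. w \<in> S \<Longrightarrow> (\<lambda>n. poly (R n) w) \<longlonglongrightarrow> l w"
  obtains Q where "\<And>w. (\<lambda>n. poly (R n) w) \<longlonglongrightarrow> poly Q w"
proof -
  obtain T where T: "T \<subseteq> S" "finite T" "card T = Suc D"
    using infinite_arbitrarily_large[OF assms(2)] by blast
  let ?I = "\<lambda>v. \<Sum>t\<in>T. smult (v t) (lagrange_basis T (\<lambda>t. t) t)"
  have R: "R n = ?I (poly (R n))" for n
  proof (rule poly_eqI_card[OF T(2), of "\<lambda>t. t"])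
    show "degree (?I (poly (R n))) < card T"
      using lagrange_interpolation(1)[OF T(2), of "\<lambda>t. t" "poly (R n)"] T(3) by simp
    show "poly (R n) k = poly (?I (poly (R n))) k" if "k \<in> T" for k
      using lagrange_interpolation(2)[OF T(2), of "\<lambda>t. t" k "poly (R n)"] that by simp
  qed (use deg T in \<open>auto simp: less_Suc_eq_le\<close>)
  have "(\<lambda>n. poly (?I (poly (R n))) w) \<longlonglongrightarrow> poly (?I l) w" for w
    unfolding poly_sum poly_smult using T lim by (intro tendsto_intros) auto
  then show thesis using that[of "?I l"] R by simp
qed

section \<open>Families with a parameter\<close>

definition specialize :: "complex \<Rightarrow> complex poly poly \<Rightarrow> complex poly" where
  "specialize t = map_poly (\<lambda>c. poly c t)"

lemma coeff_specialize [simp]: "coeff (specialize t P) i = poly (coeff P i) t"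
  by (simp add: specialize_def coeff_map_poly)

lemma specialize_0 [simp]: "specialize t 0 = 0" by (simp add: poly_eq_iff)

lemma specialize_pCons [simp]: "specialize t (pCons c P) = pCons (poly c t) (specialize t P)"
  by (simp add: poly_eq_iff coeff_pCons split: nat.split)

lemma specialize_add [simp]: "specialize t (P + Q) = specialize t P + specialize t Q"
  by (simp add: poly_eq_iff)

lemma specialize_diff [simp]: "specialize t (P - Q) = specialize t P - specialize t Q"
  by (simp add: poly_eq_iff)

lemma specialize_smult [simp]: "specialize t (smult c P) = smult (poly c t) (specialize t P)"
  by (simp add: poly_eq_iff)

lemma specialize_mult [simp]: "specialize t (P * Q) = specialize t P * specialize t Q"
  by (simp add: poly_eq_iff coeff_mult poly_sum)

lemma specialize_monom [simp]: "specialize t (monom c n) = monom (poly c t) n"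
  by (simp add: poly_eq_iff)

lemma specialize_pcompose [simp]: "specialize t (P \<circ>\<^sub>p Q) = specialize t P \<circ>\<^sub>p specialize t Q"
  by (induction P) (simp_all add: pcompose_pCons)

lemma specialize_pderiv: "specialize t (pderiv P) = pderiv (specialize t P)"
  by (simp add: poly_eq_iff coeff_pderiv)

lemma poly_specialize: "poly (specialize t P) (poly c t) = poly (poly P c) t"
  by (induction P) simp_all

lemma degree_specialize:
  assumes "poly (lead_coeff P) t \<noteq> 0"
  shows "degree (specialize t P) = degree P"
proof (rule antisym)
  show "degree (specialize t P) \<le> degree P" by (rule degree_le) (simp add: coeff_eq_0)
  show "degree P \<le> degree (specialize t P)" using assms by (intro le_degree) simp
qed

text \<open>
  The Euclidean algorithm with a parameter: unless the leading coefficient of \<open>Q\<close> vanishes at \<open>t\<close>, the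
  common roots at \<open>t\<close> remain the same when \<open>P\<close> is replaced by its pseudo-remainder, so each step
  disturbs only finitely many \<open>t\<close>. This does the work of a resultant.
\<close>

lemma common_root_dichotomy:
  fixes P Q :: "complex poly poly"
  defines "B \<equiv> {t. \<exists>z. poly (specialize t P) z = 0 \<and> poly (specialize t Q) z = 0}"
  shows "finite B \<or> finite (- B)"
  unfolding B_def
proof (induction "degree P + degree Q" arbitrary: P Q rule: less_induct)
  case less
  define CR where "CR = (\<lambda>P Q t. \<exists>z. poly (specialize t P) z = 0 \<and> poly (specialize t Q) z = 0)"
  have main: "finite {t. CR P Q t} \<or> finite (- {t. CR P Q t})"
    if IH: "\<And>P'. degree P' < degree P \<Longrightarrow> finite {t. CR P' Q t} \<or> finite (- {t. CR P' Q t})"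
      and le: "degree Q \<le> degree P" for P Q
  proof -
    consider "Q = 0" "degree P = 0" | "Q = 0" "degree P > 0" | "Q \<noteq> 0" "degree Q = 0" | "degree Q > 0" by auto
    then show ?thesis
    proof cases
      case 1
      then obtain p where p: "P = [:p:]" by (meson degree_eq_zeroE)
      show ?thesis
      proof (cases "p = 0")
        case True
        then show ?thesis using 1 p by (simp add: CR_def)
      next
        case False
        then show ?thesis using 1 p poly_roots_finite[of p] by (simp add: CR_def)
      qed
    next
      case 2
      have "- {t. CR P Q t} \<subseteq> {t. poly (lead_coeff P) t = 0}"
      proof
        fix t assume t: "t \<in> - {t. CR P Q t}"
        show "t \<in> {t. poly (lead_coeff P) t = 0}"
        proof (rule ccontr)
          assume "t \<notin> {t. poly (lead_coeff P) t = 0}"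
          then have "degree (specialize t P) > 0" using degree_specialize 2 by simp
          then have "\<exists>z. poly (specialize t P) z = 0"
            using fundamental_theorem_of_algebra[of "specialize t P"] by (simp add: constant_degree)
          then show False using t 2 by (simp add: CR_def)
        qed
      qed
      moreover have "lead_coeff P \<noteq> 0" using 2 by auto
      ultimately show ?thesis using poly_roots_finite[of "lead_coeff P"] finite_subset by blast
    next
      case 3
      then obtain q where q: "Q = [:q:]" by (meson degree_eq_zeroE)
      then have "q \<noteq> 0" using 3 by auto
      then show ?thesis using q poly_roots_finite[of q]
        by (auto simp: CR_def intro: finite_subset)
    next
      case 4
      define P' where "P' = smult (lead_coeff Q) P - monom (lead_coeff P) (degree P - degree Q) * Q"
      have "degree P' < degree P"
      proof -
        have "degree P' \<le> degree P"
          unfolding P'_def using le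
          by (intro degree_diff_le order.trans[OF degree_smult_le] order.trans[OF degree_mult_le])
             (auto intro: order.trans[OF add_right_mono[OF degree_monom_le]])
        moreover have "coeff P' (degree P) = 0"
          unfolding P'_def using le
          by (simp add: coeff_monom_mult)
        moreover have "degree P > 0" using 4 le by simp
        ultimately show ?thesis
          by (metis coeff_0_degree_minus_1 degree_0 diff_less leading_coeff_0_iff le_neq_implies_less zero_less_one)
      qed
      have eq: "CR P' Q t \<longleftrightarrow> CR P Q t" if "poly (lead_coeff Q) t \<noteq> 0" for t
      proof -
        have "poly (specialize t P') z = poly (lead_coeff Q) t * poly (specialize t P) z"
          if "poly (specialize t Q) z = 0" for z using that by (simp add: P'_def)
        then show ?thesis using that unfolding CR_def by (metis mult_eq_0_iff)
      qed
      let ?Z = "{t. poly (lead_coeff Q) t = 0}"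
      have "lead_coeff Q \<noteq> 0" using 4 by auto
      then have Z: "finite ?Z" by (rule poly_roots_finite)
      have "{t. CR P Q t} \<subseteq> {t. CR P' Q t} \<union> ?Z" "- {t. CR P Q t} \<subseteq> - {t. CR P' Q t} \<union> ?Z"
        using eq by auto
      then show ?thesis using IH[OF \<open>degree P' < degree P\<close>] Z
        by (meson finite_Un finite_subset)
    qed
  qed
  have IH: "finite {t. CR P' Q' t} \<or> finite (- {t. CR P' Q' t})"
    if "degree P' + degree Q' < degree P + degree Q" for P' Q'
    unfolding CR_def by (rule less[OF that])
  have "finite {t. CR P Q t} \<or> finite (- {t. CR P Q t})"
  proof (cases "degree Q \<le> degree P")
    case True
    then show ?thesis by (intro main[OF IH]) auto
  next
    case False
    then have "finite {t. CR Q P t} \<or> finite (- {t. CR Q P t})" by (intro main[OF IH]) auto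
    moreover have "CR Q P = CR P Q" by (auto simp: CR_def fun_eq_iff)
    ultimately show ?thesis by simp
  qed
  then show ?case by (simp add: CR_def)
qed

section \<open>Dynatomic polynomials\<close>

definition period_poly :: "complex poly \<Rightarrow> nat \<Rightarrow> complex poly" where
  "period_poly f N = poly_iterate f N - [:0, 1:]"

lemma poly_iterate_simps [simp]:
  "poly_iterate f 0 = [:0, 1:]" "poly_iterate f (Suc N) = f \<circ>\<^sub>p poly_iterate f N"
  by (simp_all add: poly_iterate_def)

lemma poly_poly_iterate: "poly (poly_iterate f N) z = (poly f ^^ N) z"
  by (induction N) (simp_all add: poly_pcompose)

lemma poly_period_poly: "poly (period_poly f N) z = (poly f ^^ N) z - z"
  by (simp add: period_poly_def poly_poly_iterate)

lemma degree_poly_iterate: "degree (poly_iterate f N) = degree f ^ N"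
  by (induction N) (simp_all add: degree_pcompose)

lemma degree_period_poly:
  assumes "degree f \<ge> 2" "N \<ge> 1"
  shows "degree (period_poly f N) = degree f ^ N"
proof -
  have "degree f ^ 1 \<le> degree f ^ N" using assms by (intro power_increasing) auto
  then have "degree [:0, 1 :: complex:] < degree (poly_iterate f N)"
    using assms by (simp add: degree_poly_iterate)
  then have "degree (poly_iterate f N + - [:0, 1:]) = degree (poly_iterate f N)"
    by (intro degree_add_eq_left) simp
  then show ?thesis unfolding period_poly_def degree_poly_iterate by (simp only: diff_conv_add_uminus)
qed

lemma period_poly_nonzero:
  assumes "degree f \<ge> 2" "N \<ge> 1"
  shows "period_poly f N \<noteq> 0"
  using degree_period_poly[OF assms] assms by auto

text \<open>
  The mean of the roots of \<open>f\<close>. If \<open>degree f \<ge> 2\<close>, it is the mean of the roots of \<open>f - c\<close> for every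
  constant \<open>c\<close>, which is why it is equivariant under conjugation.
\<close>

definition center :: "complex poly \<Rightarrow> complex" where
  "center f = - coeff f (degree f - 1) / (of_nat (degree f) * lead_coeff f)"

subsection \<open>Polynomials with simple periodic points are dense\<close>

definition poly_converges :: "(nat \<Rightarrow> complex poly) \<Rightarrow> complex poly \<Rightarrow> bool" where
  "poly_converges F f \<longleftrightarrow> (\<forall>n. degree (F n) = degree f) \<and> (\<forall>i. (\<lambda>n. coeff (F n) i) \<longlonglongrightarrow> coeff f i)"

lemma poly_converges_eval:
  assumes "poly_converges F f" "w \<longlonglongrightarrow> z"
  shows "(\<lambda>n. poly (F n) (w n)) \<longlonglongrightarrow> poly f z"
proof -
  have "poly (F n) (w n) = (\<Sum>i\<le>degree f. coeff (F n) i * w n ^ i)" for n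
    using assms(1) by (simp add: poly_altdef poly_converges_def)
  moreover have "(\<lambda>n. \<Sum>i\<le>degree f. coeff (F n) i * w n ^ i) \<longlonglongrightarrow> (\<Sum>i\<le>degree f. coeff f i * z ^ i)"
    using assms by (intro tendsto_intros) (auto simp: poly_converges_def)
  ultimately show ?thesis by (simp add: poly_altdef)
qed

lemma period_poly_converges:
  assumes "poly_converges F f"
  shows "(\<lambda>n. poly (period_poly (F n) N) z) \<longlonglongrightarrow> poly (period_poly f N) z"
proof -
  have "(\<lambda>n. (poly (F n) ^^ N) z) \<longlonglongrightarrow> (poly f ^^ N) z"
    by (induction N) (use poly_converges_eval[OF assms] in auto)
  then show ?thesis unfolding poly_period_poly by (intro tendsto_intros)
qed

lemma rsquarefree_iff_card_roots:
  fixes p :: "complex poly"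
  assumes "p \<noteq> 0"
  shows "rsquarefree p \<longleftrightarrow> card {z. poly p z = 0} = degree p"
proof
  assume "rsquarefree p"
  then have "smult (lead_coeff p) (\<Prod>z|poly p z = 0. [:-z, 1:]) = p"
    by (rule complex_poly_decompose_rsquarefree)
  then have "degree p = degree (smult (lead_coeff p) (\<Prod>z|poly p z = 0. [:-z, 1:]))" by simp
  also have "\<dots> = degree (\<Prod>z|poly p z = 0. [:-z, 1:])" using assms by simp
  also have "\<dots> = (\<Sum>z|poly p z = 0. degree [:-z, 1:])"
    by (rule degree_prod_sum_eq) auto
  finally show "card {z. poly p z = 0} = degree p" by simp
next
  assume card: "card {z. poly p z = 0} = degree p"
  show "rsquarefree p"
    unfolding rsquarefree_roots
  proof (intro allI notI)
    fix a assume a: "poly p a = 0 \<and> poly (pderiv p) a = 0"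
    then obtain q where q: "p = [:-a, 1:] * q" by (auto simp: poly_eq_0_iff_dvd dvd_def)
    have "q \<noteq> 0" using assms q by auto
    have "poly (pderiv p) a = poly q a" unfolding q pderiv_mult by (simp add: pderiv_pCons)
    then have "poly q a = 0" using a by simp
    then have "{z. poly p z = 0} = {z. poly q z = 0}" unfolding q by auto
    then have "card {z. poly p z = 0} \<le> degree q" using card_poly_roots_bound[OF \<open>q \<noteq> 0\<close>] by simp
    moreover have "degree p = Suc (degree q)" unfolding q using \<open>q \<noteq> 0\<close> by (subst degree_mult_eq) auto
    ultimately show False using card by simp
  qed
qed

text \<open>
  Approximations of distinct roots are distinct, so the number of roots cannot drop.
\<close>

lemma rsquarefree_eventually:
  fixes P :: "nat \<Rightarrow> complex poly"
  assumes lim: "\<And>w. (\<lambda>n. poly (P n) w) \<longlonglongrightarrow> poly Q w" and deg: "\<And>n. degree (P n) = degree Q"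
    and "degree Q > 0" "rsquarefree Q"
  shows "eventually (\<lambda>n. rsquarefree (P n)) sequentially"
proof -
  let ?R = "{z. poly Q z = 0}"
  have "Q \<noteq> 0" using assms(3) by auto
  then have fin: "finite ?R" by (rule poly_roots_finite)
  have "\<exists>\<zeta>. \<zeta> \<longlonglongrightarrow> z \<and> eventually (\<lambda>n. poly (P n) (\<zeta> n) = 0) sequentially" if "z \<in> ?R" for z
    by (rule roots_converge[OF lim _ \<open>Q \<noteq> 0\<close>, of "degree Q" z]) (use deg that in auto)
  then obtain \<zeta> where \<zeta>: "\<And>z. z \<in> ?R \<Longrightarrow> \<zeta> z \<longlonglongrightarrow> z"
      "\<And>z. z \<in> ?R \<Longrightarrow> eventually (\<lambda>n. poly (P n) (\<zeta> z n) = 0) sequentially" by metis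
  have "eventually (\<lambda>n. \<forall>z\<in>?R. \<forall>y\<in>?R. z \<noteq> y \<longrightarrow> \<zeta> z n \<noteq> \<zeta> y n) sequentially"
  proof (intro eventually_ball_finite ballI fin)
    fix z y assume zy: "z \<in> ?R" "y \<in> ?R"
    show "eventually (\<lambda>n. z \<noteq> y \<longrightarrow> \<zeta> z n \<noteq> \<zeta> y n) sequentially"
    proof (cases "z = y")
      case False
      have "(\<lambda>n. \<zeta> z n - \<zeta> y n) \<longlonglongrightarrow> z - y" by (intro tendsto_diff \<zeta> zy)
      then have "eventually (\<lambda>n. \<zeta> z n - \<zeta> y n \<noteq> 0) sequentially"
        using False by (intro tendsto_imp_eventually_ne) auto
      then show ?thesis by eventually_elim auto
    qed simp
  qed
  moreover have "eventually (\<lambda>n. \<forall>z\<in>?R. poly (P n) (\<zeta> z n) = 0) sequentially"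
    by (intro eventually_ball_finite ballI fin \<zeta>)
  ultimately show ?thesis
  proof eventually_elim
    case (elim n)
    have "P n \<noteq> 0" using deg[of n] assms(3) by auto
    have "inj_on (\<lambda>z. \<zeta> z n) ?R" using elim(1) by (auto simp: inj_on_def)
    then have "card ?R = card ((\<lambda>z. \<zeta> z n) ` ?R)" by (simp add: card_image)
    also have "\<dots> \<le> card {z. poly (P n) z = 0}"
      using elim(2) poly_roots_finite[OF \<open>P n \<noteq> 0\<close>] by (intro card_mono) auto
    finally have "degree (P n) \<le> card {z. poly (P n) z = 0}"
      using assms(4) rsquarefree_iff_card_roots[OF \<open>Q \<noteq> 0\<close>] deg by simp
    then have "card {z. poly (P n) z = 0} = degree (P n)"
      using card_poly_roots_bound[OF \<open>P n \<noteq> 0\<close>] by simp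
    then show ?case using rsquarefree_iff_card_roots[OF \<open>P n \<noteq> 0\<close>] by simp
  qed
qed

lemma sequence_avoiding_finite:
  fixes t :: complex
  assumes "finite B"
  obtains s where "s \<longlonglongrightarrow> t" "\<And>n. s n \<notin> B"
proof -
  obtain e where e: "e > 0" "\<And>b. b \<in> B \<Longrightarrow> b \<noteq> t \<Longrightarrow> e \<le> dist t b"
    using finite_set_avoid[OF assms, of t] by auto
  define s where "s = (\<lambda>n. t + of_real (e / (2 + real n)))"
  have "(\<lambda>n. e / (2 + real n)) \<longlonglongrightarrow> 0" by real_asymp
  from tendsto_add[OF tendsto_const[of t] tendsto_of_real[OF this]]
  have "s \<longlonglongrightarrow> t" by (simp add: s_def)
  moreover have "s n \<notin> B" for n
  proof
    assume "s n \<in> B"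
    have n: "norm (s n - t) = e / (2 + real n)" "e / (2 + real n) > 0"
      using \<open>e > 0\<close> unfolding s_def by (simp_all add: norm_divide del: of_real_divide)
    moreover have "e / (2 + real n) < e / 1"
      using \<open>e > 0\<close> by (intro divide_strict_left_mono) auto
    moreover have "s n \<noteq> t" using n by auto
    ultimately show False using e(2)[OF \<open>s n \<in> B\<close>] by (simp add: dist_norm norm_minus_commute)
  qed
  ultimately show thesis by (rule that)
qed

definition line_family :: "complex poly \<Rightarrow> complex poly \<Rightarrow> complex poly poly" where
  "line_family f g = map_poly (\<lambda>c. [:c:]) f + smult [:0, 1:] (map_poly (\<lambda>c. [:c:]) g)"

lemma specialize_line_family: "specialize t (line_family f g) = f + smult t g"
  by (simp add: line_family_def poly_eq_iff coeff_map_poly)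

text \<open>
  By the dichotomy it suffices to find infinitely many good parameters, and there are infinitely
  many close to the given one.
\<close>

lemma rsquarefree_period_poly_on_line:
  assumes "degree f \<ge> 2" "degree g < degree f" "N \<ge> 1" and sf: "rsquarefree (period_poly (f + smult t0 g) N)"
  shows "finite {t. \<not> rsquarefree (period_poly (f + smult t g) N)}"
proof -
  define H where "H = ((\<lambda>p. line_family f g \<circ>\<^sub>p p) ^^ N) [:0, 1:] - [:0, 1:]"
  have deg: "degree (f + smult t g) = degree f" for t
    using assms(2) by (intro degree_add_eq_left) (meson degree_smult_le le_less_trans)
  have it: "specialize t (((\<lambda>p. line_family f g \<circ>\<^sub>p p) ^^ n) [:0, 1:]) = poly_iterate (f + smult t g) n" for t n
    by (induction n) (simp_all add: specialize_line_family)
  have H: "specialize t H = period_poly (f + smult t g) N" for t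
    by (simp add: H_def it period_poly_def)
  define B where "B = {t. \<not> rsquarefree (period_poly (f + smult t g) N)}"
  have B: "B = {t. \<exists>z. poly (specialize t H) z = 0 \<and> poly (specialize t (pderiv H)) z = 0}"
    by (simp add: B_def rsquarefree_roots H specialize_pderiv)
  have "finite B \<or> finite (- B)" unfolding B by (rule common_root_dichotomy)
  moreover have "\<not> finite (- B)"
  proof
    assume "finite (- B)"
    then obtain s where s: "s \<longlonglongrightarrow> t0" "\<And>n. s n \<notin> - B" using sequence_avoiding_finite by metis
    have "poly_converges (\<lambda>n. f + smult (s n) g) (f + smult t0 g)"
      unfolding poly_converges_def using s(1) by (auto simp: deg intro!: tendsto_intros)
    then have "eventually (\<lambda>n. rsquarefree (period_poly (f + smult (s n) g) N)) sequentially"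
      using assms sf
      by (intro rsquarefree_eventually[of _ "period_poly (f + smult t0 g) N"])
         (auto simp: degree_period_poly deg intro: period_poly_converges)
    then obtain n where "rsquarefree (period_poly (f + smult (s n) g) N)"
      by (auto simp: eventually_sequentially)
    then show False using s(2)[of n] by (simp add: B_def)
  qed
  ultimately show ?thesis by (simp add: B_def)
qed

lemma rsquarefree_period_poly_monom:
  assumes "d \<ge> 2" "a \<noteq> 0" "N \<ge> 1"
  shows "rsquarefree (period_poly (monom a d) N)"
proof -
  have "\<exists>A. poly_iterate (monom a d) N = monom A (d ^ N)" for N
  proof (induction N)
    case 0
    show ?case by (rule exI[of _ 1]) (simp add: monom_altdef)
  next
    case (Suc N)
    then obtain A where A: "poly_iterate (monom a d) N = monom A (d ^ N)" by blast
    have "poly (poly_iterate (monom a d) (Suc N)) z = poly (monom (a * A ^ d) (d ^ Suc N)) z" for z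
      by (simp add: A poly_pcompose poly_monom power_mult_distrib mult_ac flip: power_mult)
    then show ?case using poly_eq_poly_eq_iff by blast
  qed
  then obtain A where A: "poly_iterate (monom a d) N = monom A (d ^ N)" by blast
  define e where "e = d ^ N"
  have "d ^ 1 \<le> d ^ N" using assms by (intro power_increasing) auto
  then have e: "e \<ge> 2" using assms by (simp add: e_def)
  show ?thesis
    unfolding rsquarefree_roots period_poly_def A e_def[symmetric]
  proof (intro allI notI)
    fix z assume z: "poly (monom A e - [:0, 1:]) z = 0 \<and> poly (pderiv (monom A e - [:0, 1:])) z = 0"
    then have 1: "A * z ^ e = z" and 2: "of_nat e * A * z ^ (e - 1) = 1"
      by (simp_all add: poly_monom pderiv_diff pderiv_monom pderiv_pCons)
    have "z ^ e = z * z ^ (e - 1)" using e by (cases e) auto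
    then have "of_nat e * z = z" using 1 2 by (metis mult.assoc mult.commute mult.right_neutral)
    then have "z = 0" using e by auto
    then show False using 2 e by (simp add: power_0_left)
  qed
qed

text \<open>
  Let \<open>a\<close> be the leading coefficient of \<open>f\<close>. The polynomial \<open>a z\<^sup>d + b\<close> has the two required properties
  for some \<open>b \<noteq> 0\<close>: its center is 0, and its points of period \<open>N\<close> are simple if \<open>b\<close> avoids a
  finite set, by comparison with \<open>b = 0\<close>. On the line from \<open>f\<close> to this polynomial the properties
  fail only for finitely many parameters.
\<close>

lemma generic_approximation:
  assumes f: "degree f \<ge> 2" and "N \<ge> 1"
  obtains F where "poly_converges F f" "\<And>n. rsquarefree (period_poly (F n) N)"
    "\<And>n. poly (F n) (center (F n)) \<noteq> center (F n)"
proof -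
  define d a where "d = degree f" and "a = lead_coeff f"
  have a: "a \<noteq> 0" and d: "d \<ge> 2" using f by (auto simp: a_def d_def)
  have deg_mon: "degree (monom a d) = d" using a by (simp add: degree_monom_eq)
  have "finite {b. \<not> rsquarefree (period_poly (monom a d + smult b [:1:]) N)}"
    by (rule rsquarefree_period_poly_on_line[of _ _ _ 0])
       (use d a assms rsquarefree_period_poly_monom deg_mon in auto)
  then have "finite ({b. \<not> rsquarefree (period_poly (monom a d + smult b [:1:]) N)} \<union> {0})" by simp
  from ex_new_if_finite[OF infinite_UNIV_char_0 this]
  obtain b where b: "b \<noteq> 0" "rsquarefree (period_poly (monom a d + [:b:]) N)" by auto
  define g where "g = monom a d + [:b:] - f"
  have "degree (monom a d + [:b:]) = d" using d deg_mon by (subst degree_add_eq_left) auto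
  then have "degree g \<le> d" unfolding g_def d_def by (intro degree_diff_le) auto
  moreover have "coeff g d = 0" using d by (simp add: g_def a_def d_def coeff_pCons split: nat.split)
  ultimately have g: "degree g < d"
    using d by (metis degree_0 gr0I leading_coeff_0_iff le_neq_implies_less not_numeral_le_zero)
  have deg: "degree (f + smult t g) = d" for t
    using g unfolding d_def by (intro degree_add_eq_left) (meson degree_smult_le le_less_trans)
  have "finite {t. \<not> rsquarefree (period_poly (f + smult t g) N)}"
    by (rule rsquarefree_period_poly_on_line[of _ _ _ 1]) (use f g b assms d_def in \<open>auto simp: g_def\<close>)
  moreover have "finite {t. poly (f + smult t g) (center (f + smult t g)) = center (f + smult t g)}"
  proof -
    define C where "C = [:- coeff f (d - 1) / (of_nat d * a), - coeff g (d - 1) / (of_nat d * a):]"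
    have C: "center (f + smult t g) = poly C t" for t
    proof -
      have "coeff (f + smult t g) d = a" using \<open>coeff g d = 0\<close> by (simp add: a_def d_def)
      then show ?thesis by (simp add: center_def deg C_def add_divide_distrib diff_divide_distrib)
    qed
    have "poly (f + smult t g) (center (f + smult t g)) - center (f + smult t g)
       = poly (poly (line_family f g) C - C) t" for t
      using poly_specialize[of t "line_family f g" C] by (simp add: specialize_line_family C)
    then have "{t. poly (f + smult t g) (center (f + smult t g)) = center (f + smult t g)}
        = {t. poly (poly (line_family f g) C - C) t = 0}" by (metis (no_types, lifting) eq_iff_diff_eq_0)
    moreover have "poly (line_family f g) C - C \<noteq> 0"
    proof
      assume "poly (line_family f g) C - C = 0"
      then have "poly (poly (line_family f g) C - C) 1 = 0" by simp
      then have "poly (f + smult 1 g) (poly C 1) = poly C 1"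
        using poly_specialize[of 1 "line_family f g" C] by (simp add: specialize_line_family)
      moreover have "poly C 1 = 0"
      proof -
        have "coeff (monom a d + [:b:]) (d - 1) = 0" using d by (auto simp: coeff_pCons split: nat.split)
        then have "coeff f (d - 1) + coeff g (d - 1) = 0" by (simp add: g_def)
        then have "coeff f (d - 1) = - coeff g (d - 1)" by (simp only: eq_neg_iff_add_eq_0)
        then show ?thesis by (simp add: C_def)
      qed
      ultimately show False using b d by (simp add: g_def poly_monom power_0_left)
    qed
    ultimately show ?thesis using poly_roots_finite by metis
  qed
  ultimately have "finite ({t. \<not> rsquarefree (period_poly (f + smult t g) N)} \<union>
     {t. poly (f + smult t g) (center (f + smult t g)) = center (f + smult t g)})" (is "finite ?B") by blast
  then obtain s where s: "s \<longlonglongrightarrow> 0" "\<And>n. s n \<notin> ?B" by (rule sequence_avoiding_finite[where t = 0]) blast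
  have "poly_converges (\<lambda>n. f + smult (s n) g) f"
    unfolding poly_converges_def
  proof (intro conjI allI)
    fix i
    have "(\<lambda>n. coeff f i + s n * coeff g i) \<longlonglongrightarrow> coeff f i + 0 * coeff g i" by (intro tendsto_intros s(1))
    then show "(\<lambda>n. coeff (f + smult (s n) g) i) \<longlonglongrightarrow> coeff f i" by simp
  qed (simp add: deg d_def[symmetric])
  then show thesis using that[of "\<lambda>n. f + smult (s n) g"] s(2) by auto
qed

subsection \<open>Existence, continuity and roots\<close>

text \<open>
  The only candidate for the dynatomic polynomials, up to the exactness of the divisions.
\<close>

function dynatomic_rec :: "complex poly \<Rightarrow> nat \<Rightarrow> complex poly" where
  "dynatomic_rec f N = (if N = 0 then 1 else period_poly f N div (\<Prod>k | k dvd N \<and> k < N. dynatomic_rec f k))"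
  by auto
termination by (relation "Wellfounded.measure snd") auto

declare dynatomic_rec.simps [simp del]

lemma funpow_gcd_fixed:
  assumes "(g ^^ j) z = z" "(g ^^ k) z = z"
  shows "(g ^^ gcd j k) z = z"
  using assms
proof (induction j k rule: gcd_nat_induct)
  case (step m n)
  then show ?case using funpow_mod_eq[of n g z m] by (simp add: gcd_red_nat[of m n])
qed simp

definition dynatomic_upto :: "complex poly \<Rightarrow> nat \<Rightarrow> (nat \<Rightarrow> complex poly) \<Rightarrow> bool" where
  "dynatomic_upto f N \<Phi> \<longleftrightarrow> (\<forall>n. 1 \<le> n \<longrightarrow> n < N \<longrightarrow> period_poly f n = (\<Prod>k | k dvd n. \<Phi> k))"

lemma proper_divisors_insert:
  assumes "N \<ge> (1::nat)"
  shows "{k. k dvd N} = insert N {k. k dvd N \<and> k < N}" and "finite {k. k dvd N \<and> k < N}" "finite {k. k dvd N}"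
proof -
  have "k = N \<or> k < N" if "k dvd N" for k
    using dvd_imp_le[OF that] assms by linarith
  then show "{k. k dvd N} = insert N {k. k dvd N \<and> k < N}" by auto
  show fin: "finite {k. k dvd N}" using assms by simp
  show "finite {k. k dvd N \<and> k < N}" by (rule finite_subset[OF _ fin]) blast
qed

lemma dynatomic_product_dvd:
  assumes f: "degree f \<ge> 2" and \<Phi>: "dynatomic_upto f N \<Phi>" and "n \<ge> 1" "n < N"
    and I: "I \<subseteq> {k. k dvd n}"
  shows "(\<Prod>k\<in>I. \<Phi> k) dvd period_poly f n"
proof -
  have "period_poly f n = (\<Prod>k | k dvd n. \<Phi> k)" using \<Phi> assms(3,4) by (simp add: dynatomic_upto_def)
  then show ?thesis using prod_dvd_prod_subset[OF proper_divisors_insert(3)[OF \<open>n \<ge> 1\<close>] I] by simp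
qed

text \<open>
  A common root of the factors would be a double root of the product.
\<close>

lemma rsquarefree_no_common_root:
  fixes p q h :: "complex poly"
  assumes "rsquarefree h" "p * q dvd h" "poly p z = 0" "poly q z = 0"
  shows False
proof -
  obtain c where c: "h = p * q * c" using assms(2) by (auto simp: dvd_def)
  have "poly h z = 0 \<and> poly (pderiv h) z = 0"
    unfolding c pderiv_mult using assms(3,4) by simp
  then show False using assms(1) unfolding rsquarefree_roots by blast
qed

text \<open>
  Modulo \<open>f\<^sup>k(z) - z\<close> the iterate \<open>f\<^sup>k\<close> is congruent to \<open>z\<close>, hence so are all its iterates.
\<close>

lemma period_poly_dvd:
  assumes "k dvd N"
  shows "period_poly f k dvd period_poly f N"
proof -
  obtain m where m: "N = k * m" using assms by (auto simp: dvd_def)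
  have "period_poly f k dvd period_poly f (k * m)"
  proof (induction m)
    case (Suc m)
    have "poly_iterate f (k * Suc m) = poly_iterate f k \<circ>\<^sub>p poly_iterate f (k * m)"
      by (rule poly_eq_poly_eq_iff[THEN iffD1])
         (simp add: fun_eq_iff poly_pcompose poly_poly_iterate funpow_add)
    then have "period_poly f (k * Suc m) = period_poly f k \<circ>\<^sub>p poly_iterate f (k * m) + period_poly f (k * m)"
      by (simp add: period_poly_def pcompose_diff pcompose_pCons)
    moreover have "period_poly f k dvd period_poly f k \<circ>\<^sub>p poly_iterate f (k * m)"
    proof -
      have gen: "q - [:0, 1:] dvd p \<circ>\<^sub>p q - p" for p q :: "complex poly"
      proof (induction p)
        case (pCons a p)
        have "pCons a p \<circ>\<^sub>p q - pCons a p = q * (p \<circ>\<^sub>p q - p) + (q - [:0, 1:]) * p"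
          by (simp add: pcompose_pCons algebra_simps)
        then show ?case using pCons by simp
      qed simp
      have "poly_iterate f (k * m) - [:0, 1:] dvd period_poly f k \<circ>\<^sub>p poly_iterate f (k * m) - period_poly f k"
        by (rule gen)
      then have "period_poly f k dvd period_poly f k \<circ>\<^sub>p poly_iterate f (k * m) - period_poly f k"
        using Suc by (metis dvd_trans period_poly_def)
      from dvd_add[OF this dvd_refl[of "period_poly f k"]] show ?thesis by simp
    qed
    ultimately show ?case using Suc by simp
  qed (simp add: period_poly_def)
  then show ?thesis by (simp add: m)
qed

lemma prod_dvd_of_no_common_root:
  fixes \<Phi> :: "'i \<Rightarrow> complex poly"
  assumes "finite I" "h \<noteq> 0" "\<And>i. i \<in> I \<Longrightarrow> \<Phi> i dvd h"
    and "\<And>i j z. i \<in> I \<Longrightarrow> j \<in> I \<Longrightarrow> i \<noteq> j \<Longrightarrow> poly (\<Phi> i) z = 0 \<Longrightarrow> poly (\<Phi> j) z = 0 \<Longrightarrow> False"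
  shows "(\<Prod>i\<in>I. \<Phi> i) dvd h"
  using assms(1,3,4)
proof (induction I rule: finite_induct)
  case (insert i I)
  have "coprime (\<Phi> i) (\<Prod>j\<in>I. \<Phi> j)"
  proof (rule prod_coprime_right)
    fix j assume j: "j \<in> I"
    show "coprime (\<Phi> i) (\<Phi> j)"
    proof (rule coprimeI)
      fix c assume c: "c dvd \<Phi> i" "c dvd \<Phi> j"
      have "c \<noteq> 0" using c insert.prems(1)[of i] \<open>h \<noteq> 0\<close> by auto
      have "degree c = 0"
      proof (rule ccontr)
        assume "degree c \<noteq> 0"
        then obtain z where "poly c z = 0"
          using fundamental_theorem_of_algebra[of c] by (auto simp: constant_degree)
        then have "poly (\<Phi> i) z = 0" "poly (\<Phi> j) z = 0" using c by (auto simp: dvd_def)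
        then show False using insert.prems(2)[of i j z] insert.hyps j by auto
      qed
      then show "is_unit c" using \<open>c \<noteq> 0\<close> by (simp add: is_unit_iff_degree)
    qed
  qed
  moreover have "(\<Prod>j\<in>I. \<Phi> j) dvd h"
    by (rule insert.IH) (use insert.prems in blast)+
  ultimately show ?case using insert.hyps insert.prems(1)[of i] by (simp add: divides_mult)
qed simp

text \<open>
  The quotients \<open>R n\<close> converge at the points where \<open>q\<close> does not vanish. Their degrees are bounded, so
  they converge to a polynomial.
\<close>

lemma dynatomic_limit:
  assumes conv: "poly_converges F f" and f: "degree f \<ge> 2" and "N \<ge> 1"
    and Q: "\<And>z. (\<lambda>n. poly (Q n) z) \<longlonglongrightarrow> poly q z" "q \<noteq> 0"
    and R: "\<And>n. period_poly (F n) N = Q n * R n"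
  obtains r where "period_poly f N = q * r" "\<And>z. (\<lambda>n. poly (R n) z) \<longlonglongrightarrow> poly r z"
proof -
  have deg: "degree (R n) \<le> degree f ^ N" for n
  proof -
    have F: "degree (F n) = degree f" using conv by (simp add: poly_converges_def)
    have "R n dvd period_poly (F n) N" "period_poly (F n) N \<noteq> 0"
      using R period_poly_nonzero[of "F n" N] f \<open>N \<ge> 1\<close> F by auto
    then show ?thesis using dvd_imp_degree_le degree_period_poly[of "F n" N] f \<open>N \<ge> 1\<close> F by metis
  qed
  have inf: "infinite {z. poly q z \<noteq> 0}"
  proof
    assume "finite {z. poly q z \<noteq> 0}"
    then have "finite ({z. poly q z \<noteq> 0} \<union> {z. poly q z = 0})" using poly_roots_finite[OF \<open>q \<noteq> 0\<close>] by simp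
    moreover have "{z. poly q z \<noteq> 0} \<union> {z. poly q z = 0} = UNIV" by blast
    ultimately show False using infinite_UNIV_char_0 by metis
  qed
  have lim: "(\<lambda>n. poly (R n) z) \<longlonglongrightarrow> poly (period_poly f N) z / poly q z" if "z \<in> {z. poly q z \<noteq> 0}" for z
  proof -
    have nz: "poly q z \<noteq> 0" using that by simp
    have "(\<lambda>n. poly (period_poly (F n) N) z / poly (Q n) z) \<longlonglongrightarrow> poly (period_poly f N) z / poly q z"
      by (intro tendsto_divide period_poly_converges conv Q(1) nz)
    moreover have "eventually (\<lambda>n. poly (Q n) z \<noteq> 0) sequentially"
      by (rule tendsto_imp_eventually_ne[OF Q(1) nz])
    then have "eventually (\<lambda>n. poly (period_poly (F n) N) z / poly (Q n) z = poly (R n) z) sequentially"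
      by eventually_elim (simp add: R)
    ultimately show ?thesis by (rule Lim_transform_eventually)
  qed
  obtain r where r: "\<And>z. (\<lambda>n. poly (R n) z) \<longlonglongrightarrow> poly r z"
    using polynomial_limit[OF deg inf lim] by blast
  have "poly (period_poly f N) z = poly (q * r) z" for z
  proof (rule LIMSEQ_unique)
    show "(\<lambda>n. poly (period_poly (F n) N) z) \<longlonglongrightarrow> poly (period_poly f N) z"
      by (rule period_poly_converges[OF conv])
    show "(\<lambda>n. poly (period_poly (F n) N) z) \<longlonglongrightarrow> poly (q * r) z"
      unfolding R poly_mult by (intro tendsto_mult Q r)
  qed
  then have "period_poly f N = q * r" using poly_eq_poly_eq_iff by blast
  then show thesis using that r by blast
qed

text \<open>
  If the points of period \<open>N\<close> are simple, the factors for two divisors \<open>k \<noteq> j\<close> of \<open>N\<close> have no common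
  root: such a root \<open>z\<close> would have period \<open>gcd k j\<close>, which is a proper divisor of \<open>k\<close> or of \<open>j\<close>, and
  would then be a double root of the period polynomial for \<open>k\<close> or \<open>j\<close>. Thus the division is exact for
  a dense set of polynomials, and exactness survives in the limit. Taking limits uses the
  continuity of the lower factors, so exactness and continuity are proved by one induction.
\<close>

lemma dynatomic_rec_properties:
  assumes d: "d \<ge> 2" and "N \<ge> 1"
  shows "(\<forall>f. degree f = d \<longrightarrow> period_poly f N = (\<Prod>k | k dvd N. dynatomic_rec f k)) \<and>
    (\<forall>F f. degree f = d \<longrightarrow> poly_converges F f \<longrightarrow>
       (\<forall>z. (\<lambda>n. poly (dynatomic_rec (F n) N) z) \<longlonglongrightarrow> poly (dynatomic_rec f N) z))"
  using \<open>N \<ge> 1\<close>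
proof (induction N rule: less_induct)
  case (less N)
  define Q where "Q = (\<lambda>f. \<Prod>k | k dvd N \<and> k < N. dynatomic_rec f k)"
  have pos: "k \<ge> 1" if "k dvd N" for k using that less.prems by (cases k) auto
  have upto: "dynatomic_upto f N (dynatomic_rec f)" if "degree f = d" for f
    using less.IH that by (simp add: dynatomic_upto_def)
  have rec_dvd: "dynatomic_rec f k dvd period_poly f k" if "degree f = d" "k dvd N" "k < N" for f k
    using dynatomic_product_dvd[OF _ upto[OF that(1)] pos[OF that(2)] that(3), of "{k}"] that d by simp
  have Q_nz: "Q f \<noteq> 0" if "degree f = d" for f
    unfolding Q_def
  proof (subst prod_zero_iff)
    show "\<not> (\<exists>k\<in>{k. k dvd N \<and> k < N}. dynatomic_rec f k = 0)"
    proof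
      assume "\<exists>k\<in>{k. k dvd N \<and> k < N}. dynatomic_rec f k = 0"
      then obtain k where k: "k dvd N" "k < N" "dynatomic_rec f k = 0" by blast
      then have "period_poly f k = 0" using rec_dvd[OF that k(1,2)] by simp
      then show False using period_poly_nonzero[of f k] pos[OF k(1)] that d by simp
    qed
  qed (use proper_divisors_insert(2)[OF less.prems] in simp)
  have Q_lim: "(\<lambda>n. poly (Q (F n)) z) \<longlonglongrightarrow> poly (Q f) z" if "degree f = d" "poly_converges F f" for F f z
    unfolding Q_def poly_prod by (intro tendsto_prod) (use less.IH pos that in auto)
  have generic: "Q f dvd period_poly f N" if f: "degree f = d" and sf: "rsquarefree (period_poly f N)" for f
    unfolding Q_def
  proof (rule prod_dvd_of_no_common_root)
    show "period_poly f N \<noteq> 0" using period_poly_nonzero f d less.prems by simp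
    have no_lower: False if k: "k dvd N" "k < N" and e: "e dvd k" "e < k" "e \<ge> 1"
        and z: "poly (dynatomic_rec f k) z = 0" "(poly f ^^ e) z = z" for k e z
    proof (rule rsquarefree_no_common_root[OF sf])
      have "period_poly f e = (\<Prod>i | i dvd e. dynatomic_rec f i)"
        using upto[OF f] k e by (simp add: dynatomic_upto_def)
      also have "\<dots> * dynatomic_rec f k = (\<Prod>i\<in>insert k {i. i dvd e}. dynatomic_rec f i)"
        using e proper_divisors_insert(3)[OF \<open>e \<ge> 1\<close>] by (subst prod.insert) (auto dest: dvd_imp_le)
      also have "\<dots> dvd period_poly f k"
        using k e f d upto[OF f] pos[OF k(1)] by (intro dynatomic_product_dvd) (auto intro: dvd_trans)
      also have "\<dots> dvd period_poly f N" by (rule period_poly_dvd[OF k(1)])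
      finally show "period_poly f e * dynatomic_rec f k dvd period_poly f N" .
      show "poly (period_poly f e) z = 0" using z by (simp add: poly_period_poly)
    qed (rule z)
    fix k j z
    assume k: "k \<in> {k. k dvd N \<and> k < N}" and j: "j \<in> {k. k dvd N \<and> k < N}" and "k \<noteq> j"
      and zk: "poly (dynatomic_rec f k) z = 0" and zj: "poly (dynatomic_rec f j) z = 0"
    have "poly (period_poly f k) z = 0" "poly (period_poly f j) z = 0"
      using rec_dvd[OF f, of k] rec_dvd[OF f, of j] k j zk zj by (auto simp: dvd_def)
    then have g: "(poly f ^^ gcd k j) z = z"
      by (intro funpow_gcd_fixed) (simp_all add: poly_period_poly)
    have "k \<ge> 1" "j \<ge> 1" using pos k j by auto
    then have "gcd k j \<ge> 1" by (simp add: Suc_le_eq)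
    show False
    proof (cases "gcd k j = k")
      case False
      then have "gcd k j < k" using \<open>k \<ge> 1\<close> by (simp add: le_neq_implies_less)
      then show False using no_lower[of k "gcd k j" z] k zk g \<open>gcd k j \<ge> 1\<close> by simp
    next
      case True
      then have "gcd k j < j" using \<open>k \<noteq> j\<close> \<open>j \<ge> 1\<close> by (metis gcd_le2_nat le_neq_implies_less not_one_le_zero)
      then show False using no_lower[of j "gcd k j" z] j zj g \<open>gcd k j \<ge> 1\<close> by simp
    qed
  next
    fix k assume "k \<in> {k. k dvd N \<and> k < N}"
    then show "dynatomic_rec f k dvd period_poly f N"
      using rec_dvd[OF f] period_poly_dvd dvd_trans by blast
  qed (use proper_divisors_insert(2)[OF less.prems] in simp)
  have all: "period_poly f N = Q f * dynatomic_rec f N" if f: "degree f = d" for f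
  proof -
    have "degree f \<ge> 2" using f d by simp
    obtain F where F: "poly_converges F f" "\<And>n. rsquarefree (period_poly (F n) N)"
      by (rule generic_approximation[OF \<open>degree f \<ge> 2\<close> less.prems]) blast
    have "Q (F n) dvd period_poly (F n) N" for n
      by (rule generic[OF _ F(2)]) (use F(1) f in \<open>simp add: poly_converges_def\<close>)
    then have "\<forall>n. \<exists>r. period_poly (F n) N = Q (F n) * r" by (simp add: dvd_def)
    then obtain R where R: "\<And>n. period_poly (F n) N = Q (F n) * R n" by metis
    obtain r where "period_poly f N = Q f * r"
      by (rule dynatomic_limit[OF F(1) \<open>degree f \<ge> 2\<close> less.prems Q_lim[OF f F(1)] Q_nz[OF f] R]) blast
    moreover have "dynatomic_rec f N = period_poly f N div Q f" using less.prems by (subst dynatomic_rec.simps) (simp add: Q_def)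
    ultimately show ?thesis using Q_nz[OF f] by simp
  qed
  show ?case
  proof (intro conjI allI impI)
    fix f :: "complex poly" assume "degree f = d"
    then show "period_poly f N = (\<Prod>k | k dvd N. dynatomic_rec f k)"
      using all proper_divisors_insert[OF less.prems] by (simp add: Q_def mult.commute)
  next
    fix F f z assume f: "degree f = d" and F: "poly_converges F f"
    have "degree (F n) = d" for n using f F by (simp add: poly_converges_def)
    then have R: "\<And>n. period_poly (F n) N = Q (F n) * dynatomic_rec (F n) N" using all by blast
    have "degree f \<ge> 2" using f d by simp
    obtain r where r: "period_poly f N = Q f * r" "\<And>z. (\<lambda>n. poly (dynatomic_rec (F n) N) z) \<longlonglongrightarrow> poly r z"
      by (rule dynatomic_limit[OF F \<open>degree f \<ge> 2\<close> less.prems Q_lim[OF f F] Q_nz[OF f] R]) blast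
    then have "r = dynatomic_rec f N" using all[OF f] Q_nz[OF f] by simp
    then show "(\<lambda>n. poly (dynatomic_rec (F n) N) z) \<longlonglongrightarrow> poly (dynatomic_rec f N) z" using r by blast
  qed
qed

lemma dynatomic_unique:
  assumes f: "degree f \<ge> 2"
    and "\<And>N. N \<ge> 1 \<Longrightarrow> period_poly f N = (\<Prod>k | k dvd N. \<Phi> k)"
    and "\<And>N. N \<ge> 1 \<Longrightarrow> period_poly f N = (\<Prod>k | k dvd N. \<Psi> k)"
    and "N \<ge> 1"
  shows "\<Phi> N = \<Psi> N"
  using \<open>N \<ge> 1\<close>
proof (induction N rule: less_induct)
  case (less N)
  have "k \<ge> 1" if "k dvd N" for k using that less.prems by (cases k) auto
  then have eq: "(\<Prod>k | k dvd N \<and> k < N. \<Phi> k) = (\<Prod>k | k dvd N \<and> k < N. \<Psi> k)"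
    using less.IH by (intro prod.cong) auto
  have 1: "period_poly f N = \<Phi> N * (\<Prod>k | k dvd N \<and> k < N. \<Phi> k)"
    "period_poly f N = \<Psi> N * (\<Prod>k | k dvd N \<and> k < N. \<Psi> k)"
    using assms(2,3)[OF less.prems] proper_divisors_insert[OF less.prems] by simp_all
  moreover have "period_poly f N \<noteq> 0" using period_poly_nonzero f less.prems by blast
  ultimately show ?case unfolding eq by (metis mult_right_cancel mult_zero_right)
qed

lemma dynatomic_product:
  assumes "degree f \<ge> 2" "N \<ge> 1"
  shows "period_poly f N = (\<Prod>k | k dvd N. dynatomic f k)"
proof -
  have "\<forall>N\<ge>1. poly_iterate f N - [:0, 1:] = (\<Prod>k | k dvd N. dynatomic_rec f k)"
    using dynatomic_rec_properties[OF assms(1)] by (simp add: period_poly_def)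
  then have "\<exists>\<Phi>. \<forall>N\<ge>1. poly_iterate f N - [:0, 1:] = (\<Prod>k | k dvd N. \<Phi> k)" by blast
  from someI_ex[OF this] show ?thesis using assms(2) by (simp add: dynatomic_def period_poly_def)
qed

lemma dynatomic_eq_rec:
  assumes "degree f \<ge> 2" "N \<ge> 1"
  shows "dynatomic f N = dynatomic_rec f N"
proof (rule dynatomic_unique[OF assms(1) _ _ assms(2)])
  fix n :: nat assume n: "n \<ge> 1"
  show "period_poly f n = (\<Prod>k | k dvd n. dynatomic f k)" by (rule dynatomic_product[OF assms(1) n])
  show "period_poly f n = (\<Prod>k | k dvd n. dynatomic_rec f k)" using dynatomic_rec_properties[OF assms(1) n] by simp
qed

lemma dynatomic_converges:
  assumes "degree f \<ge> 2" "N \<ge> 1" "poly_converges F f"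
  shows "(\<lambda>n. poly (dynatomic (F n) N) z) \<longlonglongrightarrow> poly (dynatomic f N) z"
proof -
  have "degree (F n) \<ge> 2" for n using assms by (simp add: poly_converges_def)
  then show ?thesis using dynatomic_rec_properties[OF assms(1,2)] assms by (simp add: dynatomic_eq_rec)
qed

lemma dynatomic_dvd:
  assumes "degree f \<ge> 2" "N \<ge> 1" "I \<subseteq> {k. k dvd N}"
  shows "(\<Prod>k\<in>I. dynatomic f k) dvd period_poly f N"
  unfolding dynatomic_product[OF assms(1,2)]
  by (rule prod_dvd_prod_subset[OF proper_divisors_insert(3)[OF assms(2)] assms(3)])

lemma dynatomic_nonzero:
  assumes "degree f \<ge> 2" "N \<ge> 1"
  shows "dynatomic f N \<noteq> 0"
  using dynatomic_dvd[OF assms, of "{N}"] period_poly_nonzero[OF assms] by auto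

lemma degree_dynatomic_le:
  assumes "degree f \<ge> 2" "N \<ge> 1"
  shows "degree (dynatomic f N) \<le> degree f ^ N"
  using dvd_imp_degree_le[of "dynatomic f N" "period_poly f N"] dynatomic_dvd[OF assms, of "{N}"]
    period_poly_nonzero[OF assms] degree_period_poly[OF assms] by simp

definition exact_period :: "('a \<Rightarrow> 'a) \<Rightarrow> nat \<Rightarrow> 'a \<Rightarrow> bool" where
  "exact_period g N z \<longleftrightarrow> (g ^^ N) z = z \<and> (\<forall>j. 0 < j \<longrightarrow> j < N \<longrightarrow> (g ^^ j) z \<noteq> z)"

lemma exact_period_imp_dynatomic_root:
  assumes f: "degree f \<ge> 2" and N: "N \<ge> 1" and z: "exact_period (poly f) N z"
  shows "poly (dynatomic f N) z = 0"
proof -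
  have "(\<Prod>k | k dvd N. poly (dynatomic f k) z) = poly (period_poly f N) z"
    by (simp add: dynatomic_product[OF f N] poly_prod)
  also have "\<dots> = 0" using z by (simp add: poly_period_poly exact_period_def)
  finally obtain k where k: "k dvd N" "poly (dynatomic f k) z = 0"
    using proper_divisors_insert(3)[OF N] by (auto simp: prod_zero_iff)
  have "k \<ge> 1" using k N by (cases k) auto
  have "poly (period_poly f k) z = 0"
    using dynatomic_dvd[OF f \<open>k \<ge> 1\<close>, of "{k}"] k(2) by (auto simp: dvd_def)
  then have "(poly f ^^ k) z = z" by (simp add: poly_period_poly)
  moreover have "k \<le> N" using k N by (auto intro: dvd_imp_le)
  ultimately have "k = N" using z \<open>k \<ge> 1\<close> unfolding exact_period_def by (cases "k < N") auto
  then show ?thesis using k by simp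
qed

text \<open>
  Otherwise the root would have a smaller period \<open>e\<close> dividing \<open>N\<close>, and would be a common root of two
  complementary factors of the period polynomial.
\<close>

lemma dynatomic_root_imp_exact_period:
  assumes f: "degree f \<ge> 2" and N: "N \<ge> 1" and sf: "rsquarefree (period_poly f N)"
    and z: "poly (dynatomic f N) z = 0"
  shows "exact_period (poly f) N z"
  unfolding exact_period_def
proof (intro conjI allI impI notI)
  have "poly (period_poly f N) z = 0"
    using dynatomic_dvd[OF f N, of "{N}"] z by (auto simp: dvd_def)
  then show *: "(poly f ^^ N) z = z" by (simp add: poly_period_poly)
  fix j assume j: "0 < j" "j < N" "(poly f ^^ j) z = z"
  define e where "e = gcd j N"
  have "e \<le> j" unfolding e_def using j(1) by (intro gcd_le1_nat) simp
  then have e: "e < N" using j(2) by simp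
  have e': "e \<ge> 1" "e dvd N" using j(1) by (simp_all add: e_def Suc_le_eq)
  note e = e' e
  have "(poly f ^^ e) z = z" unfolding e_def by (rule funpow_gcd_fixed[OF j(3) *])
  then have 0: "poly (period_poly f e) z = 0" by (simp add: poly_period_poly)
  show False
  proof (rule rsquarefree_no_common_root[OF sf _ 0 z])
    have "period_poly f e * dynatomic f N = (\<Prod>k\<in>insert N {k. k dvd e}. dynatomic f k)"
      unfolding dynatomic_product[OF f e(1)]
      using e proper_divisors_insert(3)[OF e(1)] by (subst prod.insert) (auto dest: dvd_imp_le)
    also have "\<dots> dvd period_poly f N"
      using e by (intro dynatomic_dvd[OF f N]) (auto intro: dvd_trans)
    finally show "period_poly f e * dynatomic f N dvd period_poly f N" .
  qed
qed

text \<open>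
  The period polynomial has \<open>d\<^sup>N\<close> distinct roots, more than the \<open>d + \<dots> + d\<^bsup>N - 1\<^esup>\<close> points that can
  have a smaller period.
\<close>

lemma exists_exact_period:
  assumes f: "degree f \<ge> 2" and N: "N \<ge> 1" and sf: "rsquarefree (period_poly f N)"
  obtains z where "exact_period (poly f) N z"
proof -
  let ?d = "degree f"
  have card: "card {z. poly (period_poly f N) z = 0} = ?d ^ N"
    using rsquarefree_iff_card_roots[OF period_poly_nonzero[OF f N]] sf degree_period_poly[OF f N] by simp
  have "card (\<Union>j\<in>{1..<N}. {z. poly (period_poly f j) z = 0}) \<le> (\<Sum>j\<in>{1..<N}. card {z. poly (period_poly f j) z = 0})"
    by (rule card_UN_le) simp
  also have "\<dots> \<le> (\<Sum>j\<in>{1..<N}. ?d ^ j)"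
  proof (rule sum_mono)
    fix j assume "j \<in> {1..<N}"
    then have "j \<ge> 1" by simp
    show "card {z. poly (period_poly f j) z = 0} \<le> ?d ^ j"
      using card_poly_roots_bound[OF period_poly_nonzero[OF f \<open>j \<ge> 1\<close>]] degree_period_poly[OF f \<open>j \<ge> 1\<close>] by simp
  qed
  also have "\<dots> \<le> (\<Sum>j<N. ?d ^ j)" by (rule sum_mono2) auto
  also have "\<dots> < ?d ^ N"
  proof -
    have "(\<Sum>j<N. ?d ^ j) < ?d ^ N" for N
    proof (induction N)
      case (Suc N)
      have "?d ^ N + ?d ^ N \<le> ?d * ?d ^ N" 
        unfolding mult_2[symmetric] using f by (intro mult_right_mono) auto
      then show ?case using Suc by simp
    qed simp
    then show ?thesis .
  qed
  finally have "\<not> {z. poly (period_poly f N) z = 0} \<subseteq> (\<Union>j\<in>{1..<N}. {z. poly (period_poly f j) z = 0})"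
  proof (rule contrapos_pn)
    assume sub: "{z. poly (period_poly f N) z = 0} \<subseteq> (\<Union>j\<in>{1..<N}. {z. poly (period_poly f j) z = 0})"
    have "finite (\<Union>j\<in>{1..<N}. {z. poly (period_poly f j) z = 0})"
      using period_poly_nonzero[OF f] by (intro finite_UN_I poly_roots_finite) auto
    from card_mono[OF this sub]
    show "\<not> card (\<Union>j\<in>{1..<N}. {z. poly (period_poly f j) z = 0}) < ?d ^ N" using card by simp
  qed
  then obtain z where "poly (period_poly f N) z = 0" "\<And>j. j \<in> {1..<N} \<Longrightarrow> poly (period_poly f j) z \<noteq> 0" by blast
  then have "exact_period (poly f) N z" by (auto simp: exact_period_def poly_period_poly)
  then show thesis by (rule that)
qed

section \<open>Conjugation by affine maps\<close>

lemma poly_affine_conj: "poly (affine_conj \<alpha> \<beta> f) z = \<alpha> * poly f ((z - \<beta>) / \<alpha>) + \<beta>"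
proof -
  have "- \<beta> / \<alpha> + z * (1 / \<alpha>) = (z - \<beta>) / \<alpha>" by (simp add: diff_divide_distrib)
  then show ?thesis by (simp add: affine_conj_def poly_pcompose)
qed

lemma poly_affine_conj_image:
  "\<alpha> \<noteq> 0 \<Longrightarrow> poly (affine_conj \<alpha> \<beta> f) (\<alpha> * z + \<beta>) = \<alpha> * poly f z + \<beta>"
  by (simp add: poly_affine_conj)

lemma funpow_affine_conj:
  "\<alpha> \<noteq> 0 \<Longrightarrow> (poly (affine_conj \<alpha> \<beta> f) ^^ n) (\<alpha> * z + \<beta>) = \<alpha> * (poly f ^^ n) z + \<beta>"
  by (induction n) (simp_all add: poly_affine_conj_image)

lemma degree_affine_conj: "\<alpha> \<noteq> 0 \<Longrightarrow> degree (affine_conj \<alpha> \<beta> f) = degree f"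
  by (simp add: affine_conj_def degree_pcompose)

lemma affine_conj_affine_conj:
  assumes "\<alpha> \<noteq> 0" "\<gamma> \<noteq> 0"
  shows "affine_conj \<gamma> \<delta> (affine_conj \<alpha> \<beta> f) = affine_conj (\<gamma> * \<alpha>) (\<gamma> * \<beta> + \<delta>) f"
proof (rule poly_eq_poly_eq_iff[THEN iffD1], rule ext)
  fix z
  have "((z - \<delta>) / \<gamma> - \<beta>) / \<alpha> = (z - (\<gamma> * \<beta> + \<delta>)) / (\<gamma> * \<alpha>)"
    using assms by (simp add: field_simps)
  then show "poly (affine_conj \<gamma> \<delta> (affine_conj \<alpha> \<beta> f)) z = poly (affine_conj (\<gamma> * \<alpha>) (\<gamma> * \<beta> + \<delta>) f) z"
    by (simp add: poly_affine_conj algebra_simps)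
qed

lemma affine_conj_1_0 [simp]: "affine_conj 1 0 f = f"
  by (rule poly_eq_poly_eq_iff[THEN iffD1]) (simp add: fun_eq_iff poly_affine_conj)

lemma affine_conj_inverse:
  assumes "\<alpha> \<noteq> 0"
  shows "affine_conj (1 / \<alpha>) (- \<beta> / \<alpha>) (affine_conj \<alpha> \<beta> f) = f"
  using assms by (simp add: affine_conj_affine_conj)

lemma coeff_pcompose_linear_top:
  fixes p :: "complex poly"
  shows "degree p \<le> n \<Longrightarrow> coeff (p \<circ>\<^sub>p [:b, c:]) n = c ^ n * coeff p n"
    and "degree p \<le> Suc n \<Longrightarrow>
      coeff (p \<circ>\<^sub>p [:b, c:]) n = c ^ n * (coeff p n + of_nat (Suc n) * b * coeff p (Suc n))"
proof -
  show top: "coeff (p \<circ>\<^sub>p [:b, c:]) n = c ^ n * coeff p n" if "degree p \<le> n" for p :: "complex poly" and n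
    using that
  proof (induction n arbitrary: p)
    case 0
    then obtain a where "p = [:a:]" by (meson degree_eq_zeroE le_zero_eq)
    then show ?case by simp
  next
    case (Suc n)
    obtain a q where p: "p = pCons a q" by (cases p)
    then have q: "degree q \<le> n" using Suc.prems by (cases "q = 0") auto
    have "degree (q \<circ>\<^sub>p [:b, c:]) \<le> n" using degree_pcompose_le[of q "[:b, c:]"] q by (simp split: if_splits)
    then have "coeff (q \<circ>\<^sub>p [:b, c:]) (Suc n) = 0" by (intro coeff_eq_0) simp
    then show ?case using Suc.IH[OF q] by (simp add: p pcompose_pCons)
  qed
  show "coeff (p \<circ>\<^sub>p [:b, c:]) n = c ^ n * (coeff p n + of_nat (Suc n) * b * coeff p (Suc n))"
    if "degree p \<le> Suc n" using that
  proof (induction n arbitrary: p)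
    case 0
    obtain a q where p: "p = pCons a q" by (cases p)
    then have "degree q \<le> 0" using "0.prems" by (cases "q = 0") auto
    then obtain e where "q = [:e:]" by (meson degree_eq_zeroE le_zero_eq)
    then show ?case by (simp add: p pcompose_pCons)
  next
    case (Suc n)
    obtain a q where p: "p = pCons a q" by (cases p)
    then have q: "degree q \<le> Suc n" using Suc.prems by (cases "q = 0") auto
    show ?case using Suc.IH[OF q] top[OF q] by (simp add: p pcompose_pCons algebra_simps)
  qed
qed

text \<open>
  Only the two top coefficients enter, and as \<open>degree f \<ge> 2\<close> they are not affected by adding \<open>\<beta>\<close>.
\<close>

lemma center_affine_conj:
  assumes "degree f \<ge> 2" "\<alpha> \<noteq> 0"
  shows "center (affine_conj \<alpha> \<beta> f) = \<alpha> * center f + \<beta>"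
proof -
  define n where "n = degree f - 2"
  have n: "degree f = Suc (Suc n)" using assms by (simp add: n_def)
  let ?g = "f \<circ>\<^sub>p [:- \<beta> / \<alpha>, 1 / \<alpha>:]"
  have eq: "affine_conj \<alpha> \<beta> f = smult \<alpha> ?g + [:\<beta>:]"
    by (simp add: affine_conj_def pcompose_pCons pcompose_add pcompose_smult)
  have 1: "coeff (affine_conj \<alpha> \<beta> f) (Suc (Suc n)) = \<alpha> * (1 / \<alpha>) ^ Suc (Suc n) * lead_coeff f"
    unfolding eq using coeff_pcompose_linear_top(1)[of f "Suc (Suc n)" "- \<beta> / \<alpha>" "1 / \<alpha>"] n by simp
  have 2: "coeff (affine_conj \<alpha> \<beta> f) (Suc n) = \<alpha> * (1 / \<alpha>) ^ Suc n *
     (coeff f (Suc n) + of_nat (degree f) * (- \<beta> / \<alpha>) * lead_coeff f)"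
    unfolding eq using coeff_pcompose_linear_top(2)[of f "Suc n" "- \<beta> / \<alpha>" "1 / \<alpha>"] n by simp
  have nz: "lead_coeff f \<noteq> 0" "of_nat (degree f) \<noteq> (0 :: complex)"
    using assms(1) by (auto simp del: leading_coeff_0_iff simp: leading_coeff_0_iff[of f])
  define k where "k = \<alpha> * (1 / \<alpha>) ^ Suc n"
  have k: "k \<noteq> 0" using assms(2) by (simp add: k_def)
  define y where "y = of_nat (degree f) * lead_coeff f"
  have y: "y \<noteq> 0" using nz by (simp add: y_def)
  have "coeff (affine_conj \<alpha> \<beta> f) (Suc n) = k * (coeff f (Suc n) + y * (- \<beta> / \<alpha>))"
    unfolding 2 by (simp add: k_def y_def mult_ac)
  moreover have "of_nat (degree f) * coeff (affine_conj \<alpha> \<beta> f) (degree f) = k * (y / \<alpha>)"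
    unfolding n 1 unfolding k_def y_def n by simp
  ultimately have "center (affine_conj \<alpha> \<beta> f) = - (k * (coeff f (Suc n) + y * (- \<beta> / \<alpha>))) / (k * (y / \<alpha>))"
    unfolding center_def degree_affine_conj[OF assms(2)] by (simp add: n)
  also have "\<dots> = - (coeff f (Suc n) + y * (- \<beta> / \<alpha>)) / (y / \<alpha>)" 
    by (simp only: minus_mult_right mult_divide_mult_cancel_left[OF k])
  also have "\<dots> = \<alpha> * (- coeff f (Suc n) / y) + \<beta>" using y assms(2) by (simp add: field_simps)
  also have "\<dots> = \<alpha> * center f + \<beta>" by (simp add: center_def n y_def)
  finally show ?thesis .
qed

lemma equiv_marked_conj_rel: "equiv UNIV marked_conj_rel"
proof (rule equivI)
  have "1 \<noteq> (0::complex) \<and> f = affine_conj 1 0 f \<and> z = 1 * z + 0" for f and z :: complex by simp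
  then have "((f, z), (f, z)) \<in> marked_conj_rel" for f z
    unfolding marked_conj_rel_def by blast
  then show "refl marked_conj_rel" by (auto simp: refl_on_def)
  show "sym marked_conj_rel"
  proof (rule symI, clarify)
    fix f z g w assume "((f, z), (g, w)) \<in> marked_conj_rel"
    then obtain \<alpha> \<beta> where *: "\<alpha> \<noteq> 0" "g = affine_conj \<alpha> \<beta> f" "w = \<alpha> * z + \<beta>"
      by (auto simp: marked_conj_rel_def)
    have "1 / \<alpha> \<noteq> 0" using *(1) by simp
    moreover have "f = affine_conj (1 / \<alpha>) (- \<beta> / \<alpha>) g"
      unfolding *(2) by (rule affine_conj_inverse[OF *(1), symmetric])
    moreover have "z = 1 / \<alpha> * w + - \<beta> / \<alpha>"
      using *(1) unfolding *(3) by (simp add: distrib_left)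
    ultimately show "((g, w), (f, z)) \<in> marked_conj_rel" unfolding marked_conj_rel_def by blast
  qed
  show "trans marked_conj_rel"
  proof (rule transI, clarify)
    fix f z g w h v assume "((f, z), (g, w)) \<in> marked_conj_rel" "((g, w), (h, v)) \<in> marked_conj_rel"
    then obtain \<alpha> \<beta> \<gamma> \<delta> where *: "\<alpha> \<noteq> 0" "g = affine_conj \<alpha> \<beta> f" "w = \<alpha> * z + \<beta>"
        "\<gamma> \<noteq> 0" "h = affine_conj \<gamma> \<delta> g" "v = \<gamma> * w + \<delta>"
      by (auto simp: marked_conj_rel_def)
    have "\<gamma> * \<alpha> \<noteq> 0" using *(1,4) by simp
    moreover have "h = affine_conj (\<gamma> * \<alpha>) (\<gamma> * \<beta> + \<delta>) f"
      unfolding *(2,5) by (rule affine_conj_affine_conj[OF *(1,4)])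
    moreover have "v = (\<gamma> * \<alpha>) * z + (\<gamma> * \<beta> + \<delta>)"
      unfolding *(3,6) by (simp add: distrib_left)
    ultimately show "((f, z), (h, v)) \<in> marked_conj_rel" unfolding marked_conj_rel_def by blast
  qed
qed auto

lemma conj_rel_iff_marked: "(f, g) \<in> conj_rel \<longleftrightarrow> (\<exists>w. ((f, z), (g, w)) \<in> marked_conj_rel)"
  by (auto simp: conj_rel_def marked_conj_rel_def)

lemma equiv_conj_rel: "equiv UNIV conj_rel"
proof (rule equivI)
  note m = equiv_marked_conj_rel[unfolded equiv_def]
  have refl: "((f, 0), (f, 0)) \<in> marked_conj_rel" for f using m by (simp add: refl_on_def)
  then show "refl conj_rel" by (auto simp: refl_on_def conj_rel_iff_marked[where z = 0])
  show "sym conj_rel"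
  proof (rule symI)
    fix f g assume "(f, g) \<in> conj_rel"
    then obtain w where "((f, 0), (g, w)) \<in> marked_conj_rel" by (auto simp: conj_rel_iff_marked[where z = 0])
    then have "((g, w), (f, 0)) \<in> marked_conj_rel" using m by (blast dest: symD)
    then show "(g, f) \<in> conj_rel" using conj_rel_iff_marked[where z = w] by blast
  qed
  show "trans conj_rel"
  proof (rule transI)
    fix f g h assume "(f, g) \<in> conj_rel" and gh: "(g, h) \<in> conj_rel"
    then obtain w where "((f, 0), (g, w)) \<in> marked_conj_rel" by (auto simp: conj_rel_iff_marked[where z = 0])
    moreover obtain v where "((g, w), (h, v)) \<in> marked_conj_rel"
      using gh by (auto simp: conj_rel_iff_marked[where z = w])
    ultimately have "((f, 0), (h, v)) \<in> marked_conj_rel" using m by (blast dest: transD)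
    then show "(f, h) \<in> conj_rel" using conj_rel_iff_marked[where z = 0] by blast
  qed
qed auto

text \<open>
  The conjugated period polynomials are \<open>\<alpha>\<close> times the old ones in the new variable. Putting the
  factor \<open>\<alpha>\<close> into the dynatomic polynomial for 1, the claim follows by uniqueness.
\<close>

lemma dynatomic_affine_conj:
  assumes f: "degree f \<ge> 2" and "N \<ge> 1" and "\<alpha> \<noteq> 0"
  shows "poly (dynatomic (affine_conj \<alpha> \<beta> f) N) (\<alpha> * z + \<beta>) = 0 \<longleftrightarrow> poly (dynatomic f N) z = 0"
proof -
  let ?g = "affine_conj \<alpha> \<beta> f"
  define \<Psi> where "\<Psi> = (\<lambda>k. smult (if k = 1 then \<alpha> else 1) (dynatomic f k \<circ>\<^sub>p [:- \<beta> / \<alpha>, 1 / \<alpha>:]))"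
  have g: "degree ?g \<ge> 2" using assms by (simp add: degree_affine_conj)
  have "dynatomic ?g N = \<Psi> N"
  proof (rule dynatomic_unique[OF g _ _ \<open>N \<ge> 1\<close>])
    fix n :: nat assume n: "n \<ge> 1"
    show "period_poly ?g n = (\<Prod>k | k dvd n. dynatomic ?g k)" by (rule dynatomic_product[OF g n])
    show "period_poly ?g n = (\<Prod>k | k dvd n. \<Psi> k)"
    proof (rule poly_eq_poly_eq_iff[THEN iffD1], rule ext)
      fix w
      define v where "v = (w - \<beta>) / \<alpha>"
      have w: "w = \<alpha> * v + \<beta>" using \<open>\<alpha> \<noteq> 0\<close> by (simp add: v_def)
      have lin: "poly [:- \<beta> / \<alpha>, 1 / \<alpha>:] w = v"
        by (simp add: v_def diff_divide_distrib)
      have "poly (period_poly ?g n) w = \<alpha> * poly (period_poly f n) v"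
        unfolding w poly_period_poly funpow_affine_conj[OF \<open>\<alpha> \<noteq> 0\<close>] by (simp add: algebra_simps)
      also have "\<dots> = \<alpha> * (\<Prod>k | k dvd n. poly (dynatomic f k) v)"
        by (simp add: dynatomic_product[OF f n] poly_prod)
      also have "\<dots> = (\<Prod>k | k dvd n. if k = 1 then \<alpha> else 1) * (\<Prod>k | k dvd n. poly (dynatomic f k) v)"
        using n by (subst prod.delta) auto
      also have "\<dots>
         = (\<Prod>k | k dvd n. (if k = 1 then \<alpha> else 1) * poly (dynatomic f k) v)"
        by (rule prod.distrib[symmetric])
      also have "\<dots> = poly (\<Prod>k | k dvd n. \<Psi> k) w"
        unfolding poly_prod \<Psi>_def poly_smult poly_pcompose lin ..
      finally show "poly (period_poly ?g n) w = poly (\<Prod>k | k dvd n. \<Psi> k) w" .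
    qed
  qed
  moreover have "poly [:- \<beta> / \<alpha>, 1 / \<alpha>:] (\<alpha> * z + \<beta>) = z"
    using \<open>\<alpha> \<noteq> 0\<close> by (simp add: add_divide_distrib)
  ultimately show ?thesis using \<open>\<alpha> \<noteq> 0\<close> by (simp add: \<Psi>_def poly_pcompose)
qed

subsection \<open>Normal form of a polynomial whose center is not fixed\<close>

text \<open>
  If the center is not fixed, an affine map commuting with \<open>f\<close> fixes two points and is the identity. The
  normal form sends the center to 0 and its image to 1.
\<close>

definition free_center :: "complex poly \<Rightarrow> bool" where
  "free_center f \<longleftrightarrow> poly f (center f) \<noteq> center f"

definition normal_scale :: "complex poly \<Rightarrow> complex" where
  "normal_scale f = 1 / (poly f (center f) - center f)"

definition normal_shift :: "complex poly \<Rightarrow> complex" where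
  "normal_shift f = - center f * normal_scale f"

definition normal_poly :: "complex poly \<Rightarrow> complex poly" where
  "normal_poly f = affine_conj (normal_scale f) (normal_shift f) f"

definition normal_point :: "complex poly \<Rightarrow> complex \<Rightarrow> complex" where
  "normal_point f z = normal_scale f * z + normal_shift f"

context
  fixes f :: "complex poly"
  assumes f: "degree f \<ge> 2"
begin

lemma normal_scale_affine_conj:
  "\<alpha> \<noteq> 0 \<Longrightarrow> normal_scale (affine_conj \<alpha> \<beta> f) = normal_scale f / \<alpha>"
  by (simp add: normal_scale_def center_affine_conj[OF f] poly_affine_conj_image flip: right_diff_distrib)

lemma free_center_affine_conj: "\<alpha> \<noteq> 0 \<Longrightarrow> free_center (affine_conj \<alpha> \<beta> f) \<longleftrightarrow> free_center f"
  by (simp add: free_center_def center_affine_conj[OF f] poly_affine_conj_image)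

lemma normal_shift_affine_conj:
  "\<alpha> \<noteq> 0 \<Longrightarrow> normal_scale f / \<alpha> * \<beta> + normal_shift (affine_conj \<alpha> \<beta> f) = normal_shift f"
  by (simp add: normal_shift_def normal_scale_affine_conj center_affine_conj[OF f] field_simps)

lemma normal_scale_nonzero: "free_center f \<Longrightarrow> normal_scale f \<noteq> 0"
  by (simp add: normal_scale_def free_center_def)

lemma normal_poly_affine_conj:
  assumes "\<alpha> \<noteq> 0" "free_center f"
  shows "normal_poly (affine_conj \<alpha> \<beta> f) = normal_poly f"
  unfolding normal_poly_def normal_scale_affine_conj[OF assms(1)]
  using assms normal_scale_nonzero normal_shift_affine_conj[OF assms(1), of \<beta>]
  by (subst affine_conj_affine_conj) simp_all

lemma normal_point_affine_conj:
  assumes "\<alpha> \<noteq> 0"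
  shows "normal_point (affine_conj \<alpha> \<beta> f) (\<alpha> * z + \<beta>) = normal_point f z"
proof -
  have "normal_point (affine_conj \<alpha> \<beta> f) (\<alpha> * z + \<beta>) =
     normal_scale f * z + (normal_scale f / \<alpha> * \<beta> + normal_shift (affine_conj \<alpha> \<beta> f))"
    unfolding normal_point_def normal_scale_affine_conj[OF assms] using assms by (simp add: distrib_left)
  then show ?thesis unfolding normal_shift_affine_conj[OF assms] by (simp only: normal_point_def)
qed

end

section \<open>Regular families of polynomials\<close>

lemma poly_eq_sum_atMost:
  fixes p :: "complex poly"
  assumes "degree p \<le> D"
  shows "poly p x = (\<Sum>i\<le>D. coeff p i * x ^ i)"
  unfolding poly_altdef
  by (rule sum.mono_neutral_left) (use assms in \<open>auto simp: coeff_eq_0\<close>)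

context ringed_space
begin

definition regular_family :: "'a set \<Rightarrow> ('a \<Rightarrow> complex poly) \<Rightarrow> bool" where
  "regular_family W F \<longleftrightarrow> (\<forall>i. (\<lambda>x. coeff (F x) i) \<in> regular X W)"

context
  fixes W assumes W: "openin (zariski X) W"
begin

lemma regular_family_pCons:
  assumes "a \<in> regular X W" "regular_family W F"
  shows "regular_family W (\<lambda>x. pCons (a x) (F x))"
  unfolding regular_family_def
proof
  fix i
  show "(\<lambda>x. coeff (pCons (a x) (F x)) i) \<in> regular X W"
    using assms by (cases i) (simp_all add: regular_family_def)
qed

lemma regular_family_const: "regular_family W (\<lambda>_. p)"
  by (simp add: regular_family_def regular_const[OF W])

lemma regular_family_add:
  "regular_family W F \<Longrightarrow> regular_family W G \<Longrightarrow> regular_family W (\<lambda>x. F x + G x)"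
  by (simp add: regular_family_def regular_add[OF W])

lemma regular_family_mult:
  "regular_family W F \<Longrightarrow> regular_family W G \<Longrightarrow> regular_family W (\<lambda>x. F x * G x)"
  by (simp add: regular_family_def coeff_mult regular_sum[OF W] regular_mult[OF W])

lemma regular_family_smult:
  "a \<in> regular X W \<Longrightarrow> regular_family W F \<Longrightarrow> regular_family W (\<lambda>x. smult (a x) (F x))"
  by (simp add: regular_family_def regular_mult[OF W])

lemma regular_family_power: "regular_family W F \<Longrightarrow> regular_family W (\<lambda>x. F x ^ n)"
  by (induction n) (simp_all add: regular_family_const regular_family_mult)

lemma regular_family_sum:
  assumes "\<And>i. i \<in> I \<Longrightarrow> regular_family W (F i)"
  shows "regular_family W (\<lambda>x. \<Sum>i\<in>I. F i x)"
  using assms by (induction I rule: infinite_finite_induct)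
    (simp_all add: regular_family_const regular_family_add)

lemma regular_family_prod:
  assumes "\<And>i. i \<in> I \<Longrightarrow> regular_family W (F i)"
  shows "regular_family W (\<lambda>x. \<Prod>i\<in>I. F i x)"
  using assms by (induction I rule: infinite_finite_induct)
    (simp_all add: regular_family_const regular_family_mult)

lemma regular_family_monom: "a \<in> regular X W \<Longrightarrow> regular_family W (\<lambda>x. monom (a x) n)"
  unfolding regular_family_def
proof
  fix i assume "a \<in> regular X W"
  then show "(\<lambda>x. coeff (monom (a x) n) i) \<in> regular X W"
    by (cases "n = i") (simp_all add: regular_const[OF W])
qed

lemma regular_poly_eval:
  assumes F: "regular_family W F" and deg: "\<And>x. x \<in> W \<Longrightarrow> degree (F x) \<le> D" and z: "z \<in> regular X W"
  shows "(\<lambda>x. poly (F x) (z x)) \<in> regular X W"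
proof (rule regular_cong[OF W])
  show "(\<lambda>x. \<Sum>i\<le>D. coeff (F x) i * z x ^ i) \<in> regular X W"
    using F z by (intro regular_sum[OF W] regular_mult[OF W] regular_power[OF W])
      (auto simp: regular_family_def)
  fix x assume "x \<in> W"
  show "poly (F x) (z x) = (\<Sum>i\<le>D. coeff (F x) i * z x ^ i)"
    by (rule poly_eq_sum_atMost) (rule deg[OF \<open>x \<in> W\<close>])
qed

lemma regular_poly_iterate:
  assumes "regular_family W F" "\<And>x. x \<in> W \<Longrightarrow> degree (F x) \<le> D" "z \<in> regular X W"
  shows "(\<lambda>x. (poly (F x) ^^ n) (z x)) \<in> regular X W"
  by (induction n) (simp_all add: assms regular_poly_eval[OF assms(1,2)])

lemma regular_family_affine_conj:
  assumes F: "regular_family W F" and deg: "\<And>x. x \<in> W \<Longrightarrow> degree (F x) \<le> D"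
    and a: "\<alpha> \<in> regular X W" "\<beta> \<in> regular X W" "\<And>x. x \<in> W \<Longrightarrow> \<alpha> x \<noteq> 0"
  shows "regular_family W (\<lambda>x. affine_conj (\<alpha> x) (\<beta> x) (F x))"
proof -
  let ?L = "\<lambda>x. [:- \<beta> x / \<alpha> x, 1 / \<alpha> x:]"
  have L: "regular_family W ?L"
    by (intro regular_family_pCons regular_family_const regular_divide[OF W] regular_uminus[OF W]
        regular_const[OF W] a)
  let ?G = "\<lambda>x. smult (\<alpha> x) (\<Sum>i\<le>D. smult (coeff (F x) i) (?L x ^ i)) + [:\<beta> x:]"
  have G: "regular_family W ?G"
    using F by (intro regular_family_add regular_family_smult regular_family_sum regular_family_power L a
        regular_family_pCons regular_family_const) (auto simp: regular_family_def)
  have "affine_conj (\<alpha> x) (\<beta> x) (F x) = ?G x" if "x \<in> W" for x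
  proof (rule poly_eq_poly_eq_iff[THEN iffD1], rule ext)
    fix z
    have "poly (?G x) z = \<alpha> x * (\<Sum>i\<le>D. coeff (F x) i * poly (?L x) z ^ i) + \<beta> x"
      by (simp add: poly_sum)
    also have "(\<Sum>i\<le>D. coeff (F x) i * poly (?L x) z ^ i) = poly (F x) (poly (?L x) z)"
      by (rule poly_eq_sum_atMost[symmetric]) (rule deg[OF that])
    finally have "poly (?G x) z = poly [:\<beta> x, \<alpha> x:] (poly (F x) (poly (?L x) z))"
      by (simp only: poly_pCons poly_0) simp
    then show "poly (affine_conj (\<alpha> x) (\<beta> x) (F x)) z = poly (?G x) z"
      unfolding affine_conj_def poly_pcompose by (rule sym)
  qed
  then show ?thesis
    using G unfolding regular_family_def by (auto intro: regular_cong[OF W])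
qed

end

end

lemma (in ringed_space) regular_normal_form:
  assumes W: "openin (zariski X) W" and F: "regular_family W F"
    and deg: "\<And>x. x \<in> W \<Longrightarrow> degree (F x) = d" and d: "d \<ge> 2"
  defines "V \<equiv> {x \<in> W. free_center (F x)}"
  shows "openin (zariski X) V" and "(\<lambda>x. center (F x)) \<in> regular X W"
    and "regular_family V (\<lambda>x. normal_poly (F x))"
    and "z \<in> regular X W \<Longrightarrow> (\<lambda>x. normal_point (F x) (z x)) \<in> regular X V"
proof -
  have co: "(\<lambda>x. coeff (F x) i) \<in> regular X W" for i using F by (simp add: regular_family_def)
  have lead: "coeff (F x) d \<noteq> 0" if "x \<in> W" for x using deg[OF that] d by fastforce
  have "(\<lambda>x. - coeff (F x) (d - 1) / (of_nat d * coeff (F x) d)) \<in> regular X W"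
    by (intro regular_divide[OF W] regular_uminus[OF W] regular_mult[OF W] regular_const[OF W] co)
      (use lead d in auto)
  then show c: "(\<lambda>x. center (F x)) \<in> regular X W"
    by (rule regular_cong[OF W]) (simp add: center_def deg)
  have fc: "(\<lambda>x. poly (F x) (center (F x))) \<in> regular X W"
    by (rule regular_poly_eval[OF W F _ c, of d]) (simp add: deg)
  have "V = {x \<in> W. poly (F x) (center (F x)) - center (F x) \<noteq> 0}"
    by (simp add: V_def free_center_def)
  then show V: "openin (zariski X) V" using openin_nonzero[OF W regular_diff[OF W fc c]] by simp
  have "V \<subseteq> W" by (auto simp: V_def)
  note res = regular_restrict[OF W _ V \<open>V \<subseteq> W\<close>]
  have scale: "(\<lambda>x. normal_scale (F x)) \<in> regular X V"
    unfolding normal_scale_def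
    by (intro regular_divide[OF V] regular_const[OF V] res regular_diff[OF W fc c])
      (simp add: V_def free_center_def)
  have shift: "(\<lambda>x. normal_shift (F x)) \<in> regular X V"
    unfolding normal_shift_def by (intro regular_mult[OF V] scale res regular_uminus[OF W c])
  show "regular_family V (\<lambda>x. normal_poly (F x))"
    unfolding normal_poly_def
  proof (rule regular_family_affine_conj[OF V _ _ scale shift])
    show "regular_family V F" using res co by (simp add: regular_family_def)
    fix x assume x: "x \<in> V"
    then show "degree (F x) \<le> d" using deg \<open>V \<subseteq> W\<close> by auto
    show "normal_scale (F x) \<noteq> 0"
      using normal_scale_nonzero[of "F x"] x deg d by (auto simp: V_def)
  qed
  show "(\<lambda>x. normal_point (F x) (z x)) \<in> regular X V" if "z \<in> regular X W"
    unfolding normal_point_def by (intro regular_add[OF V] regular_mult[OF V] scale shift res that)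
qed

lemma pullback_functions_along:
  assumes "(U, g) \<in> pullback_functions A p Y" "morphism Z Y (\<lambda>x. p (f x))" "\<And>x. x \<in> points Z \<Longrightarrow> f x \<in> A"
  shows "openin (zariski Z) {x \<in> points Z. f x \<in> U} \<and> (\<lambda>x. g (f x)) \<in> regular Z {x \<in> points Z. f x \<in> U}"
proof -
  obtain W h where W: "U = {x \<in> A. p x \<in> W}" "g = h \<circ> p" "openin (zariski Y) W" "h \<in> regular Y W"
    using assms(1) by (auto simp: pullback_functions_def)
  have "{x \<in> points Z. f x \<in> U} = {x \<in> points Z. p (f x) \<in> W}" using W(1) assms(3) by blast
  then show ?thesis
    using morphism_openin[OF assms(2) W(3)] morphism_regular[OF assms(2) W(3,4)] W(2) by simp
qed

section \<open>The fibre product of the spaces of marked polynomials\<close>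

definition poly_space :: "nat \<Rightarrow> complex poly fun_space" where
  "poly_space d = affine_space_on {f. degree f = d} {\<lambda>f. coeff f i | i. i \<le> d}"

definition marked_poly_space :: "nat \<Rightarrow> nat \<Rightarrow> (complex poly \<times> complex) fun_space" where
  "marked_poly_space d n = affine_space_on {(f, z). degree f = d \<and> poly (dynatomic f n) z = 0}
     ({\<lambda>(f, z). coeff f i | i. i \<le> d} \<union> {snd})"

lemma ringed_poly_space: "ringed_space (poly_space d)"
  by (simp add: poly_space_def ringed_space_affine_space_on)

lemma ringed_marked_poly_space: "ringed_space (marked_poly_space d n)"
  by (simp add: marked_poly_space_def ringed_space_affine_space_on)

lemma points_poly_space: "points (poly_space d) = {f. degree f = d}"
  by (simp add: poly_space_def points_affine_space_on)

lemma points_marked_poly_space: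
  "points (marked_poly_space d n) = {(f, z). degree f = d \<and> poly (dynatomic f n) z = 0}"
  by (simp add: marked_poly_space_def points_affine_space_on)

lemma poly_moduli_eq: "poly_moduli d = quotient_space (poly_space d) conj_rel"
  by (simp add: poly_moduli_def poly_space_def)

lemma marked_poly_moduli_eq:
  "marked_poly_moduli d n = quotient_space (marked_poly_space d n) marked_conj_rel"
  by (simp add: marked_poly_moduli_def marked_poly_space_def)

lemmas poly_quotient = ringed_poly_space equiv_conj_rel
lemmas marked_poly_quotient = ringed_marked_poly_space equiv_marked_conj_rel

lemma ringed_poly_moduli: "ringed_space (poly_moduli d)"
  unfolding poly_moduli_eq by (rule ringed_space_quotient[OF poly_quotient])

lemma ringed_marked_poly_moduli: "ringed_space (marked_poly_moduli d n)"
  unfolding marked_poly_moduli_eq by (rule ringed_space_quotient[OF marked_poly_quotient])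

lemma points_poly_moduli: "points (poly_moduli d) = {conj_rel `` {f} | f. degree f = d}"
  unfolding poly_moduli_eq points_quotient_space[OF poly_quotient] points_poly_space
  by (auto simp: quotient_def)

lemma points_marked_poly_moduli:
  "points (marked_poly_moduli d n) =
     {marked_conj_rel `` {(f, z)} | f z. degree f = d \<and> poly (dynatomic f n) z = 0}"
  unfolding marked_poly_moduli_eq points_quotient_space[OF marked_poly_quotient] points_marked_poly_space
  by (auto simp: quotient_def)

lemma regular_family_poly_space:
  "ringed_space.regular_family (poly_space d) {f. degree f = d} (\<lambda>f. f)"
proof -
  interpret ringed_space "poly_space d" by (rule ringed_poly_space)
  have o: "openin (zariski (poly_space d)) {f. degree f = d}"
    using openin_topspace[of "zariski (poly_space d)"] by (simp add: points_poly_space)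
  show ?thesis
    unfolding regular_family_def
  proof
    fix i
    show "(\<lambda>f. coeff f i) \<in> regular (poly_space d) {f. degree f = d}"
    proof (cases "i \<le> d")
      case True
      then have "(\<lambda>f. coeff f i) \<in> {\<lambda>f :: complex poly. coeff f i | i. i \<le> d}"
        by (intro CollectI exI[of _ i] conjI refl)
      then show ?thesis unfolding poly_space_def by (rule regular_coordinate)
    next
      case False
      show ?thesis by (rule regular_cong[OF o regular_const[OF o, of 0]]) (use False in \<open>simp add: coeff_eq_0\<close>)
    qed
  qed
qed

lemma regular_family_marked_poly_space:
  "ringed_space.regular_family (marked_poly_space d n) (points (marked_poly_space d n)) fst"
  "snd \<in> regular (marked_poly_space d n) (points (marked_poly_space d n))"
proof -
  interpret ringed_space "marked_poly_space d n" by (rule ringed_marked_poly_space)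
  let ?W = "points (marked_poly_space d n)"
  show "snd \<in> regular (marked_poly_space d n) ?W"
    unfolding points_marked_poly_space unfolding marked_poly_space_def
    by (intro regular_coordinate UnI2 singletonI)
  show "regular_family ?W fst"
    unfolding regular_family_def
  proof
    fix i
    show "(\<lambda>x. coeff (fst x) i) \<in> regular (marked_poly_space d n) ?W"
    proof (cases "i \<le> d")
      case True
      then have "(\<lambda>(f, z). coeff f i) \<in> {\<lambda>(f :: complex poly, z :: complex). coeff f i | i. i \<le> d}"
        by (intro CollectI exI[of _ i] conjI refl)
      then have "(\<lambda>(f, z). coeff f i) \<in> regular (marked_poly_space d n) ?W"
        unfolding points_marked_poly_space unfolding marked_poly_space_def
        by (intro regular_coordinate UnI1)
      then show ?thesis unfolding case_prod_beta' .
    next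
      case False
      show ?thesis
      proof (rule regular_cong[OF openin_topspace regular_const[OF openin_topspace]])
        fix x assume "x \<in> ?W"
        then have "degree (fst x) = d" by (simp add: points_marked_poly_space case_prod_beta)
        then show "coeff (fst x) i = 0" using False by (intro coeff_eq_0) simp
      qed
    qed
  qed
qed

subsection \<open>Normal forms of classes\<close>

text \<open>
  The representative chosen from the class does not matter as long as its center is not fixed.
\<close>

definition class_poly :: "complex poly set \<Rightarrow> complex poly" where
  "class_poly p = normal_poly (SOME f. f \<in> p)"

definition class_point :: "(complex poly \<times> complex) set \<Rightarrow> complex" where
  "class_point Q = (case SOME y. y \<in> Q of (f, z) \<Rightarrow> normal_point f z)"

lemma class_poly_eq:
  assumes "degree f \<ge> 2" "free_center f"
  shows "class_poly (conj_rel `` {f}) = normal_poly f"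
proof -
  have "(SOME g. g \<in> conj_rel `` {f}) \<in> conj_rel `` {f}"
    by (rule someI[of _ f]) (rule equiv_class_self[OF equiv_conj_rel], simp)
  then show ?thesis
    using normal_poly_affine_conj[OF assms(1) _ assms(2)] by (auto simp: class_poly_def conj_rel_def)
qed

lemma class_point_eq:
  assumes "degree f \<ge> 2"
  shows "class_point (marked_conj_rel `` {(f, z)}) = normal_point f z"
proof -
  have "(SOME g. g \<in> marked_conj_rel `` {(f, z)}) \<in> marked_conj_rel `` {(f, z)}"
    by (rule someI[of _ "(f, z)"]) (rule equiv_class_self[OF equiv_marked_conj_rel], simp)
  then show ?thesis
    using normal_point_affine_conj[OF assms] by (auto simp: class_point_def marked_conj_rel_def)
qed

lemma free_class_iff:
  assumes "degree f \<ge> 2"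
  shows "(\<exists>g\<in>conj_rel `` {f}. free_center g) \<longleftrightarrow> free_center f"
    and "(\<exists>y\<in>marked_conj_rel `` {(f, z)}. free_center (fst y)) \<longleftrightarrow> free_center f"
proof -
  have f: "f \<in> conj_rel `` {f}" and fz: "(f, z) \<in> marked_conj_rel `` {(f, z)}"
    using equiv_class_self[OF equiv_conj_rel] equiv_class_self[OF equiv_marked_conj_rel] by blast+
  have "free_center g \<longleftrightarrow> free_center f" if "g \<in> conj_rel `` {f}" for g
    using that free_center_affine_conj[OF assms] by (auto simp: conj_rel_def)
  then show "(\<exists>g\<in>conj_rel `` {f}. free_center g) \<longleftrightarrow> free_center f" using f by blast
  have "free_center (fst y) \<longleftrightarrow> free_center f" if "y \<in> marked_conj_rel `` {(f, z)}" for y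
    using that free_center_affine_conj[OF assms] by (auto simp: marked_conj_rel_def)
  then show "(\<exists>y\<in>marked_conj_rel `` {(f, z)}. free_center (fst y)) \<longleftrightarrow> free_center f"
    using fz by (metis fst_conv)
qed

lemma regular_class_poly:
  assumes d: "d \<ge> 2"
  defines "D \<equiv> {p \<in> points (poly_moduli d). \<exists>f\<in>p. free_center f}"
  shows "openin (zariski (poly_moduli d)) D"
    and "ringed_space.regular_family (poly_moduli d) D class_poly"
proof -
  interpret S: ringed_space "poly_space d" by (rule ringed_poly_space)
  interpret P: ringed_space "poly_moduli d" by (rule ringed_poly_moduli)
  let ?W = "{f :: complex poly. degree f = d}"
  have W: "openin (zariski (poly_space d)) ?W"
    using openin_topspace[of "zariski (poly_space d)"] by (simp add: points_poly_space)
  note nf = S.regular_normal_form[OF W regular_family_poly_space _ d]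
  have pre: "{f \<in> points (poly_space d). conj_rel `` {f} \<in> D} = {f \<in> ?W. free_center f}"
    using free_class_iff(1) d by (auto simp: D_def points_poly_space points_poly_moduli)
  have sub: "D \<subseteq> points (poly_space d) // conj_rel"
    using points_quotient_space[OF poly_quotient] by (auto simp: D_def poly_moduli_eq)
  show "openin (zariski (poly_moduli d)) D"
    unfolding poly_moduli_eq openin_quotient_iff[OF poly_quotient] pre using sub nf(1) by simp
  show "P.regular_family D class_poly"
    unfolding P.regular_family_def
  proof
    fix i
    have "(\<lambda>f. coeff (normal_poly f) i) \<in> regular (poly_space d) {f \<in> ?W. free_center f}"
      using nf(3) by (simp add: S.regular_family_def)
    then have "(\<lambda>f. coeff (class_poly (conj_rel `` {f})) i) \<in> regular (poly_space d) {f \<in> ?W. free_center f}"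
      by (rule S.regular_cong[rotated]) (use nf(1) d class_poly_eq in auto)
    then show "(\<lambda>p. coeff (class_poly p) i) \<in> regular (poly_moduli d) D"
      unfolding poly_moduli_eq regular_quotient_iff[OF poly_quotient sub] pre .
  qed
qed

lemma regular_class_point:
  fixes n :: nat
  assumes d: "d \<ge> 2"
  defines "D \<equiv> {Q \<in> points (marked_poly_moduli d n). \<exists>y\<in>Q. free_center (fst y)}"
  shows "openin (zariski (marked_poly_moduli d n)) D"
    and "class_point \<in> regular (marked_poly_moduli d n) D"
proof -
  let ?S = "marked_poly_space d n"
  interpret S: ringed_space ?S by (rule ringed_marked_poly_space)
  let ?W = "points ?S"
  have deg: "degree (fst y) = d" if "y \<in> ?W" for y using that by (auto simp: points_marked_poly_space)
  note nf = S.regular_normal_form[OF openin_topspace regular_family_marked_poly_space(1) deg d]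
  have pre: "{y \<in> ?W. marked_conj_rel `` {y} \<in> D} = {y \<in> ?W. free_center (fst y)}"
  proof -
    have "marked_conj_rel `` {(f, z)} \<in> D \<longleftrightarrow> free_center f" if "(f, z) \<in> ?W" for f z
    proof -
      have "degree f \<ge> 2" using deg[OF that] d by simp
      moreover have "marked_conj_rel `` {(f, z)} \<in> points (marked_poly_moduli d n)"
        using that unfolding points_marked_poly_moduli points_marked_poly_space by blast
      ultimately show ?thesis unfolding D_def using free_class_iff(2) by blast
    qed
    then show ?thesis by auto
  qed
  have sub: "D \<subseteq> ?W // marked_conj_rel"
    using points_quotient_space[OF marked_poly_quotient] by (auto simp: D_def marked_poly_moduli_eq)
  show "openin (zariski (marked_poly_moduli d n)) D"
    unfolding marked_poly_moduli_eq openin_quotient_iff[OF marked_poly_quotient] pre using sub nf(1) by simp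
  have "(\<lambda>y. normal_point (fst y) (snd y)) \<in> regular ?S {y \<in> ?W. free_center (fst y)}"
    by (rule nf(4)[OF _ regular_family_marked_poly_space(2)])
  then have "(\<lambda>y. class_point (marked_conj_rel `` {y})) \<in> regular ?S {y \<in> ?W. free_center (fst y)}"
    by (rule S.regular_cong[rotated]) (use nf(1) d deg class_point_eq in auto)
  then show "class_point \<in> regular (marked_poly_moduli d n) D"
    unfolding marked_poly_moduli_eq regular_quotient_iff[OF marked_poly_quotient sub] pre .
qed

lemma (in ringed_space) openin_distinct:
  assumes "openin (zariski X) W" "g \<in> regular X W" "h \<in> regular X W"
  shows "openin (zariski X) {x \<in> W. g x \<noteq> h x}"
  using openin_nonzero[OF assms(1) regular_diff[OF assms]] by simp

lemma openin_finite_Ball: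
  assumes "openin T W" "finite K" "\<And>k. k \<in> K \<Longrightarrow> openin T {x \<in> W. P k x}"
  shows "openin T {x \<in> W. \<forall>k\<in>K. P k x}"
  using assms(2,3)
proof (induction K rule: finite_induct)
  case (insert k K)
  have "{x \<in> W. \<forall>l\<in>insert k K. P l x} = {x \<in> W. P k x} \<inter> {x \<in> W. \<forall>l\<in>K. P l x}" by blast
  moreover have "openin T {x \<in> W. P k x}" "openin T {x \<in> W. \<forall>l\<in>K. P l x}" using insert by simp_all
  ultimately show ?case by (simp only: openin_Int)
qed (use assms(1) in simp)

locale marked_moduli =
  fixes d s :: nat and N :: "nat \<Rightarrow> nat"
  assumes d: "d \<ge> 2" and N_pos: "\<And>i. i \<in> {1..s} \<Longrightarrow> N i \<ge> 1"
begin

abbreviation X where "X \<equiv> marked_fibre_product d s N"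

definition is_marked :: "complex poly \<Rightarrow> (nat \<Rightarrow> complex) \<Rightarrow> bool" where
  "is_marked f z \<longleftrightarrow> degree f = d \<and> (\<forall>i\<in>{1..s}. poly (dynatomic f (N i)) (z i) = 0)"

text \<open>
  The point of the fibre product given by one polynomial together with all markings. When the
  polynomial has automorphisms, several choices of markings give the same point.
\<close>

definition marked_point :: "complex poly \<Rightarrow> (nat \<Rightarrow> complex) \<Rightarrow>
    complex poly set \<times> (nat \<Rightarrow> (complex poly \<times> complex) set)" where
  "marked_point f z = (conj_rel `` {f}, \<lambda>i\<in>{1..s}. marked_conj_rel `` {(f, z i)})"

definition fibre_points where
  "fibre_points = {(p, q). p \<in> points (poly_moduli d) \<and>
     q \<in> (\<Pi>\<^sub>E i\<in>{1..s}. points (marked_poly_moduli d (N i))) \<and> (\<forall>i\<in>{1..s}. forget_marking (q i) = p)}"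

definition fibre_functions where
  "fibre_functions = pullback_functions fibre_points fst (poly_moduli d) \<union>
     (\<Union>i\<in>{1..s}. pullback_functions fibre_points (\<lambda>x. snd x i) (marked_poly_moduli d (N i)))"

lemma X_eq: "X = generated_space fibre_points fibre_functions"
  by (simp add: marked_fibre_product_def fibre_product_def fibre_points_def fibre_functions_def Let_def)

lemma fibre_functions_subset: "fst ` fibre_functions \<subseteq> Pow fibre_points"
  unfolding fibre_functions_def image_Un image_UN
  by (intro Un_least UN_least pullback_functions_subset)

lemma ringed_X: "ringed_space X"
  unfolding X_eq by (rule ringed_space_generated[OF fibre_functions_subset])

lemma points_X: "points X = fibre_points"
  unfolding X_eq by (rule points_generated_space[OF fibre_functions_subset])

lemma morphism_base: "morphism X (poly_moduli d) fst"
  unfolding X_eq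
  by (rule morphism_from_generated_space[OF fibre_functions_subset])
    (auto simp: fibre_functions_def fibre_points_def ringed_poly_moduli)

lemma morphism_component: "i \<in> {1..s} \<Longrightarrow> morphism X (marked_poly_moduli d (N i)) (\<lambda>x. snd x i)"
  unfolding X_eq
  by (rule morphism_from_generated_space[OF fibre_functions_subset])
    (auto simp: fibre_functions_def fibre_points_def ringed_marked_poly_moduli)

lemma forget_marking_class: "forget_marking (marked_conj_rel `` {(f, z)}) = conj_rel `` {f}"
proof -
  have "g \<in> forget_marking (marked_conj_rel `` {(f, z)}) \<longleftrightarrow> (f, g) \<in> conj_rel" for g
    unfolding conj_rel_iff_marked[where z = z] by (force simp: forget_marking_def)
  then show ?thesis by blast
qed

lemma marked_point_in_X:
  assumes "is_marked f z"
  shows "marked_point f z \<in> points X"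
  using assms unfolding points_X fibre_points_def marked_point_def is_marked_def
  by (auto simp: points_poly_moduli points_marked_poly_moduli forget_marking_class)

text \<open>
  The factors provide markings of different conjugates of a polynomial; since these conjugates lie in
  one class, all markings can be moved to the same polynomial.
\<close>

lemma points_X_cases:
  assumes "x \<in> points X"
  obtains f z where "is_marked f z" "x = marked_point f z"
proof -
  obtain p q where x: "x = (p, q)" by (cases x)
  have p: "p \<in> points (poly_moduli d)" and q: "q \<in> (\<Pi>\<^sub>E i\<in>{1..s}. points (marked_poly_moduli d (N i)))"
    and forget: "\<And>i. i \<in> {1..s} \<Longrightarrow> forget_marking (q i) = p"
    using assms by (auto simp: x points_X fibre_points_def)
  obtain f where f: "p = conj_rel `` {f}" "degree f = d" using p by (auto simp: points_poly_moduli)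
  have "\<exists>z. q i = marked_conj_rel `` {(f, z)} \<and> poly (dynatomic f (N i)) z = 0" if i: "i \<in> {1..s}" for i
  proof -
    have "q i \<in> points (marked_poly_moduli d (N i))" using q i by blast
    then obtain g y where g: "q i = marked_conj_rel `` {(g, y)}" "degree g = d" "poly (dynatomic g (N i)) y = 0"
      by (auto simp: points_marked_poly_moduli)
    have "f \<in> p" unfolding f by (rule equiv_class_self[OF equiv_conj_rel]) simp
    then have "f \<in> fst ` q i" using forget[OF i] by (simp add: forget_marking_def)
    then obtain z where z: "((g, y), (f, z)) \<in> marked_conj_rel" by (auto simp: g(1))
    then have "q i = marked_conj_rel `` {(f, z)}" using equiv_class_eq[OF equiv_marked_conj_rel z] g(1) by simp
    moreover have "poly (dynatomic f (N i)) z = 0"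
      using z g(2,3) d N_pos[OF i] dynatomic_affine_conj[of g "N i"] by (auto simp: marked_conj_rel_def)
    ultimately show ?thesis by blast
  qed
  then obtain z where z: "\<And>i. i \<in> {1..s} \<Longrightarrow> q i = marked_conj_rel `` {(f, z i)} \<and> poly (dynatomic f (N i)) (z i) = 0"
    by metis
  have "q = (\<lambda>i\<in>{1..s}. marked_conj_rel `` {(f, z i)})"
    by (rule ext) (use z q in \<open>auto simp: PiE_def extensional_def\<close>)
  then have "x = marked_point f z" by (simp add: x f(1) marked_point_def)
  then show thesis using that[of f z] z f(2) by (auto simp: is_marked_def)
qed

text \<open>
  A family of marked polynomials with regular coefficients and markings defines a morphism into every
  factor, as the quotient maps are morphisms.
\<close>

lemma marked_point_morphism:
  assumes Z: "ringed_space Z" and marked: "\<And>x. x \<in> points Z \<Longrightarrow> is_marked (F x) (z x)"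
    and F: "ringed_space.regular_family Z (points Z) F"
    and z: "\<And>i. i \<in> {1..s} \<Longrightarrow> (\<lambda>x. z x i) \<in> regular Z (points Z)"
  shows "morphism Z X (\<lambda>x. marked_point (F x) (z x))"
  unfolding X_eq
proof (rule morphism_into_generated_space[OF fibre_functions_subset Z])
  show in_A: "marked_point (F x) (z x) \<in> fibre_points" if "x \<in> points Z" for x
    using marked_point_in_X[OF marked[OF that]] by (simp add: points_X)
  have co: "(\<lambda>x. coeff (F x) i) \<in> regular Z (points Z)" for i
    using F by (simp add: ringed_space.regular_family_def[OF Z])
  have base: "morphism Z (poly_moduli d) (\<lambda>x. fst (marked_point (F x) (z x)))"
    unfolding marked_point_def fst_conv poly_moduli_eq
  proof (rule morphism_compose[OF _ morphism_quotient_map[OF poly_quotient]])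
    show "morphism Z (poly_space d) F"
      unfolding poly_space_def
      by (rule morphism_into_affine_space_on[OF Z]) (use marked co in \<open>auto simp: is_marked_def\<close>)
  qed
  have comp: "morphism Z (marked_poly_moduli d (N i)) (\<lambda>x. snd (marked_point (F x) (z x)) i)" if i: "i \<in> {1..s}" for i
  proof -
    have "morphism Z (marked_poly_space d (N i)) (\<lambda>x. (F x, z x i))"
      unfolding marked_poly_space_def
      by (rule morphism_into_affine_space_on[OF Z]) (use marked co z i in \<open>auto simp: is_marked_def\<close>)
    then have "morphism Z (marked_poly_moduli d (N i)) (\<lambda>x. marked_conj_rel `` {(F x, z x i)})"
      unfolding marked_poly_moduli_eq
      by (rule morphism_compose[OF _ morphism_quotient_map[OF marked_poly_quotient]])
    moreover have "(\<lambda>x. snd (marked_point (F x) (z x)) i) = (\<lambda>x. marked_conj_rel `` {(F x, z x i)})"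
      using i by (simp add: marked_point_def)
    ultimately show ?thesis by simp
  qed
  fix U g assume "(U, g) \<in> fibre_functions"
  then consider "(U, g) \<in> pullback_functions fibre_points fst (poly_moduli d)"
    | i where "i \<in> {1..s}" "(U, g) \<in> pullback_functions fibre_points (\<lambda>x. snd x i) (marked_poly_moduli d (N i))"
    by (auto simp: fibre_functions_def)
  then show "openin (zariski Z) {x \<in> points Z. marked_point (F x) (z x) \<in> U} \<and>
      (\<lambda>x. g (marked_point (F x) (z x))) \<in> regular Z {x \<in> points Z. marked_point (F x) (z x) \<in> U}"
  proof cases
    case 1
    show ?thesis by (rule pullback_functions_along[OF 1 base in_A])
  next
    case 2
    show ?thesis by (rule pullback_functions_along[OF 2(2) comp[OF 2(1)] in_A])
  qed
qed

subsection \<open>Normal forms on the fibre product\<close>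

definition point_poly where "point_poly x = class_poly (fst x)"

definition point_mark where "point_mark x i = class_point (snd x i)"

text \<open>
  On this locus \<open>point_poly\<close> and \<open>point_mark\<close> invert \<open>marked_point\<close>, and they are regular because each
  of them is computed on a single factor.
\<close>

definition free_locus where "free_locus = {x \<in> points X. \<exists>f\<in>fst x. free_center f}"

lemma marked_point_conj:
  assumes "\<alpha> \<noteq> 0"
  shows "marked_point (affine_conj \<alpha> \<beta> f) (\<lambda>i. \<alpha> * z i + \<beta>) = marked_point f z"
proof -
  have "(f, affine_conj \<alpha> \<beta> f) \<in> conj_rel" using assms by (auto simp: conj_rel_def)
  then have 1: "conj_rel `` {affine_conj \<alpha> \<beta> f} = conj_rel `` {f}"
    using equiv_class_eq[OF equiv_conj_rel] by simp
  have 2: "marked_conj_rel `` {(affine_conj \<alpha> \<beta> f, \<alpha> * z i + \<beta>)} = marked_conj_rel `` {(f, z i)}" for i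
  proof -
    have "((f, z i), (affine_conj \<alpha> \<beta> f, \<alpha> * z i + \<beta>)) \<in> marked_conj_rel"
      using assms by (auto simp: marked_conj_rel_def)
    then show ?thesis using equiv_class_eq[OF equiv_marked_conj_rel] by simp
  qed
  show ?thesis unfolding marked_point_def 1 2 ..
qed

lemma is_marked_conj:
  assumes "\<alpha> \<noteq> 0" "is_marked f z"
  shows "is_marked (affine_conj \<alpha> \<beta> f) (\<lambda>i. \<alpha> * z i + \<beta>)"
  using assms d N_pos by (auto simp: is_marked_def degree_affine_conj dynatomic_affine_conj)

lemma marked_point_in_free_locus_iff:
  assumes "is_marked f z"
  shows "marked_point f z \<in> free_locus \<longleftrightarrow> free_center f"
  using marked_point_in_X[OF assms] free_class_iff(1)[of f] assms d
  by (auto simp: free_locus_def marked_point_def is_marked_def)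

lemma free_locus_cases:
  assumes "x \<in> free_locus"
  obtains f z where "is_marked f z" "free_center f" "x = marked_point f z"
proof -
  have "x \<in> points X" using assms by (simp add: free_locus_def)
  then obtain f z where "is_marked f z" "x = marked_point f z" by (rule points_X_cases)
  then show thesis using that marked_point_in_free_locus_iff assms by blast
qed

lemma point_marked_point:
  assumes "is_marked f z" "free_center f"
  shows "point_poly (marked_point f z) = normal_poly f"
    and "i \<in> {1..s} \<Longrightarrow> point_mark (marked_point f z) i = normal_point f (z i)"
  using assms d by (auto simp: point_poly_def point_mark_def marked_point_def is_marked_def
      class_poly_eq class_point_eq)

lemma point_normal_form:
  assumes "x \<in> free_locus"
  shows "is_marked (point_poly x) (point_mark x)" and "marked_point (point_poly x) (point_mark x) = x"
    and "degree (point_poly x) = d" and "center (point_poly x) = 0" and "poly (point_poly x) 0 = 1"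
proof -
  obtain f z where f: "is_marked f z" "free_center f" "x = marked_point f z" using assms by (rule free_locus_cases)
  have deg: "degree f \<ge> 2" using f(1) d by (simp add: is_marked_def)
  let ?a = "normal_scale f" and ?b = "normal_shift f"
  have a: "?a \<noteq> 0" by (rule normal_scale_nonzero[OF deg f(2)])
  have P: "point_poly x = affine_conj ?a ?b f"
    by (simp add: f(3) point_marked_point[OF f(1,2)] normal_poly_def)
  have Z: "point_mark x i = ?a * z i + ?b" if "i \<in> {1..s}" for i
    using that by (simp add: f(3) point_marked_point[OF f(1,2)] normal_point_def)
  show "is_marked (point_poly x) (point_mark x)"
    using is_marked_conj[OF a f(1), of ?b] Z by (simp add: is_marked_def P)
  have "marked_point (point_poly x) (point_mark x) = marked_point (affine_conj ?a ?b f) (\<lambda>i. ?a * z i + ?b)"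
    unfolding P marked_point_def by (intro arg_cong2[of _ _ _ _ Pair] refl restrict_ext) (simp add: Z)
  then show "marked_point (point_poly x) (point_mark x) = x"
    by (simp add: marked_point_conj[OF a] f(3))
  show "degree (point_poly x) = d" using f(1) by (simp add: P degree_affine_conj[OF a] is_marked_def)
  show c: "center (point_poly x) = 0"
    unfolding P center_affine_conj[OF deg a] by (simp add: normal_shift_def)
  have "?a * center f + ?b = 0" by (simp add: normal_shift_def)
  then have "poly (point_poly x) 0 = ?a * poly f (center f) + ?b"
    using poly_affine_conj_image[OF a, of ?b f "center f"] by (simp add: P)
  also have "\<dots> = (poly f (center f) - center f) * ?a" by (simp add: normal_shift_def algebra_simps)
  also have "\<dots> = 1" using f(2) by (simp add: normal_scale_def free_center_def)
  finally show "poly (point_poly x) 0 = 1" .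
qed

lemma open_free_locus: "openin (zariski X) free_locus"
proof -
  let ?D = "{p \<in> points (poly_moduli d). \<exists>f\<in>p. free_center f}"
  have "free_locus = {x \<in> points X. fst x \<in> ?D}" using morphism_points[OF morphism_base] by (auto simp: free_locus_def)
  then show ?thesis using morphism_openin[OF morphism_base regular_class_poly(1)[OF d]] by simp
qed

lemma regular_point_poly: "ringed_space.regular_family X free_locus point_poly"
proof -
  let ?D = "{p \<in> points (poly_moduli d). \<exists>f\<in>p. free_center f}"
  have free_locus: "free_locus = {x \<in> points X. fst x \<in> ?D}" using morphism_points[OF morphism_base] by (auto simp: free_locus_def)
  have "(\<lambda>p. coeff (class_poly p) i) \<in> regular (poly_moduli d) ?D" for i
    using regular_class_poly(2)[OF d] by (simp add: ringed_space.regular_family_def[OF ringed_poly_moduli])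
  from morphism_regular[OF morphism_base regular_class_poly(1)[OF d] this]
  show ?thesis by (simp add: ringed_space.regular_family_def[OF ringed_X] free_locus point_poly_def)
qed

lemma regular_point_mark:
  assumes i: "i \<in> {1..s}"
  shows "(\<lambda>x. point_mark x i) \<in> regular X free_locus"
proof -
  let ?D = "{Q \<in> points (marked_poly_moduli d (N i)). \<exists>y\<in>Q. free_center (fst y)}"
  have "free_locus = {x \<in> points X. snd x i \<in> ?D}"
  proof -
    have "(\<exists>f\<in>fst x. free_center f) \<longleftrightarrow> (\<exists>y\<in>snd x i. free_center (fst y))" if "x \<in> points X" for x
    proof -
      have "\<forall>i\<in>{1..s}. forget_marking (snd x i) = fst x"
        using that by (simp add: points_X fibre_points_def case_prod_beta)
      then have "fst x = fst ` snd x i" using i by (simp add: forget_marking_def)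
      then show ?thesis by simp
    qed
    then show ?thesis
      unfolding free_locus_def mem_Collect_eq using morphism_points[OF morphism_component[OF i]]
      by (intro Collect_cong) blast
  qed
  then show ?thesis
    using morphism_regular[OF morphism_component[OF i] regular_class_point[OF d]] by (simp add: point_mark_def)
qed

subsection \<open>Marked points of exact period\<close>

definition exact_locus where
  "exact_locus = {x \<in> free_locus. \<forall>i\<in>{1..s}. exact_period (poly (point_poly x)) (N i) (point_mark x i)}"

lemma regular_orbit:
  assumes "i \<in> {1..s}"
  shows "(\<lambda>x. (poly (point_poly x) ^^ j) (point_mark x i)) \<in> regular X free_locus"
  by (rule ringed_space.regular_poly_iterate[OF ringed_X open_free_locus regular_point_poly _ regular_point_mark[OF assms], of d])
    (simp add: point_normal_form)

lemma mark_periodic: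
  assumes "is_marked f z" "i \<in> {1..s}"
  shows "(poly f ^^ N i) (z i) = z i"
proof -
  have "degree f \<ge> 2" "poly (dynatomic f (N i)) (z i) = 0" using assms d by (auto simp: is_marked_def)
  then have "poly (period_poly f (N i)) (z i) = 0"
    using dynatomic_dvd[of f "N i" "{N i}"] N_pos[OF assms(2)] by (auto simp: dvd_def)
  then show ?thesis by (simp add: poly_period_poly)
qed

lemma open_exact_locus: "openin (zariski X) exact_locus"
proof -
  interpret ringed_space X by (rule ringed_X)
  let ?K = "{(i, j). i \<in> {1..s} \<and> 0 < j \<and> j < N i}"
  have "?K = Sigma {1..s} (\<lambda>i. {0<..<N i})" by auto
  then have fin: "finite ?K" by simp
  let ?V = "{x \<in> free_locus. \<forall>k\<in>?K. (poly (point_poly x) ^^ snd k) (point_mark x (fst k)) \<noteq> point_mark x (fst k)}"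
  have "openin (zariski X) ?V"
  proof (rule openin_finite_Ball[OF open_free_locus fin])
    fix k assume "k \<in> ?K"
    then show "openin (zariski X) {x \<in> free_locus. (poly (point_poly x) ^^ snd k) (point_mark x (fst k)) \<noteq> point_mark x (fst k)}"
      by (intro openin_distinct open_free_locus regular_orbit regular_point_mark) auto
  qed
  moreover have "exact_locus = ?V"
  proof (intro equalityI subsetI)
    fix x assume "x \<in> exact_locus"
    then show "x \<in> ?V" by (auto simp: exact_locus_def exact_period_def)
  next
    fix x assume x: "x \<in> ?V"
    then have "is_marked (point_poly x) (point_mark x)" using point_normal_form(1) by blast
    then show "x \<in> exact_locus"
      unfolding exact_locus_def exact_period_def using x mark_periodic by fastforce
  qed
  ultimately show ?thesis by simp
qed

lemma marked_point_in_exact_locus: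
  assumes f: "is_marked f z" "free_center f" and "\<And>i. i \<in> {1..s} \<Longrightarrow> exact_period (poly f) (N i) (z i)"
  shows "marked_point f z \<in> exact_locus"
  unfolding exact_locus_def
proof (intro CollectI conjI ballI)
  show "marked_point f z \<in> free_locus" using marked_point_in_free_locus_iff f by blast
  fix i assume i: "i \<in> {1..s}"
  have deg: "degree f \<ge> 2" using f(1) d by (simp add: is_marked_def)
  have a: "normal_scale f \<noteq> 0" by (rule normal_scale_nonzero[OF deg f(2)])
  show "exact_period (poly (point_poly (marked_point f z))) (N i) (point_mark (marked_point f z) i)"
    unfolding point_marked_point(1)[OF f] point_marked_point(2)[OF f i] normal_poly_def normal_point_def
      exact_period_def funpow_affine_conj[OF a]
    using assms(3)[OF i] a by (simp add: exact_period_def)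
qed

text \<open>
  A point given by \<open>f\<close> and \<open>z\<close> is approximated by a sequence of polynomials with simple points of period
  \<open>\<Prod>N\<^sub>i\<close>, together with roots of their dynatomic polynomials converging to the \<open>z\<^sub>i\<close>. These approximations
  are marked points of exact period. The sequence and its limit form a morphism from the space
  of sequences, so that every open neighbourhood of the point contains a member of the sequence.
\<close>

lemma exact_locus_dense: "zariski X closure_of exact_locus = points X"
  unfolding dense_intersects_open
proof (intro allI impI)
  fix W assume "openin (zariski X) W \<and> W \<noteq> {}"
  then obtain x where W: "openin (zariski X) W" and x: "x \<in> W" by blast
  then have "x \<in> points X" using openin_subset by blast
  then obtain f z where f: "is_marked f z" "x = marked_point f z" by (rule points_X_cases)
  have deg: "degree f = d" "degree f \<ge> 2" using f(1) d by (auto simp: is_marked_def)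
  \<comment> \<open>A common multiple of the periods, to which one generic approximation is applied.\<close>
  define M where "M = (\<Prod>i=1..s. N i)"
  have M: "M \<ge> 1" unfolding M_def by (rule prod_ge_1) (rule N_pos)
  obtain F where F: "poly_converges F f" "\<And>n. rsquarefree (period_poly (F n) M)" "\<And>n. free_center (F n)"
    by (rule generic_approximation[OF deg(2) M]) (unfold free_center_def, blast)
  have degF: "degree (F n) = d" for n using F(1) deg by (simp add: poly_converges_def)
  have "\<exists>\<zeta>. \<zeta> \<longlonglongrightarrow> z i \<and> eventually (\<lambda>n. poly (dynatomic (F n) (N i)) (\<zeta> n) = 0) sequentially"
    if i: "i \<in> {1..s}" for i
  proof (rule roots_converge[where P = "\<lambda>n. dynatomic (F n) (N i)" and Q = "dynatomic f (N i)" and D = "d ^ N i" and z = "z i"])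
    show "(\<lambda>n. poly (dynatomic (F n) (N i)) w) \<longlonglongrightarrow> poly (dynatomic f (N i)) w" for w
      by (rule dynatomic_converges[OF deg(2) N_pos[OF i] F(1)])
    show "degree (dynatomic (F n) (N i)) \<le> d ^ N i" for n
      using degree_dynatomic_le[of "F n" "N i"] degF N_pos[OF i] d by simp
    show "dynatomic f (N i) \<noteq> 0" by (rule dynatomic_nonzero[OF deg(2) N_pos[OF i]])
    show "poly (dynatomic f (N i)) (z i) = 0" using f(1) i by (simp add: is_marked_def)
  qed blast
  then obtain \<zeta> where \<zeta>: "\<And>i. i \<in> {1..s} \<Longrightarrow> \<zeta> i \<longlonglongrightarrow> z i"
    "\<And>i. i \<in> {1..s} \<Longrightarrow> eventually (\<lambda>n. poly (dynatomic (F n) (N i)) (\<zeta> i n) = 0) sequentially" by metis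
  have "eventually (\<lambda>n. \<forall>i\<in>{1..s}. poly (dynatomic (F n) (N i)) (\<zeta> i n) = 0) sequentially"
    by (intro eventually_ball_finite) (use \<zeta> in auto)
  then obtain n0 where "\<forall>n\<ge>n0. \<forall>i\<in>{1..s}. poly (dynatomic (F n) (N i)) (\<zeta> i n) = 0"
    unfolding eventually_sequentially by blast
  then have n0: "\<And>n i. n \<ge> n0 \<Longrightarrow> i \<in> {1..s} \<Longrightarrow> poly (dynatomic (F n) (N i)) (\<zeta> i n) = 0"
    by blast
  define G where "G = (\<lambda>y. case y of None \<Rightarrow> f | Some n \<Rightarrow> F (n + n0))"
  define y where "y = (\<lambda>y i. case y of None \<Rightarrow> z i | Some n \<Rightarrow> \<zeta> i (n + n0))"
  have marked: "is_marked (G v) (y v)" for v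
    using f(1) n0 degF by (cases v) (auto simp: G_def y_def is_marked_def)
  have "morphism sequence_space X (\<lambda>v. marked_point (G v) (y v))"
  proof (rule marked_point_morphism[OF ringed_space_sequence_space marked])
    show "ringed_space.regular_family sequence_space (points sequence_space) G"
      unfolding ringed_space.regular_family_def[OF ringed_space_sequence_space] regular_sequence_space
      using F(1) by (auto simp: G_def poly_converges_def intro: LIMSEQ_ignore_initial_segment)
    show "(\<lambda>x. y x i) \<in> regular sequence_space (points sequence_space)" if "i \<in> {1..s}" for i
      unfolding regular_sequence_space
      using \<zeta>(1)[OF that] by (auto simp: y_def intro: LIMSEQ_ignore_initial_segment)
  qed
  from morphism_openin[OF this W]
  have "eventually (\<lambda>n. marked_point (G (Some n)) (y (Some n)) \<in> W) sequentially"
    using x by (simp add: openin_sequence_space points_sequence_space f(2) G_def y_def)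
  then obtain n where n: "marked_point (G (Some n)) (y (Some n)) \<in> W"
    by (auto simp: eventually_sequentially)
  have "marked_point (G (Some n)) (y (Some n)) \<in> exact_locus"
  proof (rule marked_point_in_exact_locus[OF marked])
    show "free_center (G (Some n))" using F(3) by (simp add: G_def)
    fix i assume i: "i \<in> {1..s}"
    have "N i dvd M" unfolding M_def using i by (intro dvd_prodI) auto
    then have "period_poly (F (n + n0)) (N i) dvd period_poly (F (n + n0)) M" by (rule period_poly_dvd)
    then have "rsquarefree (period_poly (F (n + n0)) (N i))"
      using F(2)[of "n + n0"] unfolding rsquarefree_roots dvd_def by (auto simp: pderiv_mult)
    then show "exact_period (poly (G (Some n))) (N i) (y (Some n) i)"
      using dynatomic_root_imp_exact_period[of "F (n + n0)" "N i"] marked[of "Some n"] i N_pos[OF i] degF d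
      by (simp add: G_def y_def is_marked_def)
  qed
  then show "exact_locus \<inter> W \<noteq> {}" using n by blast
qed

lemma exact_locus_nonempty: "exact_locus \<noteq> {}"
proof -
  define M where "M = (\<Prod>i=1..s. N i)"
  have M: "M \<ge> 1" unfolding M_def by (rule prod_ge_1) (rule N_pos)
  have "degree (monom (1 :: complex) d) \<ge> 2" using d by (simp add: degree_monom_eq)
  then obtain F where F: "poly_converges F (monom 1 d)" "\<And>n. rsquarefree (period_poly (F n) M)" "\<And>n. free_center (F n)"
    by (rule generic_approximation[OF _ M]) (unfold free_center_def, blast)
  have deg: "degree (F 0) = d" using F(1) by (simp add: poly_converges_def degree_monom_eq)
  have "\<exists>z. exact_period (poly (F 0)) (N i) z" if i: "i \<in> {1..s}" for i
  proof -
    have "N i dvd M" unfolding M_def using i by (intro dvd_prodI) auto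
    then have "period_poly (F 0) (N i) dvd period_poly (F 0) M" by (rule period_poly_dvd)
    then have "rsquarefree (period_poly (F 0) (N i))"
      using F(2)[of 0] unfolding rsquarefree_roots dvd_def by (auto simp: pderiv_mult)
    then show ?thesis using exists_exact_period[of "F 0" "N i"] deg d N_pos[OF i] by auto
  qed
  then obtain z where z: "\<And>i. i \<in> {1..s} \<Longrightarrow> exact_period (poly (F 0)) (N i) (z i)" by metis
  have "is_marked (F 0) z"
    using z deg d N_pos exact_period_imp_dynatomic_root[of "F 0"] by (auto simp: is_marked_def)
  from marked_point_in_exact_locus[OF this F(3) z] show ?thesis by blast
qed

end

context marked_moduli
begin

section \<open>Strata\<close>

text \<open>
  The pair \<open>(i, j)\<close> stands for the \<open>j\<close>-th iterate of the \<open>i\<close>-th marked point. The value \<open>j = N i\<close> is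
  included, so that the coincidences also record how \<open>f\<close> permutes the cycle points.
\<close>

definition orbit_indices :: "(nat \<times> nat) set" where
  "orbit_indices = Sigma {1..s} (\<lambda>i. {..N i})"

definition orbit_point where
  "orbit_point x k = (poly (point_poly x) ^^ snd k) (point_mark x (fst k))"

definition coincidences where
  "coincidences x = {(k, l) \<in> orbit_indices \<times> orbit_indices. orbit_point x k = orbit_point x l}"

definition stratum where
  "stratum E = {x \<in> exact_locus. coincidences x = E}"

lemma finite_orbit_indices: "finite orbit_indices" by (simp add: orbit_indices_def)

lemma regular_orbit_point: "fst k \<in> {1..s} \<Longrightarrow> (\<lambda>x. orbit_point x k) \<in> regular X free_locus"
  unfolding orbit_point_def by (rule regular_orbit)

lemma exact_subset_free: "exact_locus \<subseteq> free_locus" by (auto simp: exact_locus_def)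

lemma regular_orbit_point_exact: "k \<in> orbit_indices \<Longrightarrow> (\<lambda>x. orbit_point x k) \<in> regular X exact_locus"
  by (rule ringed_space.regular_restrict[OF ringed_X open_free_locus regular_orbit_point open_exact_locus exact_subset_free])
    (auto simp: orbit_indices_def)

text \<open>
  The inequalities define an open set, in which the equalities persist in the closure.
\<close>

lemma stratum_locally_closed:
  obtains W where "openin (zariski X) W" "stratum E = W \<inter> (zariski X closure_of stratum E)"
proof -
  let ?K = "orbit_indices \<times> orbit_indices - E"
  define W where "W = {x \<in> exact_locus. \<forall>k\<in>?K. orbit_point x (fst k) \<noteq> orbit_point x (snd k)}"
  have W: "openin (zariski X) W"
    unfolding W_def
  proof (rule openin_finite_Ball[OF open_exact_locus])
    show "finite ?K" using finite_orbit_indices by simp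
    fix k assume "k \<in> ?K"
    then show "openin (zariski X) {x \<in> exact_locus. orbit_point x (fst k) \<noteq> orbit_point x (snd k)}"
      by (intro ringed_space.openin_distinct[OF ringed_X open_exact_locus] regular_orbit_point_exact) auto
  qed
  have sub: "stratum E \<subseteq> W \<inter> (zariski X closure_of stratum E)"
  proof
    fix x assume x: "x \<in> stratum E"
    then have "x \<in> W" by (auto simp: stratum_def W_def coincidences_def)
    moreover have "stratum E \<subseteq> points X"
      using openin_subset[OF open_exact_locus] by (auto simp: stratum_def)
    ultimately show "x \<in> W \<inter> (zariski X closure_of stratum E)"
      using x closure_of_subset by blast
  qed
  have "x \<in> stratum E" if x: "x \<in> W" "x \<in> zariski X closure_of stratum E" for x
  proof -
    have x0: "x \<in> exact_locus" using x(1) by (simp add: W_def)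
    have "stratum E \<noteq> {}" using x(2) by auto
    then obtain y where y: "y \<in> stratum E" by blast
    have "E \<subseteq> orbit_indices \<times> orbit_indices" using y by (auto simp: stratum_def coincidences_def)
    have "orbit_point x k = orbit_point x l" if kl: "(k, l) \<in> E" for k l
    proof (rule ccontr)
      assume ne: "orbit_point x k \<noteq> orbit_point x l"
      have "openin (zariski X) {x \<in> exact_locus. orbit_point x k \<noteq> orbit_point x l}"
        using kl \<open>E \<subseteq> _\<close> by (intro ringed_space.openin_distinct[OF ringed_X open_exact_locus] regular_orbit_point_exact) auto
      moreover have "x \<in> {x \<in> exact_locus. orbit_point x k \<noteq> orbit_point x l}" using ne x0 by simp
      ultimately have "\<exists>v. v \<in> stratum E \<and> v \<in> {x \<in> exact_locus. orbit_point x k \<noteq> orbit_point x l}"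
        using x(2)[unfolded in_closure_of, THEN conjunct2, rule_format, OF conjI] by meson
      then obtain v where "v \<in> stratum E" "orbit_point v k \<noteq> orbit_point v l" by blast
      then show False using kl by (auto simp: stratum_def coincidences_def)
    qed
    then have "E \<subseteq> coincidences x" using \<open>E \<subseteq> _\<close> unfolding coincidences_def by blast
    moreover have "coincidences x \<subseteq> E"
    proof
      fix k assume k: "k \<in> coincidences x"
      then have "k \<in> orbit_indices \<times> orbit_indices" "orbit_point x (fst k) = orbit_point x (snd k)"
        by (auto simp: coincidences_def)
      then show "k \<in> E" using x(1) unfolding W_def by blast
    qed
    ultimately have "coincidences x = E" by blast
    then show ?thesis using x0 by (simp add: stratum_def)
  qed
  then show thesis using that[OF W] sub by blast
qed

lemma orbit_point_marked_point:
  assumes "is_marked f z" "free_center f" "fst k \<in> {1..s}"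
  shows "orbit_point (marked_point f z) k =
    normal_scale f * (poly f ^^ snd k) (z (fst k)) + normal_shift f"
proof -
  have "degree f \<ge> 2" using assms(1) d by (simp add: is_marked_def)
  then have "normal_scale f \<noteq> 0" by (rule normal_scale_nonzero[OF _ assms(2)])
  then show ?thesis
    using assms unfolding orbit_point_def
    by (simp add: point_marked_point normal_poly_def normal_point_def funpow_affine_conj)
qed

end

text \<open>
  The combinatorial description of the stratum through a base point \<open>x0\<close>: the points on the marked
  cycles of \<open>x0\<close> are enumerated without repetition as \<open>w0 0, \<dots>, w0 (n - 1)\<close>. The polynomial acts on the
  indices by \<open>\<sigma>\<close>, the marked points have the indices \<open>\<mu> i\<close>, and \<open>\<tau> k\<close> tells which iterate of which
  marked point is \<open>w0 k\<close>. All points of the stratum share these data.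
\<close>

locale stratum_chart = marked_moduli +
  fixes x0 and n :: nat and w0 :: "nat \<Rightarrow> complex" and \<sigma> \<mu> :: "nat \<Rightarrow> nat" and \<tau> :: "nat \<Rightarrow> nat \<times> nat"
  assumes x0: "x0 \<in> exact_locus" and n_le: "n \<le> d + 1" and w0: "inj_on w0 {..<n}"
    and \<tau>: "\<And>k. k < n \<Longrightarrow> fst (\<tau> k) \<in> {1..s}" "\<And>k. k < n \<Longrightarrow> snd (\<tau> k) < N (fst (\<tau> k))"
      "\<And>k. k < n \<Longrightarrow> orbit_point x0 (\<tau> k) = w0 k"
    and \<sigma>: "\<And>k. k < n \<Longrightarrow> \<sigma> k < n" "\<And>k. k < n \<Longrightarrow> w0 (\<sigma> k) = poly (point_poly x0) (w0 k)"
    and \<mu>: "\<And>i. i \<in> {1..s} \<Longrightarrow> \<mu> i < n" "\<And>i. i \<in> {1..s} \<Longrightarrow> w0 (\<mu> i) = point_mark x0 i"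
begin

abbreviation U where "U \<equiv> stratum (coincidences x0)"

definition cycle_point where "cycle_point x k = orbit_point x (\<tau> k)"

text \<open>
  Polynomials with an enumeration of their marked cycles. This is the object to which
  interpolation applies; it determines the marked points as \<open>w (\<mu> i)\<close>.
\<close>

definition cycles :: "complex poly \<Rightarrow> (nat \<Rightarrow> complex) \<Rightarrow> bool" where
  "cycles f w \<longleftrightarrow> degree f = d \<and> inj_on w {..<n} \<and> (\<forall>k<n. poly f (w k) = w (\<sigma> k)) \<and> free_center f"

lemma \<tau>_index: "k < n \<Longrightarrow> \<tau> k \<in> orbit_indices"
  using \<tau>(1,2)[of k] by (cases "\<tau> k") (simp add: orbit_indices_def)

lemma point_poly_free: "x \<in> free_locus \<Longrightarrow> free_center (point_poly x)"
  using point_normal_form(4,5) by (simp add: free_center_def)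

lemma orbit_eq_iff:
  assumes "x \<in> U" "k \<in> orbit_indices" "l \<in> orbit_indices"
  shows "orbit_point x k = orbit_point x l \<longleftrightarrow> orbit_point x0 k = orbit_point x0 l"
proof -
  have "(k, l) \<in> coincidences x \<longleftrightarrow> (k, l) \<in> coincidences x0" using assms(1) by (simp add: stratum_def)
  then show ?thesis using assms(2,3) by (simp add: coincidences_def)
qed

lemma cycle_point_mark:
  assumes "x \<in> U" "i \<in> {1..s}"
  shows "cycle_point x (\<mu> i) = point_mark x i"
proof -
  have "(i, 0) \<in> orbit_indices" using assms(2) by (simp add: orbit_indices_def)
  moreover have "orbit_point x0 (\<tau> (\<mu> i)) = orbit_point x0 (i, 0)"
    using \<mu>[OF assms(2)] \<tau>(3) by (simp add: orbit_point_def)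
  ultimately have "orbit_point x (\<tau> (\<mu> i)) = orbit_point x (i, 0)"
    using orbit_eq_iff[OF assms(1) \<tau>_index[OF \<mu>(1)[OF assms(2)]]] by blast
  then show ?thesis by (simp add: cycle_point_def orbit_point_def)
qed

lemma cycles_cycle_point:
  assumes x: "x \<in> U"
  shows "cycles (point_poly x) (cycle_point x)"
  unfolding cycles_def
proof (intro conjI allI impI)
  have "x \<in> free_locus" using x exact_subset_free by (auto simp: stratum_def)
  then show "degree (point_poly x) = d" "free_center (point_poly x)"
    using point_normal_form(3) point_poly_free by auto
  show "inj_on (cycle_point x) {..<n}"
  proof (rule inj_onI)
    fix k l assume kl: "k \<in> {..<n}" "l \<in> {..<n}" "cycle_point x k = cycle_point x l"
    then have "orbit_point x0 (\<tau> k) = orbit_point x0 (\<tau> l)"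
      using orbit_eq_iff[OF x \<tau>_index \<tau>_index, of k l] by (simp add: cycle_point_def)
    then show "k = l" using kl(1,2) \<tau>(3) inj_onD[OF w0, of k l] by simp
  qed
  fix k assume k: "k < n"
  let ?l = "(fst (\<tau> k), Suc (snd (\<tau> k)))"
  have l: "?l \<in> orbit_indices" using \<tau>(1,2)[OF k] by (simp add: orbit_indices_def)
  have step: "orbit_point y ?l = poly (point_poly y) (orbit_point y (\<tau> k))" for y
    by (simp add: orbit_point_def)
  have "orbit_point x0 (\<tau> (\<sigma> k)) = orbit_point x0 ?l"
    unfolding step using \<sigma>[OF k] \<tau>(3) k by simp
  then have "orbit_point x (\<tau> (\<sigma> k)) = orbit_point x ?l"
    using orbit_eq_iff[OF x \<tau>_index[OF \<sigma>(1)[OF k]] l] by blast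
  then show "poly (point_poly x) (cycle_point x k) = cycle_point x (\<sigma> k)"
    unfolding step by (simp add: cycle_point_def)
qed

lemma \<sigma>_funpow: "k < n \<Longrightarrow> (\<sigma> ^^ j) k < n"
  by (induction j) (simp_all add: \<sigma>(1))

lemma cycles_funpow:
  assumes "\<And>k. k < n \<Longrightarrow> poly f (w k) = w (\<sigma> k)" "k < n"
  shows "(poly f ^^ j) (w k) = w ((\<sigma> ^^ j) k)"
  by (induction j) (simp_all add: assms \<sigma>_funpow)

text \<open>
  As the \<open>w k\<close> are distinct, iterates of the marked points \<open>w (\<mu> i)\<close> coincide exactly when their indices
  do, that is, exactly when the corresponding iterates for \<open>x0\<close> coincide. This gives the exact
  periods as well as membership in the stratum.
\<close>

lemma marked_point_of_cycles:
  assumes fw: "cycles f w"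
  defines "y \<equiv> marked_point f (\<lambda>i. w (\<mu> i))"
  shows "is_marked f (\<lambda>i. w (\<mu> i))" and "y \<in> U"
    and "point_poly y = affine_conj (normal_scale f) (normal_shift f) f"
    and "k < n \<Longrightarrow> cycle_point y k = normal_scale f * w k + normal_shift f"
proof -
  have f: "degree f = d" "free_center f" "degree f \<ge> 2" and w: "inj_on w {..<n}"
    and step: "\<And>k. k < n \<Longrightarrow> poly f (w k) = w (\<sigma> k)"
    using fw d by (auto simp: cycles_def)
  have a: "normal_scale f \<noteq> 0" by (rule normal_scale_nonzero[OF f(3,2)])
  have orbit: "(poly f ^^ j) (w (\<mu> i)) = w ((\<sigma> ^^ j) (\<mu> i))" if "i \<in> {1..s}" for i j
    by (rule cycles_funpow[where f = f and w = w, OF step \<mu>(1)[OF that]])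
  have orbit0: "orbit_point x0 k = w0 ((\<sigma> ^^ snd k) (\<mu> (fst k)))" if "fst k \<in> {1..s}" for k
    unfolding orbit_point_def \<mu>(2)[OF that, symmetric]
    by (rule cycles_funpow[where f = "point_poly x0" and w = w0, OF \<sigma>(2)[symmetric] \<mu>(1)[OF that]])
  have same: "(poly f ^^ snd k) (w (\<mu> (fst k))) = (poly f ^^ snd l) (w (\<mu> (fst l))) \<longleftrightarrow>
      orbit_point x0 k = orbit_point x0 l" if "fst k \<in> {1..s}" "fst l \<in> {1..s}" for k l
  proof -
    have "(\<sigma> ^^ snd k) (\<mu> (fst k)) \<in> {..<n}" "(\<sigma> ^^ snd l) (\<mu> (fst l)) \<in> {..<n}"
      using \<sigma>_funpow[OF \<mu>(1)] that by blast+
    from inj_on_eq_iff[OF w this] inj_on_eq_iff[OF w0 this] show ?thesis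
      unfolding orbit[OF that(1)] orbit[OF that(2)] orbit0[OF that(1)] orbit0[OF that(2)] by simp
  qed
  have exact: "exact_period (poly f) (N i) (w (\<mu> i))" if i: "i \<in> {1..s}" for i
  proof -
    have "exact_period (poly (point_poly x0)) (N i) (point_mark x0 i)" using x0 i by (simp add: exact_locus_def)
    moreover have "(poly f ^^ j) (w (\<mu> i)) = w (\<mu> i) \<longleftrightarrow>
        (poly (point_poly x0) ^^ j) (point_mark x0 i) = point_mark x0 i" for j
      using same[of "(i, j)" "(i, 0)"] i by (simp add: orbit_point_def)
    ultimately show ?thesis by (simp add: exact_period_def)
  qed
  show marked: "is_marked f (\<lambda>i. w (\<mu> i))"
    using f exact N_pos exact_period_imp_dynatomic_root[OF f(3)] by (simp add: is_marked_def)
  have y: "orbit_point y k = normal_scale f * (poly f ^^ snd k) (w (\<mu> (fst k))) + normal_shift f"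
    if "fst k \<in> {1..s}" for k
    unfolding y_def by (rule orbit_point_marked_point[OF marked f(2) that])
  have "y \<in> exact_locus" unfolding y_def by (rule marked_point_in_exact_locus[OF marked f(2) exact])
  moreover have "coincidences y = coincidences x0"
  proof -
    have "orbit_point y k = orbit_point y l \<longleftrightarrow> orbit_point x0 k = orbit_point x0 l"
      if "k \<in> orbit_indices" "l \<in> orbit_indices" for k l
    proof -
      have kl: "fst k \<in> {1..s}" "fst l \<in> {1..s}" using that by (auto simp: orbit_indices_def)
      show ?thesis unfolding y[OF kl(1)] y[OF kl(2)] same[OF kl, symmetric] using a by simp
    qed
    then show ?thesis unfolding coincidences_def by auto
  qed
  ultimately show "y \<in> U" by (simp add: stratum_def)
  show "point_poly y = affine_conj (normal_scale f) (normal_shift f) f"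
    unfolding y_def by (simp add: point_marked_point[OF marked f(2)] normal_poly_def)
  show "cycle_point y k = normal_scale f * w k + normal_shift f" if k: "k < n"
  proof -
    have "w0 ((\<sigma> ^^ snd (\<tau> k)) (\<mu> (fst (\<tau> k)))) = w0 k" using orbit0[OF \<tau>(1)[OF k]] \<tau>(3)[OF k] by simp
    then have "(\<sigma> ^^ snd (\<tau> k)) (\<mu> (fst (\<tau> k))) = k"
      using inj_on_eq_iff[OF w0] \<sigma>_funpow[OF \<mu>(1)[OF \<tau>(1)[OF k]]] k by simp
    then show ?thesis
      unfolding cycle_point_def y[OF \<tau>(1)[OF k]] orbit[OF \<tau>(1)[OF k]] by simp
  qed
qed

subsection \<open>Affine normalisation\<close>

text \<open>
  Two distinct points depending equivariantly on the polynomial and its cycles; the affine group acts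
  simply transitively on such pairs, so putting them at 0 and 1 selects one representative of each
  orbit. A single cycle point is fixed by \<open>f\<close> and therefore different from the center.
\<close>

definition base0 :: "complex poly \<Rightarrow> (nat \<Rightarrow> complex) \<Rightarrow> complex" where
  "base0 f w = (if n \<ge> 2 then w 0 else center f)"

definition base1 :: "complex poly \<Rightarrow> (nat \<Rightarrow> complex) \<Rightarrow> complex" where
  "base1 f w = (if n \<ge> 2 then w 1 else if n = 1 then w 0 else poly f (center f))"

definition slice :: "complex poly \<Rightarrow> (nat \<Rightarrow> complex) \<Rightarrow> bool" where
  "slice f w \<longleftrightarrow> cycles f w \<and> base0 f w = 0 \<and> base1 f w = 1"

lemma base_distinct:
  assumes "cycles f w"
  shows "base0 f w \<noteq> base1 f w"
proof -
  have inj: "inj_on w {..<n}" and step: "\<And>k. k < n \<Longrightarrow> poly f (w k) = w (\<sigma> k)" and free: "free_center f"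
    using assms by (simp_all add: cycles_def)
  consider "n \<ge> 2" | "n = 1" | "n = 0" by linarith
  then show ?thesis
  proof cases
    case 1
    then show ?thesis unfolding base0_def base1_def using inj_on_eq_iff[OF inj, of 0 1] by simp
  next
    case 2
    then have "poly f (w 0) = w 0" using \<sigma>(1)[of 0] step[of 0] by simp
    then show ?thesis unfolding base0_def base1_def using free 2 by (auto simp: free_center_def)
  next
    case 3
    then show ?thesis unfolding base0_def base1_def using free by (simp add: free_center_def)
  qed
qed

lemma base_affine_conj:
  assumes "degree f = d" "\<alpha> \<noteq> 0" and v: "\<And>k. k < n \<Longrightarrow> v k = \<alpha> * w k + \<beta>"
  shows "base0 (affine_conj \<alpha> \<beta> f) v = \<alpha> * base0 f w + \<beta>"
    and "base1 (affine_conj \<alpha> \<beta> f) v = \<alpha> * base1 f w + \<beta>"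
  using assms d center_affine_conj[of f \<alpha> \<beta>]
  by (simp_all add: base0_def base1_def poly_affine_conj_image)

lemma cycles_affine_conj:
  assumes fw: "cycles f w" and "\<alpha> \<noteq> 0" and v: "\<And>k. k < n \<Longrightarrow> v k = \<alpha> * w k + \<beta>"
  shows "cycles (affine_conj \<alpha> \<beta> f) v"
  unfolding cycles_def
proof (intro conjI allI impI)
  have f: "degree f = d" "degree f \<ge> 2" using fw d by (auto simp: cycles_def)
  show "degree (affine_conj \<alpha> \<beta> f) = d" using f assms(2) by (simp add: degree_affine_conj)
  show "free_center (affine_conj \<alpha> \<beta> f)"
    using free_center_affine_conj[OF f(2) assms(2)] fw by (simp add: cycles_def)
  show "inj_on v {..<n}" using fw v \<open>\<alpha> \<noteq> 0\<close> by (auto simp: cycles_def inj_on_def)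
  show "poly (affine_conj \<alpha> \<beta> f) (v k) = v (\<sigma> k)" if "k < n" for k
    using fw that \<sigma>(1)[OF that] by (simp add: v poly_affine_conj_image[OF assms(2)] cycles_def)
qed

definition slice_scale where
  "slice_scale x = 1 / (base1 (point_poly x) (cycle_point x) - base0 (point_poly x) (cycle_point x))"

definition slice_shift where
  "slice_shift x = - base0 (point_poly x) (cycle_point x) * slice_scale x"

definition slice_poly where
  "slice_poly x = affine_conj (slice_scale x) (slice_shift x) (point_poly x)"

definition slice_point where
  "slice_point x k = slice_scale x * cycle_point x k + slice_shift x"

lemma slice_scale_nonzero: "x \<in> U \<Longrightarrow> slice_scale x \<noteq> 0"
  using not_sym[OF base_distinct[OF cycles_cycle_point, of x]] by (simp add: slice_scale_def)

lemma slice_slice_point: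
  assumes x: "x \<in> U"
  shows "slice (slice_poly x) (slice_point x)"
proof -
  have c: "cycles (point_poly x) (cycle_point x)" by (rule cycles_cycle_point[OF x])
  then have deg: "degree (point_poly x) = d" by (simp add: cycles_def)
  have a: "slice_scale x \<noteq> 0" by (rule slice_scale_nonzero[OF x])
  have v: "slice_point x k = slice_scale x * cycle_point x k + slice_shift x" for k by (simp add: slice_point_def)
  have "(base1 (point_poly x) (cycle_point x) - base0 (point_poly x) (cycle_point x)) * slice_scale x = 1"
    using not_sym[OF base_distinct[OF c]] by (simp add: slice_scale_def)
  then show ?thesis
    unfolding slice_def slice_poly_def base_affine_conj[OF deg a v]
    using cycles_affine_conj[OF c a v] by (simp add: slice_shift_def algebra_simps)
qed

lemma marked_point_slice:
  assumes x: "x \<in> U"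
  shows "marked_point (slice_poly x) (\<lambda>i. slice_point x (\<mu> i)) = x"
proof -
  have "marked_point (slice_poly x) (\<lambda>i. slice_point x (\<mu> i)) =
     marked_point (slice_poly x) (\<lambda>i. slice_scale x * point_mark x i + slice_shift x)"
    unfolding marked_point_def
    by (intro arg_cong2[of _ _ _ _ Pair] refl restrict_ext) (simp add: slice_point_def cycle_point_mark[OF x])
  also have "\<dots> = marked_point (point_poly x) (point_mark x)"
    unfolding slice_poly_def by (rule marked_point_conj[OF slice_scale_nonzero[OF x]])
  also have "\<dots> = x" using x exact_subset_free by (intro point_normal_form(2)) (auto simp: stratum_def)
  finally show ?thesis .
qed

lemma slice_of_marked_point:
  assumes s: "slice f w"
  defines "y \<equiv> marked_point f (\<lambda>i. w (\<mu> i))"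
  shows "slice_poly y = f" and "k < n \<Longrightarrow> slice_point y k = w k"
proof -
  have c: "cycles f w" and b: "base0 f w = 0" "base1 f w = 1" using s by (auto simp: slice_def)
  then have deg: "degree f = d" "degree f \<ge> 2" "free_center f" using d by (auto simp: cycles_def)
  define \<alpha> \<beta> where "\<alpha> = normal_scale f" and "\<beta> = normal_shift f"
  have \<alpha>: "\<alpha> \<noteq> 0" unfolding \<alpha>_def by (rule normal_scale_nonzero[OF deg(2,3)])
  have P: "point_poly y = affine_conj \<alpha> \<beta> f"
    unfolding y_def \<alpha>_def \<beta>_def by (rule marked_point_of_cycles(3)[OF c])
  have w: "cycle_point y k = \<alpha> * w k + \<beta>" if "k < n" for k
    unfolding y_def \<alpha>_def \<beta>_def by (rule marked_point_of_cycles(4)[OF c that])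
  have "base0 (point_poly y) (cycle_point y) = \<beta>" "base1 (point_poly y) (cycle_point y) = \<alpha> + \<beta>"
    using base_affine_conj[where v = "cycle_point y" and w = w, OF deg(1) \<alpha> w] by (simp_all add: P b)
  then have sc: "slice_scale y = 1 / \<alpha>" "slice_shift y = - \<beta> / \<alpha>"
    by (simp_all add: slice_scale_def slice_shift_def)
  show "slice_poly y = f"
    unfolding slice_poly_def P sc by (rule affine_conj_inverse[OF \<alpha>])
  show "slice_point y k = w k" if "k < n"
    unfolding slice_point_def w[OF that] sc using \<alpha> by (simp add: add_divide_distrib)
qed

end

context stratum_chart
begin

subsection \<open>Coordinates on the slice\<close>

text \<open>
  The affine coordinates \<open>u 1, \<dots>, u (d - 1)\<close> of the slice. If \<open>n \<ge> 2\<close>, the cycle points are 0, 1 and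
  \<open>u 1, \<dots>, u (n - 2)\<close>, and \<open>u (n - 1), \<dots>, u (d - 1)\<close> are the coefficients of degrees \<open>n, \<dots>, d\<close>. If
  \<open>n < 2\<close>, the coefficient of degree \<open>d - 1\<close> vanishes because the center is 0, the other coefficients of
  positive degree are the coordinates, and the constant term is determined by \<open>f(0) = 1\<close> or, when
  there is a cycle point, by \<open>f(1) = 1\<close>.
\<close>

definition param_point :: "(nat \<Rightarrow> complex) \<Rightarrow> nat \<Rightarrow> complex" where
  "param_point u k = (if n \<ge> 2 then if k = 0 then 0 else if k = 1 then 1 else u (k - 1) else 1)"

definition top_part :: "(nat \<Rightarrow> complex) \<Rightarrow> complex poly" where
  "top_part u = (\<Sum>j\<in>{n..d}. monom (u (j - 1)) j)"

definition low_part :: "(nat \<Rightarrow> complex) \<Rightarrow> complex poly" where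
  "low_part u = (\<Sum>j\<in>{1..d} - {d - 1}. monom (u (if j = d then d - 1 else j)) j)"

definition param_poly :: "(nat \<Rightarrow> complex) \<Rightarrow> complex poly" where
  "param_poly u =
     (if n \<ge> 2
      then top_part u + (\<Sum>k<n. smult (param_point u (\<sigma> k) - poly (top_part u) (param_point u k))
             (lagrange_basis {..<n} (param_point u) k))
      else low_part u + [:1 - (if n = 1 then poly (low_part u) 1 else 0):])"

definition coords :: "complex poly \<Rightarrow> (nat \<Rightarrow> complex) \<Rightarrow> nat \<Rightarrow> complex" where
  "coords f w k =
     (if k \<in> {1..d - 1}
      then if n \<ge> 2 then if k \<le> n - 2 then w (k + 1) else coeff f (k + 1)
           else coeff f (if k = d - 1 then d else k)
      else 0)"

abbreviation CS where "CS \<equiv> coordinate_space (d - 1)"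

definition \<Omega>1 where "\<Omega>1 = {u \<in> points CS. inj_on (param_point u) {..<n}}"

definition \<Omega> where
  "\<Omega> = {u \<in> {u \<in> \<Omega>1. coeff (param_poly u) d \<noteq> 0}. free_center (param_poly u)}"

lemma coeff_top_part: "coeff (top_part u) i = (if n \<le> i \<and> i \<le> d then u (i - 1) else 0)"
  unfolding top_part_def coeff_sum coeff_monom by (simp add: sum.delta')

lemma coeff_low_part:
  "coeff (low_part u) i = (if i \<in> {1..d} - {d - 1} then u (if i = d then d - 1 else i) else 0)"
  unfolding low_part_def coeff_sum coeff_monom by (simp add: sum.delta')

lemma degree_top_part: "degree (top_part u) \<le> d"
  by (rule degree_le) (simp add: coeff_top_part)

lemma degree_low_part: "degree (low_part u) \<le> d"
  by (rule degree_le) (simp add: coeff_low_part)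

lemma degree_param_poly: "degree (param_poly u) \<le> d"
proof (cases "n \<ge> 2")
  case True
  have deg: "degree (\<Sum>k<n. smult (c k) (lagrange_basis {..<n} (param_point u) k)) \<le> d" for c
  proof (rule degree_sum_le)
    fix k assume "k \<in> {..<n}"
    then have "degree (lagrange_basis {..<n} (param_point u) k) < n"
      using degree_lagrange_basis[of "{..<n}" k "param_point u"] by simp
    then show "degree (smult (c k) (lagrange_basis {..<n} (param_point u) k)) \<le> d"
      using degree_smult_le[of "c k" "lagrange_basis {..<n} (param_point u) k"] n_le by linarith
  qed simp
  have "param_poly u = top_part u + (\<Sum>k<n. smult (param_point u (\<sigma> k) - poly (top_part u) (param_point u k))
             (lagrange_basis {..<n} (param_point u) k))" using True by (simp add: param_poly_def)
  then show ?thesis using degree_add_le[OF degree_top_part deg] by simp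
next
  case False
  have "param_poly u = low_part u + [:1 - (if n = 1 then poly (low_part u) 1 else 0):]"
    using False by (simp add: param_poly_def)
  then show ?thesis using degree_add_le[OF degree_low_part, of "[:1 - (if n = 1 then poly (low_part u) 1 else 0):]"]
    by simp
qed

lemma param_poly_interpolates:
  assumes "n \<ge> 2" "inj_on (param_point u) {..<n}"
  shows "k < n \<Longrightarrow> poly (param_poly u) (param_point u k) = param_point u (\<sigma> k)"
    and "n \<le> i \<Longrightarrow> i \<le> d \<Longrightarrow> coeff (param_poly u) i = u (i - 1)"
proof -
  define c where "c = (\<lambda>k. param_point u (\<sigma> k) - poly (top_part u) (param_point u k))"
  let ?L = "\<Sum>k<n. smult (c k) (lagrange_basis {..<n} (param_point u) k)"
  have P: "param_poly u = top_part u + ?L" using assms(1) by (simp add: param_poly_def c_def)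
  note L = lagrange_interpolation[OF _ assms(2), where v = c]
  show "poly (param_poly u) (param_point u k) = param_point u (\<sigma> k)" if "k < n"
    using L(2)[of k] that by (simp add: P c_def)
  show "coeff (param_poly u) i = u (i - 1)" if "n \<le> i" "i \<le> d"
  proof -
    have "degree ?L < i" using L(1) that assms(1) by simp
    then show ?thesis using that by (simp add: P coeff_top_part coeff_eq_0)
  qed
qed

lemma low_param_poly:
  assumes "\<not> n \<ge> 2" "coeff (param_poly u) d \<noteq> 0"
  shows "i \<in> {1..d} \<Longrightarrow> coeff (param_poly u) i = (if i = d - 1 then 0 else u (if i = d then d - 1 else i))"
    and "center (param_poly u) = 0"
    and "n = 0 \<Longrightarrow> poly (param_poly u) 0 = 1" and "n = 1 \<Longrightarrow> poly (param_poly u) 1 = 1"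
proof -
  have P: "param_poly u = low_part u + [:1 - (if n = 1 then poly (low_part u) 1 else 0):]"
    using assms(1) by (simp add: param_poly_def)
  show co: "coeff (param_poly u) i = (if i = d - 1 then 0 else u (if i = d then d - 1 else i))"
    if "i \<in> {1..d}" for i
  proof -
    have "coeff [:c:] i = 0" for c :: complex using that by (cases i) auto
    then show ?thesis using that unfolding P coeff_add coeff_low_part by auto
  qed
  have "degree (param_poly u) = d" using degree_param_poly le_degree[OF assms(2)] by (rule antisym)
  moreover have "coeff (param_poly u) (d - 1) = 0" using co[of "d - 1"] d by simp
  ultimately show "center (param_poly u) = 0" by (simp add: center_def)
  have "poly (low_part u) 0 = 0" unfolding poly_0_coeff_0 coeff_low_part by simp
  then show "poly (param_poly u) 0 = 1" if "n = 0" unfolding P using that by simp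
  show "poly (param_poly u) 1 = 1" if "n = 1" unfolding P using that by simp
qed

lemma slice_param:
  assumes u: "u \<in> \<Omega>"
  shows "slice (param_poly u) (param_point u)" and "coords (param_poly u) (param_point u) = u"
proof -
  have uS: "\<And>k. k \<notin> {1..d - 1} \<Longrightarrow> u k = 0" and inj: "inj_on (param_point u) {..<n}"
    and lead: "coeff (param_poly u) d \<noteq> 0" and free: "free_center (param_poly u)"
    using u by (auto simp: \<Omega>_def \<Omega>1_def points_coordinate_space)
  have deg: "degree (param_poly u) = d" using degree_param_poly le_degree[OF lead] by (rule antisym)
  have step: "poly (param_poly u) (param_point u k) = param_point u (\<sigma> k)" if k: "k < n" for k
  proof (cases "n \<ge> 2")
    case True
    then show ?thesis by (rule param_poly_interpolates(1)[OF _ inj k])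
  next
    case False
    then have "n = 1" using k by simp
    then show ?thesis unfolding param_point_def using low_param_poly(4)[OF False lead] by simp
  qed
  have cyc: "cycles (param_poly u) (param_point u)"
    unfolding cycles_def using deg inj step free by blast
  have "base0 (param_poly u) (param_point u) = 0 \<and> base1 (param_poly u) (param_point u) = 1"
  proof (cases "n \<ge> 2")
    case True
    then show ?thesis unfolding base0_def base1_def by (simp add: param_point_def)
  next
    case False
    note c = low_param_poly(2)[OF False lead]
    show ?thesis
    proof (cases "n = 1")
      case True
      then show ?thesis unfolding base0_def base1_def param_point_def using False c by simp
    next
      case n1: False
      then have "n = 0" using False by simp
      from low_param_poly(3)[OF False lead this] show ?thesis
        unfolding base0_def base1_def using False n1 c by simp
    qed
  qed
  then show "slice (param_poly u) (param_point u)" using cyc by (simp add: slice_def)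
  show "coords (param_poly u) (param_point u) = u"
  proof
    fix k
    show "coords (param_poly u) (param_point u) k = u k"
    proof (cases "k \<in> {1..d - 1}")
      case False
      show ?thesis unfolding coords_def if_not_P[OF False] using uS[OF False] by simp
    next
      case True
      show ?thesis
      proof (cases "n \<ge> 2")
        case n: True
        show ?thesis
        proof (cases "k \<le> n - 2")
          case kn: True
          have "k \<ge> 1" using True by simp
          then show ?thesis
            unfolding coords_def if_P[OF True] if_P[OF n] if_P[OF kn] unfolding param_point_def using n by simp
        next
          case kn: False
          then have "coeff (param_poly u) (k + 1) = u k"
            using param_poly_interpolates(2)[OF n inj, of "k + 1"] True n by simp
          then show ?thesis unfolding coords_def if_P[OF True] if_P[OF n] if_not_P[OF kn] .
        qed
      next
        case n: False
        have "coeff (param_poly u) (if k = d - 1 then d else k) = u k"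
          using low_param_poly(1)[OF n lead, of "if k = d - 1 then d else k"] True d
          by (auto split: if_splits)
        then show ?thesis unfolding coords_def if_P[OF True] if_not_P[OF n] .
      qed
    qed
  qed
qed

text \<open>
  Interpolation is unique: for \<open>n \<ge> 2\<close> the difference of the two polynomials has degree less than \<open>n\<close> and
  vanishes at \<open>n\<close> points.
\<close>

lemma param_coords:
  assumes s: "slice f w"
  shows "param_poly (coords f w) = f" and "k < n \<Longrightarrow> param_point (coords f w) k = w k"
    and "coords f w \<in> \<Omega>"
proof -
  let ?u = "coords f w"
  have c: "cycles f w" and b: "base0 f w = 0" "base1 f w = 1" using s by (auto simp: slice_def)
  have deg: "degree f = d" and inj: "inj_on w {..<n}" and step: "\<And>k. k < n \<Longrightarrow> poly f (w k) = w (\<sigma> k)"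
    and free: "free_center f" using c by (auto simp: cycles_def)
  show pt: "param_point ?u k = w k" if k: "k < n" for k
  proof (cases "n \<ge> 2")
    case True
    have "w 0 = 0" "w 1 = 1" using b True unfolding base0_def base1_def by simp_all
    moreover have "?u (k - 1) = w k" if "k \<noteq> 0" "k \<noteq> 1"
      unfolding coords_def using that k n_le True by auto
    ultimately show ?thesis unfolding param_point_def using True by auto
  next
    case False
    then have "n = 1" using k by simp
    then have "w 0 = 1" "k = 0" using b(2) k unfolding base1_def by simp_all
    then show ?thesis unfolding param_point_def using False by simp
  qed
  have inj': "inj_on (param_point ?u) {..<n}"
    using inj pt by (simp add: inj_on_def)
  show P: "param_poly ?u = f"
  proof (cases "n \<ge> 2")
    case True
    have low: "degree p < n" if "\<And>i. n \<le> i \<Longrightarrow> coeff p i = 0" for p :: "complex poly"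
      using that True by (intro degree_lessI) auto
    have "param_poly ?u - f = 0"
    proof (rule poly_eqI_card[of "{..<n}" w])
      show "degree (param_poly ?u - f) < card {..<n}"
        unfolding card_lessThan
      proof (rule low)
        fix i assume i: "n \<le> i"
        show "coeff (param_poly ?u - f) i = 0"
        proof (cases "i \<le> d")
          case id: True
          have "?u (i - 1) = coeff f i" unfolding coords_def using True i id by auto
          then show ?thesis using param_poly_interpolates(2)[OF True inj' i id] by simp
        next
          case False
          then show ?thesis using degree_param_poly[of ?u] deg by (simp add: coeff_eq_0)
        qed
      qed
      fix k assume "k \<in> {..<n}"
      then have k: "k < n" by simp
      show "poly (param_poly ?u - f) (w k) = poly 0 (w k)"
        using param_poly_interpolates(1)[OF True inj' k] pt[OF k] pt[OF \<sigma>(1)[OF k]] step[OF k] by simp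
    qed (use inj True in auto)
    then show ?thesis by simp
  next
    case False
    have center: "center f = 0" using b(1) False unfolding base0_def by simp
    have sub: "coeff f (d - 1) = 0"
    proof -
      have "lead_coeff f \<noteq> 0" using deg d by auto
      then show ?thesis using center d by (simp add: center_def deg)
    qed
    have f: "f = low_part ?u + [:coeff f 0:]"
    proof (rule poly_eqI)
      fix i
      consider "i = 0" | "i \<in> {1..d}" | "i > d" by fastforce
      then show "coeff f i = coeff (low_part ?u + [:coeff f 0:]) i"
      proof cases
        case 1
        then show ?thesis unfolding coeff_add coeff_low_part by simp
      next
        case 2
        then have "coeff [:coeff f 0:] i = 0" by (cases i) auto
        moreover have "coeff (low_part ?u) i = coeff f i"
          using 2 sub d False unfolding coeff_low_part coords_def by auto
        ultimately show ?thesis by simp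
      next
        case 3
        then have "coeff [:coeff f 0:] i = 0" "coeff (low_part ?u) i = 0" "coeff f i = 0"
          using deg by (cases i, auto simp: coeff_low_part coeff_eq_0)
        then show ?thesis by simp
      qed
    qed
    have "coeff f 0 = 1 - (if n = 1 then poly (low_part ?u) 1 else 0)"
    proof (cases "n = 1")
      case True
      then have "w 0 = 1" using b(2) unfolding base1_def by simp
      moreover have "\<sigma> 0 = 0" using \<sigma>(1)[of 0] True by simp
      ultimately have "poly f 1 = 1" using step[of 0] True by simp
      moreover have "poly f 1 = poly (low_part ?u) 1 + coeff f 0" by (subst f) simp
      ultimately show ?thesis using True by (simp add: algebra_simps)
    next
      case n1: False
      then have "poly f 0 = 1" using b(2) False center unfolding base1_def by simp
      then show ?thesis using n1 by (simp add: poly_0_coeff_0)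
    qed
    then show ?thesis unfolding param_poly_def using False f by simp
  qed
  have "coords f w \<in> points CS" unfolding points_coordinate_space coords_def by simp
  moreover have "coeff f d \<noteq> 0" using deg d by auto
  ultimately show "coords f w \<in> \<Omega>"
    unfolding \<Omega>_def \<Omega>1_def using inj' P free by simp
qed

lemma coords_cong:
  "(\<And>k. k < n \<Longrightarrow> v k = w k) \<Longrightarrow> coords f v = coords f w"
  by (rule ext) (auto simp: coords_def)

subsection \<open>The slice is open in affine space\<close>

lemma regular_param_point: "(\<lambda>u. param_point u k) \<in> regular CS (points CS)"
proof -
  interpret ringed_space CS by (rule ringed_space_coordinate_space)
  have "(\<lambda>_. c) \<in> regular CS (points CS)" for c by (rule regular_const[OF openin_topspace])
  then show ?thesis
    unfolding param_point_def using regular_coordinate_space[of "k - 1"]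
    by (cases "n \<ge> 2"; cases "k = 0"; cases "k = 1") simp_all
qed

lemma open_\<Omega>1: "openin (zariski CS) \<Omega>1"
proof -
  interpret ringed_space CS by (rule ringed_space_coordinate_space)
  let ?K = "{(k, l) \<in> {..<n} \<times> {..<n}. k \<noteq> l}"
  have "finite ?K" by (rule finite_subset[of _ "{..<n} \<times> {..<n}"]) auto
  then have "openin (zariski CS) {u \<in> points CS. \<forall>p\<in>?K. param_point u (fst p) \<noteq> param_point u (snd p)}"
    by (rule openin_finite_Ball[OF openin_topspace]) (intro openin_distinct[OF openin_topspace] regular_param_point)
  moreover have "\<Omega>1 = {u \<in> points CS. \<forall>p\<in>?K. param_point u (fst p) \<noteq> param_point u (snd p)}"
    unfolding \<Omega>1_def inj_on_def by auto
  ultimately show ?thesis by simp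
qed

lemma regular_param_poly: "ringed_space.regular_family CS \<Omega>1 param_poly"
proof -
  interpret ringed_space CS by (rule ringed_space_coordinate_space)
  note o = open_\<Omega>1
  have sub: "\<Omega>1 \<subseteq> points CS" by (auto simp: \<Omega>1_def)
  have u: "(\<lambda>u. u k) \<in> regular CS \<Omega>1" for k
    by (rule regular_restrict[OF openin_topspace regular_coordinate_space o sub])
  have pt: "(\<lambda>u. param_point u k) \<in> regular CS \<Omega>1" for k
    by (rule regular_restrict[OF openin_topspace regular_param_point o sub])
  have top: "regular_family \<Omega>1 top_part"
    unfolding top_part_def by (intro regular_family_sum[OF o] regular_family_monom[OF o] u)
  have low: "regular_family \<Omega>1 low_part"
    unfolding low_part_def by (intro regular_family_sum[OF o] regular_family_monom[OF o] u)
  show ?thesis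
  proof (cases "n \<ge> 2")
    case True
    have lag: "regular_family \<Omega>1 (\<lambda>u. lagrange_basis {..<n} (param_point u) k)" if k: "k < n" for k
      unfolding lagrange_basis_def
    proof (rule regular_family_prod[OF o])
      fix l assume l: "l \<in> {..<n} - {k}"
      have "param_point u k - param_point u l \<noteq> 0" if "u \<in> \<Omega>1" for u
        using that l k by (auto simp: \<Omega>1_def inj_on_def)
      then have "(\<lambda>u. 1 / (param_point u k - param_point u l)) \<in> regular CS \<Omega>1"
        by (intro regular_divide[OF o regular_const[OF o]] regular_diff[OF o] pt)
      then show "regular_family \<Omega>1 (\<lambda>u. smult (1 / (param_point u k - param_point u l)) [:- param_point u l, 1:])"
        by (rule regular_family_smult[OF o])
          (rule regular_family_pCons[OF o regular_uminus[OF o pt] regular_family_const[OF o]])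
    qed
    have "regular_family \<Omega>1 (\<lambda>u. top_part u +
       (\<Sum>k<n. smult (param_point u (\<sigma> k) - poly (top_part u) (param_point u k))
             (lagrange_basis {..<n} (param_point u) k)))"
      by (intro regular_family_add[OF o] top regular_family_sum[OF o] regular_family_smult[OF o] lag
          regular_diff[OF o] pt regular_poly_eval[OF o top degree_top_part pt]) simp
    then show ?thesis using True by (simp add: param_poly_def[abs_def])
  next
    case False
    have e: "(\<lambda>u. poly (low_part u) 1) \<in> regular CS \<Omega>1"
      by (rule regular_poly_eval[OF o low degree_low_part regular_const[OF o]])
    have "(\<lambda>u. 1 - (if n = 1 then poly (low_part u) 1 else 0)) \<in> regular CS \<Omega>1"
      using regular_diff[OF o regular_const[OF o] e] regular_const[OF o] by (cases "n = 1") simp_all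
    then have "regular_family \<Omega>1 (\<lambda>u. low_part u + [:1 - (if n = 1 then poly (low_part u) 1 else 0):])"
      by (intro regular_family_add[OF o] low regular_family_pCons[OF o] regular_family_const[OF o])
    then show ?thesis using False by (simp add: param_poly_def[abs_def])
  qed
qed

lemma open_\<Omega>: "openin (zariski CS) \<Omega>"
proof -
  interpret ringed_space CS by (rule ringed_space_coordinate_space)
  let ?V = "{u \<in> \<Omega>1. coeff (param_poly u) d \<noteq> 0}"
  have co: "(\<lambda>u. coeff (param_poly u) i) \<in> regular CS \<Omega>1" for i
    using regular_param_poly[unfolded regular_family_def] by blast
  have V: "openin (zariski CS) ?V" by (rule openin_nonzero[OF open_\<Omega>1 co])
  have "?V \<subseteq> \<Omega>1" by blast
  from regular_restrict[OF open_\<Omega>1 co V this]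
  have "regular_family ?V param_poly" unfolding regular_family_def by blast
  moreover have "degree (param_poly u) = d" if "u \<in> ?V" for u
    using that degree_param_poly le_degree by (intro antisym) auto
  ultimately show ?thesis unfolding \<Omega>_def by (rule regular_normal_form(1)[OF V _ _ d])
qed

end

context stratum_chart
begin

subsection \<open>Strata are isomorphic to open subsets of affine space\<close>

definition param_marked where
  "param_marked u = marked_point (param_poly u) (\<lambda>i. param_point u (\<mu> i))"

lemma \<Omega>_subset: "\<Omega> \<subseteq> \<Omega>1" "\<Omega> \<subseteq> points CS"
  by (auto simp: \<Omega>_def \<Omega>1_def)

lemma param_marked_morphism: "morphism (subspace_of CS \<Omega>) X param_marked"
  unfolding param_marked_def
proof (rule marked_point_morphism[OF ringed_space_subspace_of])
  fix u assume "u \<in> points (subspace_of CS \<Omega>)"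
  then have "u \<in> \<Omega>" by (simp add: points_subspace_of)
  then have "cycles (param_poly u) (param_point u)" using slice_param(1) by (simp add: slice_def)
  then show "is_marked (param_poly u) (\<lambda>i. param_point u (\<mu> i))" by (rule marked_point_of_cycles(1))
next
  note res = regular_subspace_of[OF ringed_space_coordinate_space]
  have "(\<lambda>u. coeff (param_poly u) i) \<in> regular CS \<Omega>1" for i
    using regular_param_poly[unfolded ringed_space.regular_family_def[OF ringed_space_coordinate_space]] by blast
  from res[OF open_\<Omega>1 this \<Omega>_subset(1)]
  show "ringed_space.regular_family (subspace_of CS \<Omega>) (points (subspace_of CS \<Omega>)) param_poly"
    unfolding ringed_space.regular_family_def[OF ringed_space_subspace_of] points_subspace_of by blast
  show "(\<lambda>u. param_point u (\<mu> i)) \<in> regular (subspace_of CS \<Omega>) (points (subspace_of CS \<Omega>))" for i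
    unfolding points_subspace_of by (rule res[OF openin_topspace regular_param_point \<Omega>_subset(2)])
qed

lemma param_marked_in_U: "u \<in> \<Omega> \<Longrightarrow> param_marked u \<in> U"
  unfolding param_marked_def using slice_param(1) by (intro marked_point_of_cycles(2)) (simp add: slice_def)

definition slice_coords where "slice_coords x = coords (slice_poly x) (slice_point x)"

lemma slice_coords_in_\<Omega>: "x \<in> U \<Longrightarrow> slice_coords x \<in> \<Omega>"
  unfolding slice_coords_def by (rule param_coords(3)[OF slice_slice_point])

lemma param_marked_slice_coords:
  assumes x: "x \<in> U"
  shows "param_marked (slice_coords x) = x"
proof -
  note s = slice_slice_point[OF x]
  have "param_marked (slice_coords x) = marked_point (slice_poly x) (\<lambda>i. slice_point x (\<mu> i))"
    unfolding param_marked_def slice_coords_def param_coords(1)[OF s] marked_point_def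
    by (intro arg_cong2[of _ _ _ _ Pair] refl restrict_ext) (simp add: param_coords(2)[OF s \<mu>(1)])
  then show ?thesis by (simp add: marked_point_slice[OF x])
qed

lemma slice_coords_param_marked:
  assumes u: "u \<in> \<Omega>"
  shows "slice_coords (param_marked u) = u"
proof -
  note s = slice_param(1)[OF u]
  have "slice_coords (param_marked u) = coords (param_poly u) (slice_point (param_marked u))"
    unfolding slice_coords_def param_marked_def slice_of_marked_point(1)[OF s] ..
  also have "\<dots> = coords (param_poly u) (param_point u)"
    unfolding param_marked_def by (rule coords_cong) (rule slice_of_marked_point(2)[OF s])
  finally show ?thesis using slice_param(2)[OF u] by simp
qed

lemma \<Omega>_nonempty: "\<Omega> \<noteq> {}"
proof -
  have "x0 \<in> U" using x0 by (simp add: stratum_def)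
  then show ?thesis using slice_coords_in_\<Omega> by blast
qed

lemma irreducible_stratum: "irreducible_in (zariski X) U"
proof -
  have "irreducible_in (zariski CS) (\<Omega> \<inter> points CS)"
    using \<Omega>_nonempty \<Omega>_subset(2)
    by (intro irreducible_in_open_subset[OF irreducible_coordinate_space open_\<Omega>]) blast
  then have irr: "irreducible_in (zariski CS) \<Omega>" using \<Omega>_subset(2) by (simp add: Int_absorb2)
  have "irreducible_in (zariski (subspace_of CS \<Omega>)) \<Omega>"
    unfolding irreducible_in_def
  proof (intro conjI allI impI)
    show "\<Omega> \<subseteq> points (subspace_of CS \<Omega>)" by (simp add: points_subspace_of)
    fix V W assume "openin (zariski (subspace_of CS \<Omega>)) V" "openin (zariski (subspace_of CS \<Omega>)) W"
      and ne: "V \<inter> \<Omega> \<noteq> {}" "W \<inter> \<Omega> \<noteq> {}"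
    then obtain V' W' where "openin (zariski CS) V'" "V = V' \<inter> \<Omega>" "openin (zariski CS) W'" "W = W' \<inter> \<Omega>"
      unfolding openin_subspace_of[OF ringed_space_coordinate_space \<Omega>_subset(2)] by blast
    moreover from this ne have "V' \<inter> \<Omega> \<noteq> {}" "W' \<inter> \<Omega> \<noteq> {}" by auto
    ultimately have "V' \<inter> W' \<inter> \<Omega> \<noteq> {}" using irr unfolding irreducible_in_def by blast
    then show "V \<inter> W \<inter> \<Omega> \<noteq> {}" using \<open>V = V' \<inter> \<Omega>\<close> \<open>W = W' \<inter> \<Omega>\<close> by blast
  qed (rule \<Omega>_nonempty)
  moreover have "continuous_map (zariski (subspace_of CS \<Omega>)) (zariski X) param_marked"
    using param_marked_morphism by (simp add: morphism_def)
  ultimately have "irreducible_in (zariski X) (param_marked ` \<Omega>)" by (rule irreducible_in_image)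
  moreover have "param_marked ` \<Omega> = U"
  proof
    show "param_marked ` \<Omega> \<subseteq> U" using param_marked_in_U by blast
    show "U \<subseteq> param_marked ` \<Omega>"
    proof
      fix x assume "x \<in> U"
      then show "x \<in> param_marked ` \<Omega>"
        using param_marked_slice_coords slice_coords_in_\<Omega> by (intro image_eqI[of _ _ "slice_coords x"]) auto
    qed
  qed
  ultimately show ?thesis by simp
qed

lemma slice_coords_morphism:
  assumes S: "ringed_space S" "points S = U"
    and F: "ringed_space.regular_family S U point_poly"
    and z: "\<And>i. i \<in> {1..s} \<Longrightarrow> (\<lambda>x. point_mark x i) \<in> regular S U"
  shows "morphism S (subspace_of CS \<Omega>) slice_coords"
proof -
  interpret ringed_space S by (rule S(1))
  have o: "openin (zariski S) U" using openin_topspace[of "zariski S"] S(2) by simp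
  have cyc: "cycles (point_poly x) (cycle_point x)" if "x \<in> U" for x using that by (rule cycles_cycle_point)
  have deg: "degree (point_poly x) = d" if "x \<in> U" for x using cyc[OF that] by (simp add: cycles_def)
  have w: "(\<lambda>x. cycle_point x k) \<in> regular S U" if "k < n" for k
    unfolding cycle_point_def orbit_point_def
    by (rule regular_poly_iterate[OF o F _ z[OF \<tau>(1)[OF that]], of d]) (simp add: deg)
  have c: "(\<lambda>x. center (point_poly x)) \<in> regular S U"
    by (rule regular_normal_form(2)[OF o F deg d])
  have fc: "(\<lambda>x. poly (point_poly x) (center (point_poly x))) \<in> regular S U"
    by (rule regular_poly_eval[OF o F _ c, of d]) (simp add: deg)
  have b0: "(\<lambda>x. base0 (point_poly x) (cycle_point x)) \<in> regular S U"
    unfolding base0_def using w[of 0] c by (cases "n \<ge> 2") simp_all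
  have b1: "(\<lambda>x. base1 (point_poly x) (cycle_point x)) \<in> regular S U"
    unfolding base1_def using w[of 0] w[of 1] fc by (cases "n \<ge> 2"; cases "n = 1") simp_all
  have scale: "slice_scale \<in> regular S U"
    unfolding slice_scale_def[abs_def]
    by (intro regular_divide[OF o regular_const[OF o]] regular_diff[OF o] b0 b1)
      (use not_sym[OF base_distinct[OF cyc]] in simp)
  have shift: "slice_shift \<in> regular S U"
    unfolding slice_shift_def[abs_def] by (intro regular_mult[OF o] regular_uminus[OF o] b0 scale)
  have P: "regular_family U slice_poly"
    unfolding slice_poly_def[abs_def]
    by (rule regular_family_affine_conj[OF o F _ scale shift, of d]) (simp_all add: deg slice_scale_nonzero)
  have W: "(\<lambda>x. slice_point x k) \<in> regular S U" if "k < n" for k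
    unfolding slice_point_def by (intro regular_add[OF o] regular_mult[OF o] scale shift w that)
  have Pc: "(\<lambda>x. coeff (slice_poly x) i) \<in> regular S U" for i
    using P[unfolded regular_family_def] by blast
  have co: "(\<lambda>x. slice_coords x k) \<in> regular S U" for k
  proof (cases "k \<in> {1..d - 1}")
    case False
    show ?thesis unfolding slice_coords_def coords_def if_not_P[OF False] by (rule regular_const[OF o])
  next
    case True
    show ?thesis
    proof (cases "n \<ge> 2")
      case n: True
      show ?thesis
      proof (cases "k \<le> n - 2")
        case kn: True
        then have "k + 1 < n" using n by simp
        from W[OF this] show ?thesis
          unfolding slice_coords_def coords_def if_P[OF True] if_P[OF n] if_P[OF kn] .
      next
        case False
        show ?thesis unfolding slice_coords_def coords_def if_P[OF True] if_P[OF n] if_not_P[OF False] by (rule Pc)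
      qed
    next
      case False
      show ?thesis unfolding slice_coords_def coords_def if_P[OF True] if_not_P[OF False] by (rule Pc)
    qed
  qed
  have "morphism S CS slice_coords"
    unfolding coordinate_space_def
  proof (rule morphism_into_affine_space_on[OF S(1)])
    fix x assume "x \<in> points S"
    then have "slice_coords x \<in> points CS" using slice_coords_in_\<Omega> \<Omega>_subset(2) S(2) by blast
    then show "slice_coords x \<in> {u. \<forall>k. k \<notin> {1..d - 1} \<longrightarrow> u k = 0}"
      by (simp only: points_coordinate_space)
  next
    fix e :: "(nat \<Rightarrow> complex) \<Rightarrow> complex" assume "e \<in> {\<lambda>u. u k | k. k \<in> {1..d - 1}}"
    then obtain k where "e = (\<lambda>u. u k)" by blast
    then show "(\<lambda>x. e (slice_coords x)) \<in> regular S (points S)" using co S(2) by simp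
  qed
  then show ?thesis
    by (rule morphism_into_subspace_of[OF S(1)]) (simp add: S(2) slice_coords_in_\<Omega>)
qed

text \<open>
  Applied with the whole fibre product and with an irreducible component as \<open>Z\<close>. The hypotheses say
  that near the stratum a morphism into \<open>Z\<close> is the same as a morphism into the fibre product, so that
  the mutually inverse maps between stratum and slice are morphisms for \<open>Z\<close> too.
\<close>

lemma stratum_birational:
  fixes Z :: "(complex poly set \<times> (nat \<Rightarrow> (complex poly \<times> complex) set)) fun_space"
  assumes Z: "ringed_space Z" and inc: "morphism Z X (\<lambda>x. x)"
    and into: "\<And>T :: (nat \<Rightarrow> complex) fun_space. \<And>f. ringed_space T \<Longrightarrow> morphism T X f \<Longrightarrow> (\<And>x. x \<in> points T \<Longrightarrow> f x \<in> U) \<Longrightarrow> morphism T Z f"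
    and open_U: "openin (zariski Z) U" and dense: "zariski Z closure_of U = points Z"
  shows "birational Z (projective_space (d - 1))"
proof -
  let ?S = "subspace_of Z U"
  have U_X1: "U \<subseteq> free_locus" using exact_subset_free by (auto simp: stratum_def)
  have U_Z: "U \<subseteq> points Z" using openin_subset[OF open_U] .
  have reg: "g \<in> regular ?S U" if "g \<in> regular X free_locus" for g
  proof (rule regular_subspace_of[OF Z])
    show "openin (zariski Z) {x \<in> points Z. x \<in> free_locus}" by (rule morphism_openin[OF inc open_free_locus])
    show "g \<in> regular Z {x \<in> points Z. x \<in> free_locus}" using morphism_regular[OF inc open_free_locus that] by simp
    show "U \<subseteq> {x \<in> points Z. x \<in> free_locus}" using U_X1 U_Z by blast
  qed
  have "morphism ?S (subspace_of CS \<Omega>) slice_coords"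
  proof (rule slice_coords_morphism[OF ringed_space_subspace_of points_subspace_of])
    show "ringed_space.regular_family ?S U point_poly"
      unfolding ringed_space.regular_family_def[OF ringed_space_subspace_of]
      using regular_point_poly[unfolded ringed_space.regular_family_def[OF ringed_X]] reg by blast
    show "(\<lambda>x. point_mark x i) \<in> regular ?S U" if "i \<in> {1..s}" for i
      by (rule reg[OF regular_point_mark[OF that]])
  qed
  moreover have "morphism (subspace_of CS \<Omega>) ?S param_marked"
    by (intro morphism_into_subspace_of into ringed_space_subspace_of param_marked_morphism)
      (simp_all add: points_subspace_of param_marked_in_U)
  ultimately have "isomorphic ?S (subspace_of CS \<Omega>)"
    unfolding isomorphic_def
    by (intro exI[of _ slice_coords] exI[of _ param_marked])
      (simp add: points_subspace_of slice_coords_param_marked param_marked_slice_coords)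
  moreover obtain V where V: "openin (zariski (projective_space (d - 1))) V"
    "zariski (projective_space (d - 1)) closure_of V = points (projective_space (d - 1))"
    "isomorphic (subspace_of CS \<Omega>) (subspace_of (projective_space (d - 1)) V)"
    by (rule chart_projective_space[OF open_\<Omega> \<Omega>_nonempty]) blast
  ultimately have "isomorphic ?S (subspace_of (projective_space (d - 1)) V)"
    using isomorphic_trans by blast
  then show ?thesis unfolding birational_def using open_U dense V(1,2) by blast
qed

end

section \<open>Rationality\<close>

lemma irreducible_subset_finite_Union:
  assumes "finite \<K>" "irreducible_in T C" "\<And>K. K \<in> \<K> \<Longrightarrow> closedin T K" "C \<subseteq> \<Union>\<K>"
  shows "\<exists>K\<in>\<K>. C \<subseteq> K"
  using assms(1,3,4)
proof (induction \<K> rule: finite_induct)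
  case empty
  then show ?case using assms(2) by (auto simp: irreducible_in_def)
next
  case (insert K \<K>)
  show ?case
  proof (cases "C \<subseteq> K")
    case False
    have C: "C \<subseteq> topspace T" using assms(2) by (simp add: irreducible_in_def)
    have o: "openin T (topspace T - K)" "openin T (topspace T - \<Union>\<K>)"
      using insert.prems(1) insert.hyps(1) by (auto intro!: openin_diff closedin_Union)
    have "(topspace T - K) \<inter> (topspace T - \<Union>\<K>) \<inter> C = {}" using insert.prems(2) by blast
    moreover have "(topspace T - K) \<inter> C \<noteq> {}" using False C by blast
    ultimately have "(topspace T - \<Union>\<K>) \<inter> C = {}"
      using assms(2) o unfolding irreducible_in_def by blast
    then have "C \<subseteq> \<Union>\<K>" using C by blast
    then show ?thesis using insert.IH insert.prems(1) by blast
  qed blast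
qed

lemma irreducible_in_closure:
  assumes "irreducible_in T C"
  shows "irreducible_in T (T closure_of C)"
  unfolding irreducible_in_def
proof (intro conjI allI impI)
  have C: "C \<subseteq> topspace T" "C \<noteq> {}" using assms by (auto simp: irreducible_in_def)
  show "T closure_of C \<subseteq> topspace T" by (rule closure_of_subset_topspace)
  have sub: "C \<subseteq> T closure_of C" by (rule closure_of_subset[OF C(1)])
  show "T closure_of C \<noteq> {}" using C sub by blast
  fix U V assume U: "openin T U" and V: "openin T V"
    and "U \<inter> T closure_of C \<noteq> {}" "V \<inter> T closure_of C \<noteq> {}"
  then have "U \<inter> C \<noteq> {}" "V \<inter> C \<noteq> {}"
    using openin_Int_closure_of_eq_empty[OF U] openin_Int_closure_of_eq_empty[OF V] by auto
  then have "U \<inter> V \<inter> C \<noteq> {}" using assms U V unfolding irreducible_in_def by blast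
  then show "U \<inter> V \<inter> T closure_of C \<noteq> {}" using sub by blast
qed

context marked_moduli
begin

text \<open>
  The cycle points are the iterates \<open>(i, j)\<close> with \<open>j < N i\<close>, so there are at most \<open>\<Sum>N\<^sub>i\<close> of them. They are
  permuted since the iterate \<open>(i, N i)\<close> is \<open>(i, 0)\<close>.
\<close>

lemma exists_stratum_chart:
  assumes x0: "x0 \<in> exact_locus" and sum: "(\<Sum>i=1..s. N i) \<le> d + 1"
  shows "\<exists>n w0 \<sigma> \<mu> \<tau>. stratum_chart d s N x0 n w0 \<sigma> \<mu> \<tau>"
proof -
  let ?I = "Sigma {1..s} (\<lambda>i. {..<N i})"
  let ?W = "orbit_point x0 ` ?I"
  have fin: "finite ?I" by simp
  have "card ?W \<le> card ?I" by (rule card_image_le[OF fin])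
  also have "\<dots> = (\<Sum>i=1..s. N i)" by simp
  finally have n: "card ?W \<le> d + 1" using sum by simp
  obtain w where w: "bij_betw w {0..<card ?W} ?W" using ex_bij_betw_nat_finite[of ?W] fin by blast
  have inj: "inj_on w {..<card ?W}" using w by (simp add: bij_betw_def atLeast0LessThan)
  have img: "w ` {..<card ?W} = ?W" using w by (simp add: bij_betw_def atLeast0LessThan)
  have period: "exact_period (poly (point_poly x0)) (N i) (point_mark x0 i)" if "i \<in> {1..s}" for i
    using x0 that by (simp add: exact_locus_def)
  have in_W: "orbit_point x0 (i, j) \<in> ?W" if i: "i \<in> {1..s}" "j \<le> N i" for i j
  proof (cases "j < N i")
    case True
    then show ?thesis using i by (intro imageI) simp
  next
    case False
    then have "orbit_point x0 (i, j) = orbit_point x0 (i, 0)"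
      using i period[OF i(1)] by (simp add: orbit_point_def exact_period_def)
    moreover have "(i, 0) \<in> ?I" using i N_pos[OF i(1)] by simp
    ultimately show ?thesis by (metis imageI)
  qed
  have ex: "\<exists>k<card ?W. w k = y" if "y \<in> ?W" for y
  proof -
    have "y \<in> w ` {..<card ?W}" using that img by simp
    then show ?thesis by auto
  qed
  have "\<forall>k. \<exists>t. k < card ?W \<longrightarrow> t \<in> ?I \<and> orbit_point x0 t = w k"
  proof
    fix k
    show "\<exists>t. k < card ?W \<longrightarrow> t \<in> ?I \<and> orbit_point x0 t = w k"
    proof (cases "k < card ?W")
      case True
      then have "w k \<in> ?W" using img by (metis imageI lessThan_iff)
      then obtain t where "t \<in> ?I" "w k = orbit_point x0 t" by (rule imageE)
      then show ?thesis by metis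
    qed blast
  qed
  then obtain \<tau> where \<tau>: "\<And>k. k < card ?W \<Longrightarrow> \<tau> k \<in> ?I \<and> orbit_point x0 (\<tau> k) = w k" by metis
  have "\<forall>k. \<exists>l. k < card ?W \<longrightarrow> l < card ?W \<and> w l = poly (point_poly x0) (w k)"
  proof
    fix k
    show "\<exists>l. k < card ?W \<longrightarrow> l < card ?W \<and> w l = poly (point_poly x0) (w k)"
    proof (cases "k < card ?W")
      case True
      obtain i j where ij: "\<tau> k = (i, j)" by (cases "\<tau> k")
      then have "i \<in> {1..s}" "j < N i" using \<tau>[OF True] by auto
      then have "orbit_point x0 (i, Suc j) \<in> ?W" using in_W[of i "Suc j"] by simp
      moreover have "orbit_point x0 (i, Suc j) = poly (point_poly x0) (w k)"
        using \<tau>[OF True] ij by (simp add: orbit_point_def)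
      ultimately show ?thesis using ex by metis
    qed blast
  qed
  then obtain \<sigma> where \<sigma>: "\<And>k. k < card ?W \<Longrightarrow> \<sigma> k < card ?W \<and> w (\<sigma> k) = poly (point_poly x0) (w k)" by metis
  have "\<forall>i. \<exists>l. i \<in> {1..s} \<longrightarrow> l < card ?W \<and> w l = point_mark x0 i"
  proof
    fix i
    show "\<exists>l. i \<in> {1..s} \<longrightarrow> l < card ?W \<and> w l = point_mark x0 i"
    proof (cases "i \<in> {1..s}")
      case True
      then have "point_mark x0 i \<in> ?W" using in_W[of i 0] by (simp add: orbit_point_def)
      then show ?thesis using ex by metis
    qed blast
  qed
  then obtain \<mu> where \<mu>: "\<And>i. i \<in> {1..s} \<Longrightarrow> \<mu> i < card ?W \<and> w (\<mu> i) = point_mark x0 i" by metis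
  have \<tau>': "fst (\<tau> k) \<in> {1..s}" "snd (\<tau> k) < N (fst (\<tau> k))" "orbit_point x0 (\<tau> k) = w k" if "k < card ?W" for k
    using \<tau>[OF that] by (auto simp: mem_Sigma_iff split: prod.splits)
  have "stratum_chart d s N x0 (card ?W) w \<sigma> \<mu> \<tau>"
    by unfold_locales (use x0 n inj \<tau>' \<sigma> \<mu> in blast)+
  then show ?thesis by blast
qed

text \<open>
  All points of a cycle have the same exact period, so cycles of different periods are disjoint.
\<close>

lemma coincidences_of_distinct_periods:
  assumes inj: "inj_on N {1..s}" and x: "x \<in> exact_locus"
  shows "coincidences x =
    {(k, l) \<in> orbit_indices \<times> orbit_indices. fst k = fst l \<and> snd k mod N (fst k) = snd l mod N (fst l)}"
proof -
  let ?g = "poly (point_poly x)"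
  have period: "exact_period ?g (N i) (point_mark x i)" if "i \<in> {1..s}" for i
    using x that by (simp add: exact_locus_def)
  have reduce: "(?g ^^ j) (point_mark x i) = (?g ^^ (j mod N i)) (point_mark x i)" if "i \<in> {1..s}" for i j
    using funpow_mod_eq[of "N i" ?g "point_mark x i" j] period[OF that] by (simp add: exact_period_def)
  have compose: "(?g ^^ a) ((?g ^^ b) v) = (?g ^^ (a + b)) v" for a b v by (simp add: funpow_add)
  have returns: "(?g ^^ (j + (N i - 1) * j)) (point_mark x i) = point_mark x i" if "i \<in> {1..s}" for i j
  proof -
    have "j + (N i - 1) * j = N i * j" using N_pos[OF that] by (cases "N i") auto
    then show ?thesis using reduce[OF that, of "N i * j"] by simp
  qed
  have fixed: "exact_period ?g (N i) ((?g ^^ j) (point_mark x i))" if i: "i \<in> {1..s}" for i j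
    unfolding exact_period_def
  proof (intro conjI allI impI notI)
    show "(?g ^^ N i) ((?g ^^ j) (point_mark x i)) = (?g ^^ j) (point_mark x i)"
      using reduce[OF i, of "N i + j"] reduce[OF i, of j] by (simp add: funpow_add)
    fix m assume m: "0 < m" "m < N i" and eq: "(?g ^^ m) ((?g ^^ j) (point_mark x i)) = (?g ^^ j) (point_mark x i)"
    let ?r = "(N i - 1) * j"
    have "(?g ^^ m) (point_mark x i) = (?g ^^ m) ((?g ^^ (j + ?r)) (point_mark x i))" using returns[OF i] by simp
    also have "\<dots> = (?g ^^ ?r) ((?g ^^ m) ((?g ^^ j) (point_mark x i)))"
      by (simp only: compose add_ac)
    also have "\<dots> = (?g ^^ (j + ?r)) (point_mark x i)"
      unfolding eq by (simp only: compose add_ac)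
    also have "\<dots> = point_mark x i" by (rule returns[OF i])
    finally show False using period[OF i] m by (simp add: exact_period_def)
  qed
  have unique: "N i = N i'" if "i \<in> {1..s}" "i' \<in> {1..s}" "exact_period ?g (N i) v" "exact_period ?g (N i') v" for i i' v
  proof -
    have "\<not> N i < N i'" "\<not> N i' < N i"
      using that(3,4) N_pos[OF that(1)] N_pos[OF that(2)] by (auto simp: exact_period_def)
    then show ?thesis by simp
  qed
  have small: "a = b" if i: "i \<in> {1..s}" and ab: "a < N i" "b < N i" "a \<le> b"
    and eq: "(?g ^^ a) (point_mark x i) = (?g ^^ b) (point_mark x i)" for i a b
  proof (rule ccontr)
    assume "a \<noteq> b"
    then have "0 < b - a" "b - a < N i" using ab by auto
    moreover have "(?g ^^ (b - a)) ((?g ^^ a) (point_mark x i)) = (?g ^^ a) (point_mark x i)"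
      using compose[of "b - a" a "point_mark x i"] ab(3) unfolding eq by simp
    ultimately show False using fixed[OF i, of a] by (simp add: exact_period_def)
  qed
  have "orbit_point x (i, j) = orbit_point x (i', j') \<longleftrightarrow> i = i' \<and> j mod N i = j' mod N i'"
    if i: "i \<in> {1..s}" "i' \<in> {1..s}" for i j i' j'
  proof
    assume eq: "orbit_point x (i, j) = orbit_point x (i', j')"
    then have "exact_period ?g (N i) (orbit_point x (i, j))" "exact_period ?g (N i') (orbit_point x (i, j))"
      using fixed[OF i(1), of j] fixed[OF i(2), of j'] by (simp_all add: orbit_point_def)
    then have "N i = N i'" by (rule unique[OF i])
    then have "i = i'" using inj_onD[OF inj] i by blast
    have "(?g ^^ (j mod N i)) (point_mark x i) = (?g ^^ (j' mod N i)) (point_mark x i)"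
      using eq reduce[OF i(1), of j] reduce[OF i(1), of j'] \<open>i = i'\<close> by (simp add: orbit_point_def)
    moreover have "j mod N i < N i" "j' mod N i < N i" using N_pos[OF i(1)] by simp_all
    ultimately have "j mod N i = j' mod N i"
      using small[OF i(1), of "j mod N i" "j' mod N i"] small[OF i(1), of "j' mod N i" "j mod N i"] by fastforce
    then show "i = i' \<and> j mod N i = j' mod N i'" using \<open>i = i'\<close> by simp
  next
    assume "i = i' \<and> j mod N i = j' mod N i'"
    then have i': "i' = i" and m: "j mod N i = j' mod N i" by auto
    have "(?g ^^ j) (point_mark x i) = (?g ^^ (j' mod N i)) (point_mark x i)"
      unfolding m[symmetric] by (rule reduce[OF i(1)])
    also have "\<dots> = (?g ^^ j') (point_mark x i)" by (rule reduce[OF i(1), symmetric])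
    finally show "orbit_point x (i, j) = orbit_point x (i', j')"
      by (simp only: orbit_point_def i' fst_conv snd_conv)
  qed
  then show ?thesis unfolding coincidences_def orbit_indices_def by auto
qed

lemma birational_of_distinct_periods:
  assumes sum: "(\<Sum>i=1..s. N i) \<le> d + 1" and inj: "inj_on N {1..s}"
  shows "birational X (projective_space (d - 1))"
proof -
  obtain x0 where x0: "x0 \<in> exact_locus" using exact_locus_nonempty by blast
  obtain n w0 \<sigma> \<mu> \<tau> where "stratum_chart d s N x0 n w0 \<sigma> \<mu> \<tau>" using exists_stratum_chart[OF x0 sum] by blast
  then interpret stratum_chart d s N x0 n w0 \<sigma> \<mu> \<tau> .
  have U: "U = exact_locus"
    unfolding stratum_def using coincidences_of_distinct_periods[OF inj] x0 by auto
  have inc: "morphism X X (\<lambda>x. x)"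
    unfolding morphism_def
  proof (intro conjI allI impI ballI)
    fix V g assume V: "openin (zariski X) V" and g: "g \<in> regular X V"
    have "{x \<in> points X. x \<in> V} = V" using openin_subset[OF V] by blast
    then show "g \<circ> (\<lambda>x. x) \<in> regular X {x \<in> points X. x \<in> V}" using g by (simp add: comp_def)
  qed simp
  show ?thesis
    by (rule stratum_birational[OF ringed_X inc]) (use open_exact_locus exact_locus_dense U in auto)
qed

text \<open>
  The closures of the finitely many strata cover the fibre product. A component, being irreducible,
  lies in one of them, and equals it by maximality.
\<close>

lemma birational_component:
  assumes sum: "(\<Sum>i=1..s. N i) \<le> d + 1" and C: "irreducible_component X C"
  shows "birational (subspace_of X C) (projective_space (d - 1))"
proof -
  let ?cl = "\<lambda>A. zariski X closure_of A"
  have irrC: "irreducible_in (zariski X) C" and maxC: "\<And>D. irreducible_in (zariski X) D \<Longrightarrow> C \<subseteq> D \<Longrightarrow> D = C"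
    using C by (auto simp: irreducible_component_def)
  have CX: "C \<subseteq> points X" using irrC by (simp add: irreducible_in_def)
  let ?E = "coincidences ` exact_locus"
  have "?E \<subseteq> Pow (orbit_indices \<times> orbit_indices)" by (auto simp: coincidences_def)
  then have finE: "finite ?E" using finite_orbit_indices by (meson finite_Pow_iff finite_SigmaI finite_subset)
  have "exact_locus = (\<Union>E\<in>?E. stratum E)" by (auto simp: stratum_def)
  then have "points X = ?cl (\<Union>E\<in>?E. stratum E)" using exact_locus_dense by simp
  also have "\<dots> = (\<Union>B\<in>stratum ` ?E. ?cl B)"
    using closure_of_Union[of "stratum ` ?E" "zariski X"] finE by simp
  finally have "C \<subseteq> \<Union>(?cl ` stratum ` ?E)" using CX by simp
  moreover have "finite (?cl ` stratum ` ?E)" using finE by simp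
  moreover have "closedin (zariski X) K" if "K \<in> ?cl ` stratum ` ?E" for K
    using that by (elim imageE) simp
  ultimately have "\<exists>K\<in>?cl ` stratum ` ?E. C \<subseteq> K"
    by (intro irreducible_subset_finite_Union[OF _ irrC])
  then obtain x0 where "x0 \<in> exact_locus" and C_sub: "C \<subseteq> ?cl (stratum (coincidences x0))"
    by (elim bexE imageE) simp
  obtain n w0 \<sigma> \<mu> \<tau> where "stratum_chart d s N x0 n w0 \<sigma> \<mu> \<tau>" using exists_stratum_chart[OF \<open>x0 \<in> exact_locus\<close> sum] by blast
  then interpret stratum_chart d s N x0 n w0 \<sigma> \<mu> \<tau> .
  have C_eq: "?cl U = C" using maxC[OF irreducible_in_closure[OF irreducible_stratum] C_sub] .
  have UC: "U \<subseteq> C"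
    using closure_of_subset[of U "zariski X"] irreducible_stratum C_eq by (simp add: irreducible_in_def)
  obtain W where W: "openin (zariski X) W" "U = W \<inter> C"
    using stratum_locally_closed[of "coincidences x0"] C_eq by metis
  show ?thesis
  proof (rule stratum_birational[OF ringed_space_subspace_of morphism_inclusion[OF ringed_X CX]])
    fix T :: "(nat \<Rightarrow> complex) fun_space" and f
    assume "ringed_space T" "morphism T X f" "\<And>x. x \<in> points T \<Longrightarrow> f x \<in> U"
    then show "morphism T (subspace_of X C) f" using UC by (intro morphism_into_subspace_of) blast+
  next
    show "openin (zariski (subspace_of X C)) U"
      unfolding openin_subspace_of[OF ringed_X CX] using W by blast
    show "zariski (subspace_of X C) closure_of U = points (subspace_of X C)"
      unfolding dense_intersects_open
    proof (intro allI impI)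
      fix V assume "openin (zariski (subspace_of X C)) V \<and> V \<noteq> {}"
      then obtain V' where V': "openin (zariski X) V'" "V = V' \<inter> C" "V' \<inter> C \<noteq> {}"
        unfolding openin_subspace_of[OF ringed_X CX] by blast
      then have "V' \<inter> U \<noteq> {}" using openin_Int_closure_of_eq_empty[OF V'(1), of U] C_eq by simp
      then show "U \<inter> V \<noteq> {}" using V'(2) UC by blast
    qed
  qed
qed

end

theorem theorem4:
  fixes d s :: nat and N :: "nat \<Rightarrow> nat"
  assumes "d \<ge> 2"
    and "\<And>i. i \<in> {1..s} \<Longrightarrow> N i \<ge> 1"
    and "(\<Sum>i=1..s. N i) \<le> d + 1"
  shows "(inj_on N {1..s} \<longrightarrow>
            birational (marked_fibre_product d s N) (projective_space (d - 1))) \<and>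
         (\<forall>C. irreducible_component (marked_fibre_product d s N) C \<longrightarrow>
            birational (subspace_of (marked_fibre_product d s N) C) (projective_space (d - 1)))"
proof -
  interpret marked_moduli d s N by unfold_locales (use assms in auto)
  show ?thesis using birational_of_distinct_periods[OF assms(3)] birational_component[OF assms(3)] by blast
qed

end
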